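(* Define for every $n \in \mathbb{Z}$ the probability measure $\mu_n$ on $\{0,1\}$ given by $$\mu_n(0) = \begin{cases} \frac{1}{2} + \frac{1}{6 \sqrt{n}} & \text{if } n \geq 1,\\ \frac{1}{2} & \text{if } n \leq 0.\end{cases}$$ The associated Bernoulli shift $T$ on $(X,\mu) = \prod_{n \in \mathbb{Z}} (\{0,1\},\mu_n)$ is (nonsingular,) essentially free, ergodic, of type III$_1$ and with weakly mixing Maharam extension, but for $m$ large enough (in particular for all $m \geq 73$), the $m$-th power transformation $$T \times \cdots \times T : X^m \to X^m : (x_1,\ldots,x_m) \mapsto (T(x_1),\ldots,T(x_m))$$ is dissipative.
   Context: The Bernoulli shift is $(T x)_n = x_{n-1}$; it is the transformation given by $1 \in \mathbb{Z}$ in the Bernoulli action $(k\cdot x)_n = x_{n-k}$ of $\mathbb{Z}$. A nonsingular invertible transformation is identified with the nonsingular action of $\mathbb{Z}$ it generates, and $X^m$ carries the measure $\mu^m$. A nonsingular action $G \curvearrowright (X,\mu)$ is dissipative if there exists a Borel set $\mathcal{U} \subset X$ such that all $g \cdot \mathcal{U}$, $g \in G$, are disjoint and $\bigcup_{g \in G} g \cdot \mathcal{U} = X$ up to measure zero. For a nonsingular action $G \curvearrowright (X,\mu)$ of a countable group, the Radon-Nikodym cocycle $\omega : G \times X \to (0,\infty)$ is determined by $\int_X f(x)\,\omega(g,x)\,d\mu(x) = \int_X f(g^{-1}\cdot x)\,d\mu(x)$ for all positive Borel $f$. The Maharam extension is the measure preserving action $G \curvearrowright (X \times \mathbb{R},\mu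 \times \nu)$ given by $g \cdot (x,s) = (g\cdot x, \log(\omega(g,x)) + s)$, with $d\nu(s) = \exp(-s)\,ds$. An essentially free ergodic nonsingular action is of type III$_1$ if and only if its Maharam extension is ergodic. A nonsingular action $G \curvearrowright (Z,\zeta)$ on a ($\sigma$-finite) measure space is weakly mixing if for every ergodic probability measure preserving action $G \curvearrowright (Y,\eta)$ on a standard probability space, the diagonal action $G \curvearrowright (Y \times Z,\eta\times\zeta)$ is ergodic. *)

theory Defs
  imports "HOL-Probability.Probability"
begin

text \<open>
  Group actions are written additively: \<open>a g x\<close> is $g \cdot x$, the unit of the group is \<open>0\<close> and
  $g^{-1}$ is \<open>- g\<close>; the class \<open>group_add\<close> does not assume commutativity. Only the values of
  \<open>a g\<close> on \<open>space M\<close> matter.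
\<close>

definition measurable_action :: "('g :: {group_add,countable} \<Rightarrow> 'x \<Rightarrow> 'x) \<Rightarrow> 'x measure \<Rightarrow> bool" where
  "measurable_action a M \<longleftrightarrow>
     (\<forall>g. a g \<in> M \<rightarrow>\<^sub>M M) \<and>
     (\<forall>x\<in>space M. a 0 x = x) \<and>
     (\<forall>g h. \<forall>x\<in>space M. a (g + h) x = a g (a h x))"

definition nonsingular_action :: "('g :: {group_add,countable} \<Rightarrow> 'x \<Rightarrow> 'x) \<Rightarrow> 'x measure \<Rightarrow> bool" where
  "nonsingular_action a M \<longleftrightarrow>
     measurable_action a M \<and> (\<forall>g. null_sets (distr M M (a g)) = null_sets M)"

definition measure_preserving_action :: "('g :: {group_add,countable} \<Rightarrow> 'x \<Rightarrow> 'x) \<Rightarrow> 'x measure \<Rightarrow> bool" where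
  "measure_preserving_action a M \<longleftrightarrow>
     measurable_action a M \<and> (\<forall>g. distr M M (a g) = M)"

definition essentially_free :: "('g :: {group_add,countable} \<Rightarrow> 'x \<Rightarrow> 'x) \<Rightarrow> 'x measure \<Rightarrow> bool" where
  "essentially_free a M \<longleftrightarrow> (AE x in M. \<forall>g. a g x = x \<longrightarrow> g = 0)"

text \<open>
  Invariance is taken up to null sets, so that the notion is also meaningful for maps that satisfy
  the action identities only almost everywhere, such as the Maharam extension below. For a
  nonsingular action of a countable group, every set that is invariant in this sense differs by a
  null set from a strictly invariant one.
\<close>

definition ergodic_action :: "('g :: {group_add,countable} \<Rightarrow> 'x \<Rightarrow> 'x) \<Rightarrow> 'x measure \<Rightarrow> bool" where
  "ergodic_action a M \<longleftrightarrow>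
     (\<forall>A\<in>sets M. (\<forall>g. sym_diff (a g -` A \<inter> space M) A \<in> null_sets M) \<longrightarrow>
        A \<in> null_sets M \<or> space M - A \<in> null_sets M)"

definition dissipative_action :: "('g :: {group_add,countable} \<Rightarrow> 'x \<Rightarrow> 'x) \<Rightarrow> 'x measure \<Rightarrow> bool" where
  "dissipative_action a M \<longleftrightarrow>
     nonsingular_action a M \<and>
     (\<exists>U\<in>sets M. disjoint_family (\<lambda>g. a g ` U) \<and> space M - (\<Union>g. a g ` U) \<in> null_sets M)"

text \<open>
  $\omega(g,\cdot)$ is the Radon-Nikodym derivative of the image of \<open>M\<close> under $g^{-1}$, which is the
  measure $f \mapsto \int f(g^{-1} \cdot x) \, d\mu(x)$. The value \<open>1\<close> is only used on a null set, to
  have values in $(0,\infty)$ everywhere.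
\<close>

definition rn_cocycle :: "('g :: {group_add,countable} \<Rightarrow> 'x \<Rightarrow> 'x) \<Rightarrow> 'x measure \<Rightarrow> 'g \<Rightarrow> 'x \<Rightarrow> real" where
  "rn_cocycle a M g x =
     (let d = RN_deriv M (distr M M (a (- g))) x in if 0 < d \<and> d < \<infinity> then enn2real d else 1)"

lemma rn_cocycle_pos: "0 < rn_cocycle a M g x"
  by (auto simp: rn_cocycle_def Let_def enn2real_positive_iff top.not_eq_extremum)

lemma rn_cocycle_nn_integral:
  assumes "prob_space M" "nonsingular_action a M" "f \<in> borel_measurable M"
  shows "(\<integral>\<^sup>+x. f x * ennreal (rn_cocycle a M g x) \<partial>M) = (\<integral>\<^sup>+x. f (a (- g) x) \<partial>M)"
proof -
  interpret prob_space M by fact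
  have [measurable]: "a (- g) \<in> M \<rightarrow>\<^sub>M M"
    using assms(2) by (auto simp: nonsingular_action_def measurable_action_def)
  note [measurable] = assms(3)
  define N where "N = distr M M (a (- g))"
  have null: "null_sets N = null_sets M"
    using assms(2) by (auto simp: nonsingular_action_def N_def)
  have ac: "absolutely_continuous M N" and sets: "sets N = sets M"
    by (auto simp: absolutely_continuous_def null) (auto simp: N_def)
  interpret N: prob_space N
    unfolding N_def by (rule prob_space_distr) measurable
  have dens: "density M (RN_deriv M N) = N"
    by (rule density_RN_deriv[OF ac sets])
  have fin: "AE x in M. RN_deriv M N x \<noteq> \<infinity>"
    by (rule RN_deriv_finite[OF N.sigma_finite_measure_axioms ac sets])
  let ?Z = "{x \<in> space M. RN_deriv M N x = 0}"
  have "emeasure N ?Z = (\<integral>\<^sup>+x. RN_deriv M N x * indicator ?Z x \<partial>M)"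
    by (subst dens[symmetric], subst emeasure_density) auto
  also have "\<dots> = (\<integral>\<^sup>+x. 0 \<partial>M)"
    by (rule nn_integral_cong) (auto simp: indicator_def)
  finally have "?Z \<in> null_sets N"
    by (auto simp: null_sets_def sets)
  then have pos: "AE x in M. RN_deriv M N x \<noteq> 0"
    by (subst AE_iff_null) (auto simp: null)
  have "AE x in M. ennreal (rn_cocycle a M g x) = RN_deriv M N x"
    using fin pos
    by eventually_elim (auto simp: rn_cocycle_def N_def Let_def top.not_eq_extremum zero_less_iff_neq_zero)
  then have "(\<integral>\<^sup>+x. f x * ennreal (rn_cocycle a M g x) \<partial>M) = (\<integral>\<^sup>+x. RN_deriv M N x * f x \<partial>M)"
    by (intro nn_integral_cong_AE) (auto simp: mult.commute)
  also have "\<dots> = (\<integral>\<^sup>+x. f x \<partial>N)"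
    by (subst (2) dens[symmetric], subst nn_integral_density) auto
  also have "\<dots> = (\<integral>\<^sup>+x. f (a (- g) x) \<partial>M)"
    unfolding N_def by (subst nn_integral_distr) auto
  finally show ?thesis .
qed

definition maharam_measure :: "'x measure \<Rightarrow> ('x \<times> real) measure" where
  "maharam_measure M = M \<Otimes>\<^sub>M density lborel (\<lambda>s. ennreal (exp (- s)))"

definition maharam_extension ::
    "('g :: {group_add,countable} \<Rightarrow> 'x \<Rightarrow> 'x) \<Rightarrow> 'x measure \<Rightarrow> 'g \<Rightarrow> 'x \<times> real \<Rightarrow> 'x \<times> real" where
  "maharam_extension a M g = (\<lambda>(x, s). (a g x, ln (rn_cocycle a M g x) + s))"

definition type_III_1 :: "('g :: {group_add,countable} \<Rightarrow> 'x \<Rightarrow> 'x) \<Rightarrow> 'x measure \<Rightarrow> bool" where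
  "type_III_1 a M \<longleftrightarrow>
     nonsingular_action a M \<and> essentially_free a M \<and> ergodic_action a M \<and>
     ergodic_action (maharam_extension a M) (maharam_measure M)"

definition standard_borel_space :: "'y measure \<Rightarrow> bool" where
  "standard_borel_space M \<longleftrightarrow>
     (\<exists>S. completely_metrizable_space S \<and> second_countable S \<and> topspace S = space M \<and>
        sets M = sigma_sets (space M) (Collect (openin S)))"

definition diagonal_action :: "('g \<Rightarrow> 'y \<Rightarrow> 'y) \<Rightarrow> ('g \<Rightarrow> 'z \<Rightarrow> 'z) \<Rightarrow> 'g \<Rightarrow> 'y \<times> 'z \<Rightarrow> 'y \<times> 'z" where
  "diagonal_action b a g = (\<lambda>(y, z). (b g y, a g z))"

text \<open>
  The type argument is the type in which the spaces $Y$ live. Weak mixing is the statement for all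
  types \<open>'y\<close>, expressed by leaving \<open>'y\<close> free in a theorem that has weak mixing as its conclusion.
\<close>

definition weakly_mixing ::
    "'y itself \<Rightarrow> ('g :: {group_add,countable} \<Rightarrow> 'z \<Rightarrow> 'z) \<Rightarrow> 'z measure \<Rightarrow> bool" where
  "weakly_mixing TYPE('y) a Z \<longleftrightarrow>
     (\<forall>(Y :: 'y measure) b.
        standard_borel_space Y \<and> prob_space Y \<and> measure_preserving_action b Y \<and> ergodic_action b Y \<longrightarrow>
        ergodic_action (diagonal_action b a) (Y \<Otimes>\<^sub>M Z))"

definition generated_action :: "'x measure \<Rightarrow> ('x \<Rightarrow> 'x) \<Rightarrow> int \<Rightarrow> 'x \<Rightarrow> 'x" where
  "generated_action M T k =
     (if 0 \<le> k then T ^^ nat k else inv_into (space M) T ^^ nat (- k))"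

definition power_measure :: "nat \<Rightarrow> 'x measure \<Rightarrow> (nat \<Rightarrow> 'x) measure" where
  "power_measure m M = PiM {..<m} (\<lambda>_. M)"

definition power_transformation :: "nat \<Rightarrow> ('x \<Rightarrow> 'x) \<Rightarrow> (nat \<Rightarrow> 'x) \<Rightarrow> nat \<Rightarrow> 'x" where
  "power_transformation m T x = (\<lambda>i\<in>{..<m}. T (x i))"

definition bernoulli_shift :: "(int \<Rightarrow> 'b) \<Rightarrow> int \<Rightarrow> 'b" where
  "bernoulli_shift x n = x (n - 1)"

text \<open>The two points $0$ and $1$ are \<open>False\<close> and \<open>True\<close>.\<close>

definition marginal_zero :: "int \<Rightarrow> real" where
  "marginal_zero n = (if n \<ge> 1 then 1 / 2 + 1 / (6 * sqrt (real_of_int n)) else 1 / 2)"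

definition marginal :: "int \<Rightarrow> bool measure" where
  "marginal n = measure_pmf (bernoulli_pmf (1 - marginal_zero n))"

lemma marginal_zero_bounds: "0 \<le> marginal_zero n" "marginal_zero n \<le> 1"
proof -
  have "1 \<le> sqrt (real_of_int n)" if "n \<ge> 1"
    using that by simp
  then have "1 / (6 * sqrt (real_of_int n)) \<in> {0..1 / 6}" if "n \<ge> 1"
    using that by (auto simp: divide_simps)
  then show "0 \<le> marginal_zero n" "marginal_zero n \<le> 1"
    by (fastforce simp: marginal_zero_def)+
qed

lemma emeasure_marginal:
  "emeasure (marginal n) {False} = marginal_zero n"
  "emeasure (marginal n) {True} = 1 - marginal_zero n"
  using marginal_zero_bounds[of n] by (auto simp: marginal_def emeasure_pmf_single)

definition bernoulli_measure :: "(int \<Rightarrow> bool) measure" where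
  "bernoulli_measure = PiM UNIV marginal"

definition bernoulli_action :: "int \<Rightarrow> (int \<Rightarrow> bool) \<Rightarrow> int \<Rightarrow> bool" where
  "bernoulli_action = generated_action bernoulli_measure bernoulli_shift"

lemma bernoulli_action_apply:
  "bernoulli_action k x = (\<lambda>n. x (n - k))"
proof -
  have space: "space bernoulli_measure = UNIV"
    by (simp add: bernoulli_measure_def marginal_def space_PiM PiE_UNIV_domain)
  have inv: "inv bernoulli_shift = (\<lambda>(x :: int \<Rightarrow> bool) n. x (n + 1))"
    by (rule inv_equality) (auto simp: bernoulli_shift_def)
  have "(bernoulli_shift ^^ j) x = (\<lambda>n. x (n - int j))" for j
    by (induction j) (auto simp: bernoulli_shift_def fun_eq_iff algebra_simps)
  moreover have "(inv bernoulli_shift ^^ j) x = (\<lambda>n. x (n + int j))" for j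
    by (induction j) (auto simp: inv fun_eq_iff algebra_simps)
  ultimately show ?thesis
    by (simp add: bernoulli_action_def generated_action_def space)
qed

end

theory Submission
  imports Defs
begin

text \<open>
  Write $\mu_n$ for the law of the $n$-th coin and $\mu$ for their product. Since the biases have
  bounded variation, the product $\prod_n \mu_{n+k}(x_n) / \mu_n(x_n)$ converges at every point, and it
  is the Radon-Nikodym cocycle (\<open>density_log_cocycle\<close>). Its integrals are products over the
  coins. Its square root has integral at most $|k|^{-1/72}$, so that for $m \ge 73$ the cocycle of the
  $m$-th power is at least 1 only finitely often along almost every orbit; the points for
  which time 0 is the first time at which it is maximal then form a fundamental domain
  (\<open>dissipative_power_action\<close>).
  On the other hand its inverse has integral at most of order $|k|^{1/4}$, so that a single copy of
  the shift returns often, and so does its Maharam extension.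

  For the ergodic statements, multiply the Maharam extension by an ergodic probability measure
  preserving action on $Y$, and let $f$ be the indicator of an invariant set, as a function of
  $x$, $y$ and of the level $s \in \mathbb{R}$. Three steps show that $f$ is a function of $y$ alone,
  which is then constant by ergodicity of $Y$.

  (1) The coins with $n \le 0$ are fair. Let $Q_L$ be the conditional expectation of $f$ given $y$, $s$
  and the coordinates $n > -L$. The increments of this martingale are orthogonal, and by invariance of
  $f$ they are carried to each other by the dynamics. So their sum controls the number of visits of an
  orbit to a set of finite measure, weighted by the first increment; these visits are too frequent
  unless the increment vanishes (\<open>past_average_increment_null\<close>). Hence $f = Q_0$ does not
  depend on the coordinates $n \le 0$.

  (2) Applying the inverse of the shift $M$ times, $f$ depends on the coordinates $n \le M$ only
  through the level, which they move by \<open>cylinder_weight\<close>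
  (\<open>past_average_skew_mix\<close>). Averaging over $x$ gives functions $g_M$ of the level with
  $g_M(u) = \sum_b \mu_{M+1}(b) g_{M+1}(u - w_{M+1}(b))$, where $w_n$ is \<open>log_weight\<close>. The steps
  $w_n(0) - w_n(1)$ are of order $n^{-1/2}$: they tend to 0 and their squares have infinite sum.
  Two independent walks with these steps therefore come arbitrarily close to each other, and $g_M$ is
  constant (\<open>harmonic_family_constant\<close>).

  (3) So the integral of $f$ over a product of sets in $x$ and $y$ and of an interval of levels is
  proportional to the measure of the first set and invariant under translation of the interval. This
  determines $f$ as a function of $y$ (\<open>invariant_eq_base_part\<close>).

  The action on one point in the place of $Y$ gives ergodicity of the Maharam extension, hence type
  III$_1$ and ergodicity of the shift itself.
\<close>

notation bernoulli_measure ("\<mu>")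

section \<open>Products of independent coins\<close>

definition coin_product :: "(int \<Rightarrow> bool pmf) \<Rightarrow> (int \<Rightarrow> bool) measure" where
  "coin_product p = PiM UNIV (\<lambda>n. measure_pmf (p n))"

abbreviation cantor_borel :: "(int \<Rightarrow> bool) measure" where
  "cantor_borel \<equiv> PiM UNIV (\<lambda>_. count_space UNIV)"

lemma sets_coin_product [measurable_cong]: "sets (coin_product p) = sets cantor_borel"
  unfolding coin_product_def by (intro sets_PiM_cong) auto

lemma space_coin_product [simp]: "space (coin_product p) = UNIV"
  by (auto simp: coin_product_def space_PiM)

lemma prob_space_coin_product: "prob_space (coin_product p)"
  unfolding coin_product_def by (intro prob_space_PiM) (rule prob_space_measure_pmf)

lemma emeasure_coin_product_UNIV [simp]: "emeasure (coin_product p) UNIV = 1"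
  using prob_space.emeasure_space_1[OF prob_space_coin_product, of p] by simp

lemma measurable_coordinate: "(\<lambda>x. x n) \<in> cantor_borel \<rightarrow>\<^sub>M count_space UNIV"
  by (rule measurable_component_singleton) simp

lemma measurable_coordinatewise:
  fixes f :: "'a \<Rightarrow> int \<Rightarrow> bool"
  assumes "\<And>n. (\<lambda>z. f z n) \<in> N \<rightarrow>\<^sub>M count_space UNIV"
  shows "f \<in> N \<rightarrow>\<^sub>M cantor_borel"
  by (rule measurable_PiM_single') (use assms in auto)

lemma cylinder_measurable:
  assumes "countable J"
  shows "{x :: int \<Rightarrow> bool. \<forall>j\<in>J. x j \<in> F j} \<in> sets cantor_borel"
proof -
  have "(\<lambda>x. x j \<in> F j) \<in> cantor_borel \<rightarrow>\<^sub>M count_space UNIV" for j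
    by (rule measurable_compose[OF measurable_coordinate]) simp
  then have "{x \<in> space cantor_borel. \<forall>j\<in>J. x j \<in> F j} \<in> sets cantor_borel"
    using assms by (intro sets.sets_Collect_countable_Ball) (auto simp: pred_def)
  then show ?thesis by (simp add: space_PiM)
qed

lemma prod_emb_eq_cylinder:
  "prod_emb UNIV (\<lambda>n. measure_pmf (p n)) J (Pi\<^sub>E J F) = {x. \<forall>j\<in>J. x j \<in> F j}"
  by (auto simp: prod_emb_def PiE_iff)

lemma emeasure_cylinder:
  assumes "finite J"
  shows "emeasure (coin_product p) {x. \<forall>j\<in>J. x j \<in> F j} = (\<Prod>j\<in>J. emeasure (p j) (F j))"
  using emeasure_PiM_emb[of UNIV "\<lambda>n. measure_pmf (p n)" J F] assms
  by (simp add: prob_space_measure_pmf coin_product_def prod_emb_eq_cylinder)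

lemma measure_eqI_cylinder:
  assumes "sets P = sets cantor_borel" "sets Q = sets cantor_borel" "finite_measure P"
    and "\<And>J F. finite J \<Longrightarrow> emeasure P {x. \<forall>j\<in>J. x j \<in> F j} = emeasure Q {x. \<forall>j\<in>J. x j \<in> F j}"
  shows "P = Q"
proof (rule measure_eqI_PiM_infinite[where I = UNIV and M = "\<lambda>_. count_space UNIV"])
  fix A :: "int \<Rightarrow> bool set" and J :: "int set" assume "finite J"
  moreover have "prod_emb UNIV (\<lambda>_. count_space UNIV) J (Pi\<^sub>E J A) = {x. \<forall>j\<in>J. x j \<in> A j}"
    by (auto simp: prod_emb_def PiE_iff)
  ultimately show "emeasure P (prod_emb UNIV (\<lambda>_. count_space UNIV) J (Pi\<^sub>E J A))
      = emeasure Q (prod_emb UNIV (\<lambda>_. count_space UNIV) J (Pi\<^sub>E J A))"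
    using assms(4)[of J A] by simp
qed (use assms in auto)

lemma coin_product_eqI:
  fixes p :: "int \<Rightarrow> bool pmf"
  assumes "sets P = sets cantor_borel"
    and "\<And>J F. finite J \<Longrightarrow> emeasure P {x. \<forall>j\<in>J. x j \<in> F j} = (\<Prod>j\<in>J. emeasure (p j) (F j))"
  shows "P = coin_product p"
proof -
  have "coin_product p = P"
    by (rule measure_eqI_cylinder)
      (use assms prob_space_coin_product[of p] in \<open>auto simp: sets_coin_product emeasure_cylinder prob_space_def\<close>)
  then show ?thesis ..
qed

lemma nn_integral_coin_product_prod:
  fixes f :: "int \<Rightarrow> bool \<Rightarrow> ennreal"
  assumes J: "finite J"
  shows "(\<integral>\<^sup>+x. (\<Prod>n\<in>J. f n (x n)) \<partial>coin_product p) = (\<Prod>n\<in>J. \<integral>\<^sup>+b. f n b \<partial>measure_pmf (p n))"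
proof -
  interpret product_prob_space "\<lambda>n. measure_pmf (p n)" UNIV
    by standard
  have [measurable]: "(\<lambda>x. \<Prod>n\<in>J. f n (x n)) \<in> borel_measurable (PiM J (\<lambda>n. measure_pmf (p n)))"
    by (intro borel_measurable_prod_ennreal measurable_compose[OF measurable_component_singleton]) auto
  have "(\<integral>\<^sup>+x. (\<Prod>n\<in>J. f n (x n)) \<partial>coin_product p)
      = (\<integral>\<^sup>+x. (\<Prod>n\<in>J. f n (restrict x J n)) \<partial>PiM UNIV (\<lambda>n. measure_pmf (p n)))"
    unfolding coin_product_def by (intro nn_integral_cong prod.cong) auto
  also have "\<dots> = (\<integral>\<^sup>+x. (\<Prod>n\<in>J. f n (x n)) \<partial>distr (PiM UNIV (\<lambda>n. measure_pmf (p n))) (PiM J (\<lambda>n. measure_pmf (p n))) (\<lambda>x. restrict x J))"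
    by (subst nn_integral_distr) auto
  also have "\<dots> = (\<integral>\<^sup>+x. (\<Prod>n\<in>J. f n (x n)) \<partial>PiM J (\<lambda>n. measure_pmf (p n)))"
    by (subst distr_PiM_restrict_finite[OF J]) auto
  also have "\<dots> = (\<Prod>n\<in>J. \<integral>\<^sup>+b. f n b \<partial>measure_pmf (p n))"
    by (intro product_nn_integral_prod J) auto
  finally show ?thesis .
qed

definition coord_shift :: "int \<Rightarrow> (int \<Rightarrow> 'b) \<Rightarrow> int \<Rightarrow> 'b" where
  "coord_shift k x = (\<lambda>n. x (n - k))"

lemma coord_shift_add: "coord_shift (k + l) x = coord_shift k (coord_shift l x)"
  by (auto simp: coord_shift_def algebra_simps)

lemma coord_shift_0 [simp]: "coord_shift 0 x = x"
  by (auto simp: coord_shift_def)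

lemma coord_shift_measurable [measurable]: "coord_shift k \<in> cantor_borel \<rightarrow>\<^sub>M cantor_borel"
  unfolding coord_shift_def by (intro measurable_coordinatewise measurable_coordinate)

lemma distr_shift: "distr (coin_product p) cantor_borel (coord_shift k) = coin_product (\<lambda>n. p (n - k))"
proof (rule coin_product_eqI)
  fix J :: "int set" and F :: "int \<Rightarrow> bool set" assume J: "finite J"
  have "emeasure (distr (coin_product p) cantor_borel (coord_shift k)) {x. \<forall>j\<in>J. x j \<in> F j}
      = emeasure (coin_product p) {x. \<forall>j\<in>J. x (j - k) \<in> F j}"
    using J by (subst emeasure_distr) (auto simp: cylinder_measurable countable_finite coord_shift_def vimage_def)
  also have "{x. \<forall>j\<in>J. x (j - k) \<in> F j} = {x :: int \<Rightarrow> bool. \<forall>i\<in>(\<lambda>j. j - k) ` J. x i \<in> F (i + k)}"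
    by auto
  also have "emeasure (coin_product p) \<dots> = (\<Prod>i\<in>(\<lambda>j. j - k) ` J. emeasure (p i) (F (i + k)))"
    using J by (intro emeasure_cylinder) auto
  also have "\<dots> = (\<Prod>j\<in>J. emeasure (p (j - k)) (F j))"
    by (subst prod.reindex) (auto simp: inj_on_def)
  finally show "emeasure (distr (coin_product p) cantor_borel (coord_shift k)) {x. \<forall>j\<in>J. x j \<in> F j}
      = (\<Prod>j\<in>J. emeasure (p (j - k)) (F j))" .
qed auto

definition mix :: "int set \<Rightarrow> (int \<Rightarrow> bool) \<Rightarrow> (int \<Rightarrow> bool) \<Rightarrow> int \<Rightarrow> bool" where
  "mix I x x' = (\<lambda>n. if n \<in> I then x n else x' n)"

lemma mix_measurable [measurable]:
  assumes [measurable]: "f \<in> N \<rightarrow>\<^sub>M cantor_borel" "g \<in> N \<rightarrow>\<^sub>M cantor_borel"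
  shows "(\<lambda>z. mix I (f z) (g z)) \<in> N \<rightarrow>\<^sub>M cantor_borel"
proof (rule measurable_coordinatewise)
  fix n
  have "(\<lambda>z. f z n) \<in> N \<rightarrow>\<^sub>M count_space UNIV" "(\<lambda>z. g z n) \<in> N \<rightarrow>\<^sub>M count_space UNIV"
    by (rule measurable_compose[OF _ measurable_coordinate], fact)+
  then show "(\<lambda>z. mix I (f z) (g z) n) \<in> N \<rightarrow>\<^sub>M count_space UNIV"
    by (auto simp: mix_def)
qed

text \<open>
  Resampling the coordinates outside \<open>I\<close>. All conditional expectations below are integrals over
  resampled coordinates, so that they are defined at every point.
\<close>
lemma distr_mix:
  "distr (coin_product p \<Otimes>\<^sub>M coin_product q) cantor_borel (\<lambda>(x, x'). mix I x x')
    = coin_product (\<lambda>n. if n \<in> I then p n else q n)"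
proof (rule coin_product_eqI)
  interpret q: prob_space "coin_product q" by (rule prob_space_coin_product)
  fix J :: "int set" and F :: "int \<Rightarrow> bool set" assume J: "finite J"
  have *: "{y. \<forall>j\<in>J. (case y of (x, x') \<Rightarrow> mix I x x') j \<in> F j} = {x. \<forall>j\<in>J\<inter>I. x j \<in> F j} \<times> {x. \<forall>j\<in>J-I. x j \<in> F j}"
    unfolding mix_def by (fastforce split: if_split)
  have "emeasure (distr (coin_product p \<Otimes>\<^sub>M coin_product q) cantor_borel (\<lambda>(x, x'). mix I x x')) {x. \<forall>j\<in>J. x j \<in> F j}
      = emeasure (coin_product p \<Otimes>\<^sub>M coin_product q) ({x. \<forall>j\<in>J\<inter>I. x j \<in> F j} \<times> {x. \<forall>j\<in>J-I. x j \<in> F j})"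
    using J by (subst emeasure_distr) (auto simp: cylinder_measurable countable_finite * space_pair_measure vimage_def)
  also have "\<dots> = emeasure (coin_product p) {x. \<forall>j\<in>J\<inter>I. x j \<in> F j} * emeasure (coin_product q) {x. \<forall>j\<in>J-I. x j \<in> F j}"
    using J by (intro q.emeasure_pair_measure_Times) (auto simp: sets_coin_product cylinder_measurable countable_finite)
  also have "\<dots> = (\<Prod>j\<in>J\<inter>I. emeasure (p j) (F j)) * (\<Prod>j\<in>J-I. emeasure (q j) (F j))"
    using J by (simp add: emeasure_cylinder)
  also have "\<dots> = (\<Prod>j\<in>J. emeasure (if j \<in> I then p j else q j) (F j))"
    using J by (subst prod.Int_Diff[of J _ I]) (auto intro!: arg_cong2[where f="(*)"] prod.cong)
  finally show "emeasure (distr (coin_product p \<Otimes>\<^sub>M coin_product q) cantor_borel (\<lambda>(x, x'). mix I x x')) {x. \<forall>j\<in>J. x j \<in> F j}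
      = (\<Prod>j\<in>J. emeasure (if j \<in> I then p j else q j) (F j))" .
qed auto

lemma AE_eqI_cylinder:
  fixes f g :: "(int \<Rightarrow> bool) \<Rightarrow> ennreal"
  assumes [measurable]: "f \<in> borel_measurable cantor_borel" "g \<in> borel_measurable cantor_borel"
    and fin: "(\<integral>\<^sup>+x. f x \<partial>coin_product p) \<noteq> \<infinity>"
    and eq: "\<And>J F. finite J \<Longrightarrow> (\<integral>\<^sup>+x. f x * indicator {x. \<forall>j\<in>J. x j \<in> F j} x \<partial>coin_product p)
      = (\<integral>\<^sup>+x. g x * indicator {x. \<forall>j\<in>J. x j \<in> F j} x \<partial>coin_product p)"
  shows "AE x in coin_product p. f x = g x"
proof -
  interpret prob_space "coin_product p" by (rule prob_space_coin_product)
  have "density (coin_product p) f = density (coin_product p) g"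
  proof (rule measure_eqI_cylinder)
    show "finite_measure (density (coin_product p) f)"
      using fin sets.top[of "coin_product p"] by (intro finite_measureI) (auto simp: emeasure_density)
    fix J :: "int set" and F :: "int \<Rightarrow> bool set" assume J: "finite J"
    show "emeasure (density (coin_product p) f) {x. \<forall>j\<in>J. x j \<in> F j}
        = emeasure (density (coin_product p) g) {x. \<forall>j\<in>J. x j \<in> F j}"
      using eq[OF J] J
      by (subst (1 2) emeasure_density) (auto simp: sets_coin_product cylinder_measurable countable_finite)
  qed (auto simp: sets_coin_product)
  then show ?thesis
    by (subst (asm) density_unique_iff) auto
qed

section \<open>The biased coins and the logarithm of the cocycle\<close>

definition bias :: "int \<Rightarrow> real" where
  "bias n = marginal_zero n - 1 / 2"

definition coin :: "int \<Rightarrow> bool pmf" where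
  "coin n = bernoulli_pmf (1 - marginal_zero n)"

definition coin_prob :: "int \<Rightarrow> bool \<Rightarrow> real" where
  "coin_prob n b = (if b then 1 / 2 - bias n else 1 / 2 + bias n)"

lemma bias_pos_eq: "n \<ge> 1 \<Longrightarrow> bias n = 1 / (6 * sqrt (real_of_int n))"
  by (simp add: bias_def marginal_zero_def)

lemma bias_nonpos [simp]: "n \<le> 0 \<Longrightarrow> bias n = 0"
  by (simp add: bias_def marginal_zero_def)

lemma bias_nonneg: "0 \<le> bias n"
  by (cases "n \<ge> 1") (simp_all add: bias_pos_eq)

lemma bias_antimono:
  assumes "1 \<le> m" "m \<le> n"
  shows "bias n \<le> bias m"
  using assms by (auto simp: bias_pos_eq intro!: divide_left_mono mult_pos_pos)

lemma bias_le: "bias n \<le> 1 / 6"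
proof (cases "n \<ge> 1")
  case True
  then show ?thesis using bias_antimono[of 1 n] by (simp add: bias_pos_eq)
qed simp

lemma bias_squared: "n \<ge> 1 \<Longrightarrow> (bias n)\<^sup>2 = 1 / (36 * real_of_int n)"
  by (simp add: bias_pos_eq power_divide power_mult_distrib)

lemma coin_prob_ge: "1 / 3 \<le> coin_prob n b"
  using bias_le[of n] bias_nonneg[of n] by (auto simp: coin_prob_def)

lemma coin_prob_le: "coin_prob n b \<le> 2 / 3"
  using bias_le[of n] bias_nonneg[of n] by (auto simp: coin_prob_def)

lemma coin_prob_pos [simp]: "0 < coin_prob n b" "0 \<le> coin_prob n b"
  using coin_prob_ge[of n b] by linarith+

lemma coin_prob_nonpos: "n \<le> 0 \<Longrightarrow> coin_prob n b = 1 / 2"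
  by (simp add: coin_prob_def)

lemma coin_nonpos: "n \<le> 0 \<Longrightarrow> coin n = bernoulli_pmf (1 / 2)"
  by (simp add: coin_def marginal_zero_def)

lemma pmf_coin: "pmf (coin n) b = coin_prob n b"
  using marginal_zero_bounds[of n] by (cases b) (auto simp: coin_def coin_prob_def bias_def)

lemma bernoulli_measure_eq: "\<mu> = coin_product coin"
  unfolding bernoulli_measure_def coin_product_def by (simp add: marginal_def[abs_def] coin_def)

lemma nn_integral_coin:
  "(\<integral>\<^sup>+b. f b \<partial>measure_pmf (coin n)) = f True * ennreal (coin_prob n True) + f False * ennreal (coin_prob n False)"
  using marginal_zero_bounds[of n]
  by (simp add: coin_def coin_prob_def bias_def mult.commute)

text \<open>
  The factor 2 makes the weight of a fair coin vanish, so that sums of weights only see the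
  coordinates $n \ge 1$.
\<close>
definition log_weight :: "int \<Rightarrow> bool \<Rightarrow> real" where
  "log_weight n b = ln (2 * coin_prob n b)"

lemma exp_log_weight: "exp (log_weight n b) = 2 * coin_prob n b"
  by (simp add: log_weight_def)

lemma log_weight_nonpos [simp]: "n \<le> 0 \<Longrightarrow> log_weight n b = 0"
  by (simp add: log_weight_def coin_prob_nonpos)

lemma abs_ln_diff_le:
  fixes a b c :: real
  assumes "0 < c" "c \<le> a" "c \<le> b"
  shows "\<bar>ln a - ln b\<bar> \<le> \<bar>a - b\<bar> / c"
proof -
  have *: "ln x - ln y \<le> \<bar>x - y\<bar> / c" if "c \<le> x" "c \<le> y" for x y
  proof -
    have "ln x - ln y = ln (x / y)" using that assms(1) by (simp add: ln_div)
    also have "\<dots> \<le> x / y - 1" using that assms(1) by (intro ln_le_minus_one) auto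
    also have "\<dots> = (x - y) / y" using that assms(1) by (simp add: field_simps)
    also have "\<dots> \<le> \<bar>x - y\<bar> / y" using that assms(1) by (intro divide_right_mono) auto
    also have "\<dots> \<le> \<bar>x - y\<bar> / c" using that assms(1) by (intro divide_left_mono) auto
    finally show ?thesis .
  qed
  show ?thesis using *[of a b] *[of b a] assms by (auto simp: abs_minus_commute)
qed

lemma log_weight_diff: "\<bar>log_weight m b - log_weight n b\<bar> \<le> 3 * \<bar>bias m - bias n\<bar>"
proof -
  have "\<bar>log_weight m b - log_weight n b\<bar> \<le> \<bar>2 * coin_prob m b - 2 * coin_prob n b\<bar> / (2 / 3)"
    unfolding log_weight_def using coin_prob_ge[of m b] coin_prob_ge[of n b]
    by (intro abs_ln_diff_le) auto
  also have "\<dots> = 3 * \<bar>bias m - bias n\<bar>"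
    by (simp add: coin_prob_def abs_if)
  finally show ?thesis .
qed

lemma sum_bias_increments: "(\<Sum>n\<in>{- int N..int N}. \<bar>bias (n + 1) - bias n\<bar>) = 2 * bias 1 - bias (int N + 1)"
proof (induction N)
  case (Suc N)
  have "{- int (Suc N)..int (Suc N)} = insert (- int (Suc N)) (insert (int (Suc N)) {- int N..int N})"
    by auto
  moreover have "bias (int (Suc N) + 1) \<le> bias (int (Suc N))"
    by (rule bias_antimono) auto
  ultimately show ?case using Suc by (simp add: add.commute)
qed (simp add: bias_nonneg)

text \<open>
  The bias jumps once, from 0 to its maximum, and decreases afterwards: its total variation is finite,
  although its squares are not summable. For this reason the product for the cocycle converges
  everywhere, with bounds that do not depend on the point.
\<close>
lemma bias_increment_summable: "(\<lambda>n. \<bar>bias (n + 1) - bias n\<bar>) summable_on UNIV"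
proof (rule nonneg_bdd_above_summable_on)
  show "bdd_above (sum (\<lambda>n. \<bar>bias (n + 1) - bias n\<bar>) ` {F. F \<subseteq> UNIV \<and> finite F})"
  proof (intro bdd_aboveI2)
    fix F :: "int set" assume F: "F \<in> {F. F \<subseteq> UNIV \<and> finite F}"
    then obtain N where "\<forall>i\<in>F. \<bar>i\<bar> \<le> int N"
      using finite_set_of_finite_funs by (metis (no_types, lifting) abs_ge_zero finite_imageI finite_nat_set_iff_bounded_le image_eqI mem_Collect_eq nat_le_iff)
    then have "F \<subseteq> {- int N..int N}" by fastforce
    then have "(\<Sum>n\<in>F. \<bar>bias (n + 1) - bias n\<bar>) \<le> (\<Sum>n\<in>{- int N..int N}. \<bar>bias (n + 1) - bias n\<bar>)"
      by (intro sum_mono2) auto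
    also have "\<dots> \<le> 1 / 3"
      using bias_le[of 1] bias_nonneg[of "int N + 1"] unfolding sum_bias_increments by linarith
    finally show "(\<Sum>n\<in>F. \<bar>bias (n + 1) - bias n\<bar>) \<le> 1 / 3" .
  qed
qed auto

lemma summable_on_int_translate: "(f :: int \<Rightarrow> real) summable_on UNIV \<Longrightarrow> (\<lambda>n. f (n + k)) summable_on UNIV"
  by (subst summable_on_reindex_bij_betw[of "\<lambda>n. n + k" UNIV UNIV f]) (auto intro!: bij_betwI[where g = "\<lambda>n. n - k"])

lemma infsum_int_translate: "(\<Sum>\<^sub>\<infinity>n. f (n + k)) = (\<Sum>\<^sub>\<infinity>n. (f :: int \<Rightarrow> real) n)"
  by (rule infsum_reindex_bij_betw[of "\<lambda>n. n + k" UNIV UNIV f]) (auto intro!: bij_betwI[where g = "\<lambda>n. n - k"])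

lemma bias_diff_summable: "(\<lambda>n. \<bar>bias (n + k) - bias n\<bar>) summable_on UNIV"
proof -
  have *: "(\<lambda>n. \<bar>bias (n + int j) - bias n\<bar>) summable_on UNIV" for j
  proof (induction j)
    case (Suc j)
    have "(\<lambda>n. \<bar>bias (n + int j + 1) - bias (n + int j)\<bar> + \<bar>bias (n + int j) - bias n\<bar>) summable_on UNIV"
      using summable_on_int_translate[OF bias_increment_summable, of "int j"] Suc
      by (intro summable_on_add) (auto simp: algebra_simps)
    then show ?case
      by (rule summable_on_comparison_test) (auto simp: algebra_simps)
  qed simp
  show ?thesis
  proof (cases "k \<ge> 0")
    case True
    then show ?thesis using *[of "nat k"] by simp
  next
    case False
    then show ?thesis using summable_on_int_translate[OF *[of "nat (- k)"], of k]
      by (simp add: abs_minus_commute)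
  qed
qed

text \<open>
  The logarithm of $\prod_n \mu_{n+k}(x_n) / \mu_n(x_n)$, the Radon-Nikodym derivative of the image of
  the product measure under the shift by $-k$.
\<close>
definition log_cocycle :: "int \<Rightarrow> (int \<Rightarrow> bool) \<Rightarrow> real" where
  "log_cocycle k x = (\<Sum>\<^sub>\<infinity>n. log_weight (n + k) (x n) - log_weight n (x n))"

definition cocycle_bound :: "int \<Rightarrow> real" where
  "cocycle_bound k = (\<Sum>\<^sub>\<infinity>n. 3 * \<bar>bias (n + k) - bias n\<bar>)"

lemma log_cocycle_abs_summable: "(\<lambda>n. norm (log_weight (n + k) (x n) - log_weight n (x n))) summable_on UNIV"
  by (rule summable_on_comparison_test[OF summable_on_cmult_right[OF bias_diff_summable[of k], of 3]])
    (use log_weight_diff in auto)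

lemma log_cocycle_summable: "(\<lambda>n. log_weight (n + k) (x n) - log_weight n (x n)) summable_on UNIV"
  using log_cocycle_abs_summable by (rule abs_summable_summable)

lemma sum_log_cocycle_le:
  assumes "finite F"
  shows "\<bar>\<Sum>n\<in>F. log_weight (n + k) (x n) - log_weight n (x n)\<bar> \<le> cocycle_bound k"
proof -
  have "\<bar>\<Sum>n\<in>F. log_weight (n + k) (x n) - log_weight n (x n)\<bar> \<le> (\<Sum>n\<in>F. 3 * \<bar>bias (n + k) - bias n\<bar>)"
    by (rule order_trans[OF sum_abs sum_mono]) (rule log_weight_diff)
  also have "\<dots> \<le> cocycle_bound k"
    unfolding cocycle_bound_def using assms
    by (intro finite_sum_le_infsum summable_on_cmult_right bias_diff_summable) auto
  finally show ?thesis .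
qed

lemma filterlim_symmetric_intervals:
  "filterlim (\<lambda>N::nat. {- int N..int N}) (finite_subsets_at_top UNIV) sequentially"
  unfolding filterlim_finite_subsets_at_top
proof (intro allI impI)
  fix X :: "int set" assume X: "finite X \<and> X \<subseteq> UNIV"
  then obtain N where N: "\<forall>i\<in>X. nat \<bar>i\<bar> \<le> N"
    using finite_nat_set_iff_bounded_le[of "(\<lambda>i. nat \<bar>i\<bar>) ` X"] by auto
  have "X \<subseteq> {- int M..int M}" if "N \<le> M" for M
    using N that by fastforce
  then show "\<forall>\<^sub>F M in sequentially. finite {- int M..int M} \<and> X \<subseteq> {- int M..int M} \<and> {- int M..int M} \<subseteq> UNIV"
    by (intro eventually_sequentiallyI[of N]) auto
qed

lemma log_cocycle_LIMSEQ:
  "(\<lambda>N. \<Sum>n\<in>{- int N..int N}. log_weight (n + k) (x n) - log_weight n (x n)) \<longlonglongrightarrow> log_cocycle k x"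
proof -
  have "((\<lambda>n. log_weight (n + k) (x n) - log_weight n (x n)) has_sum log_cocycle k x) UNIV"
    unfolding log_cocycle_def using log_cocycle_summable by (rule has_sum_infsum)
  then show ?thesis
    unfolding has_sum_def by (rule filterlim_compose[OF _ filterlim_symmetric_intervals])
qed

text \<open>
  Because the series converges at every point, the cocycle identity is a reindexing without exceptional
  null sets.
\<close>
lemma log_cocycle_add: "log_cocycle (k + l) x = log_cocycle k (coord_shift l x) + log_cocycle l x"
proof -
  have "log_cocycle k (coord_shift l x) = (\<Sum>\<^sub>\<infinity>n. log_weight (n + k) (x (n - l)) - log_weight n (x (n - l)))"
    by (simp add: log_cocycle_def coord_shift_def)
  also have "\<dots> = (\<Sum>\<^sub>\<infinity>n. log_weight (n + l + k) (x n) - log_weight (n + l) (x n))"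
    using infsum_int_translate[of "\<lambda>n. log_weight (n + k) (x (n - l)) - log_weight n (x (n - l))" l] by simp
  finally have *: "log_cocycle k (coord_shift l x) = (\<Sum>\<^sub>\<infinity>n. log_weight (n + l + k) (x n) - log_weight (n + l) (x n))" .
  have "(\<lambda>n. log_weight (n + l + k) (x n) - log_weight (n + l) (x n)) summable_on UNIV"
    using summable_on_int_translate[OF log_cocycle_summable[of k "coord_shift l x"], of l] by (simp add: coord_shift_def)
  then have "log_cocycle k (coord_shift l x) + log_cocycle l x
      = (\<Sum>\<^sub>\<infinity>n. (log_weight (n + l + k) (x n) - log_weight (n + l) (x n)) + (log_weight (n + l) (x n) - log_weight n (x n)))"
    unfolding * log_cocycle_def[of l] by (intro infsum_add[symmetric] log_cocycle_summable)
  then show ?thesis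
    by (simp add: log_cocycle_def algebra_simps)
qed

lemma log_cocycle_0 [simp]: "log_cocycle 0 x = 0"
  by (simp add: log_cocycle_def)

lemma coordinate_compose_measurable:
  assumes "f \<in> N \<rightarrow>\<^sub>M cantor_borel"
  shows "(\<lambda>z. (g :: bool \<Rightarrow> real) (f z n)) \<in> borel_measurable N"
  by (rule measurable_compose[OF measurable_compose[OF assms measurable_coordinate]]) simp

lemma log_cocycle_measurable [measurable]: "log_cocycle k \<in> borel_measurable cantor_borel"
proof (rule borel_measurable_LIMSEQ_real[OF log_cocycle_LIMSEQ])
  show "(\<lambda>x. \<Sum>n\<in>{- int N..int N}. log_weight (n + k) (x n) - log_weight n (x n)) \<in> borel_measurable cantor_borel" for N
    by (intro borel_measurable_sum borel_measurable_diff coordinate_compose_measurable[OF measurable_ident_sets[OF refl]])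
qed

section \<open>Moments of the cocycle\<close>

text \<open>
  The partial products are bounded by a constant, so dominated convergence reduces the integral of a
  power of the cocycle over a cylinder to a product over single coins. The power $c = 1$ identifies the
  density of the shifted measure, $c = 1/2$ gives Hellinger integrals and $c = -1$ the inverse moment.
\<close>
lemma nn_integral_exp_log_cocycle_LIMSEQ:
  fixes c :: real and G :: "int \<Rightarrow> bool set"
  assumes J: "finite J" and G: "\<And>n. n \<notin> J \<Longrightarrow> G n = UNIV"
  shows "(\<lambda>N. \<Prod>n\<in>{- int N..int N}. \<integral>\<^sup>+b. ennreal (exp (c * (log_weight (n + k) b - log_weight n b))) * indicator (G n) b \<partial>coin n)
    \<longlonglongrightarrow> (\<integral>\<^sup>+x. ennreal (exp (c * log_cocycle k x)) * indicator {x. \<forall>n\<in>J. x n \<in> G n} x \<partial>coin_product coin)"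
proof -
  let ?P = "coin_product coin"
  let ?S = "\<lambda>N x. \<Sum>n\<in>{- int N..int N}. log_weight (n + k) (x n) - log_weight n (x n)"
  let ?E = "{x. \<forall>n\<in>J. x n \<in> G n}"
  have [measurable]: "?E \<in> sets cantor_borel"
    using J by (simp add: cylinder_measurable countable_finite)
  have [measurable]: "?S N \<in> borel_measurable cantor_borel" for N
    by (intro borel_measurable_sum borel_measurable_diff coordinate_compose_measurable[OF measurable_ident_sets[OF refl]])
  have "(\<lambda>N. \<integral>\<^sup>+x. ennreal (exp (c * ?S N x)) * indicator ?E x \<partial>?P)
    \<longlonglongrightarrow> (\<integral>\<^sup>+x. ennreal (exp (c * log_cocycle k x)) * indicator ?E x \<partial>?P)"
  proof (rule nn_integral_dominated_convergence[where w = "\<lambda>_. ennreal (exp (\<bar>c\<bar> * cocycle_bound k))"])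
    show "AE x in ?P. ennreal (exp (c * ?S N x)) * indicator ?E x \<le> ennreal (exp (\<bar>c\<bar> * cocycle_bound k))" for N
    proof (rule AE_I2)
      fix x
      have "c * ?S N x \<le> \<bar>c\<bar> * \<bar>?S N x\<bar>"
        unfolding abs_mult[symmetric] by (rule abs_ge_self)
      also have "\<dots> \<le> \<bar>c\<bar> * cocycle_bound k"
        by (intro mult_left_mono sum_log_cocycle_le) auto
      finally show "ennreal (exp (c * ?S N x)) * indicator ?E x \<le> ennreal (exp (\<bar>c\<bar> * cocycle_bound k))"
        by (auto simp: indicator_def intro!: ennreal_leI)
    qed
    show "AE x in ?P. (\<lambda>N. ennreal (exp (c * ?S N x)) * indicator ?E x) \<longlonglongrightarrow> ennreal (exp (c * log_cocycle k x)) * indicator ?E x"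
    proof (rule AE_I2)
      fix x
      have "(\<lambda>N. ennreal (exp (c * ?S N x))) \<longlonglongrightarrow> ennreal (exp (c * log_cocycle k x))"
        by (intro tendsto_intros log_cocycle_LIMSEQ)
      then show "(\<lambda>N. ennreal (exp (c * ?S N x)) * indicator ?E x) \<longlonglongrightarrow> ennreal (exp (c * log_cocycle k x)) * indicator ?E x"
        by (auto simp: indicator_def)
    qed
  qed (auto simp: ennreal_mult_eq_top_iff)
  moreover have "\<forall>\<^sub>F N in sequentially. (\<integral>\<^sup>+x. ennreal (exp (c * ?S N x)) * indicator ?E x \<partial>?P)
     = (\<Prod>n\<in>{- int N..int N}. \<integral>\<^sup>+b. ennreal (exp (c * (log_weight (n + k) b - log_weight n b))) * indicator (G n) b \<partial>coin n)"
  proof -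
    have "\<forall>\<^sub>F N in sequentially. J \<subseteq> {- int N..int N}"
      using filterlim_symmetric_intervals J unfolding filterlim_finite_subsets_at_top by fastforce
    then show ?thesis
    proof eventually_elim
      case (elim N)
      have *: "ennreal (exp (c * ?S N x)) * indicator ?E x
        = (\<Prod>n\<in>{- int N..int N}. ennreal (exp (c * (log_weight (n + k) (x n) - log_weight n (x n)))) * indicator (G n) (x n))" for x
      proof -
        have "(\<Prod>n\<in>{- int N..int N}. indicator (G n) (x n) :: ennreal) = indicator ?E x"
        proof (cases "x \<in> ?E")
          case True
          then have "x n \<in> G n" for n using G[of n] by (cases "n \<in> J") auto
          then show ?thesis using True by simp
        next
          case False
          then obtain n where "n \<in> J" "x n \<notin> G n" by auto
          then show ?thesis using elim False by (auto intro!: prod_zero bexI[of _ n])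
        qed
        then show ?thesis
          by (simp add: prod.distrib sum_distrib_left exp_sum prod_ennreal)
      qed
      show ?case unfolding * by (rule nn_integral_coin_product_prod) simp
    qed
  qed
  ultimately show ?thesis
    by (rule Lim_transform_eventually)
qed

lemma exp_log_weight_diff:
  "exp (log_weight m b - log_weight n b) = coin_prob m b / coin_prob n b"
  by (simp add: exp_diff exp_log_weight)

text \<open>
  Each factor of the cocycle turns the law of the coin $n$ into the law of the coin $n + k$.
\<close>
lemma density_log_cocycle:
  "density (coin_product coin) (\<lambda>x. ennreal (exp (log_cocycle k x))) = coin_product (\<lambda>n. coin (n + k))"
proof (rule coin_product_eqI)
  fix J :: "int set" and F :: "int \<Rightarrow> bool set" assume J: "finite J"
  define G where "G n = (if n \<in> J then F n else UNIV)" for n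
  have E: "{x. \<forall>n\<in>J. x n \<in> G n} = {x. \<forall>n\<in>J. x n \<in> F n}"
    by (auto simp: G_def)
  have factor: "(\<integral>\<^sup>+b. ennreal (exp (1 * (log_weight (n + k) b - log_weight n b))) * indicator (G n) b \<partial>coin n)
      = emeasure (coin (n + k)) (G n)" for n
  proof -
    have *: "ennreal (coin_prob (n + k) b / coin_prob n b) * i * ennreal (coin_prob n b) = i * ennreal (coin_prob (n + k) b)" for b i
    proof -
      have "ennreal (coin_prob (n + k) b / coin_prob n b) * ennreal (coin_prob n b) = ennreal (coin_prob (n + k) b)"
        using less_imp_neq[OF coin_prob_pos(1)[of n b]] by (subst ennreal_mult'[symmetric]) auto
      then show ?thesis by (metis mult.assoc mult.commute)
    qed
    have "emeasure (coin (n + k)) (G n) = (\<integral>\<^sup>+b. indicator (G n) b \<partial>coin (n + k))"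
      by simp
    also have "\<dots> = indicator (G n) True * ennreal (coin_prob (n + k) True) + indicator (G n) False * ennreal (coin_prob (n + k) False)"
      by (rule nn_integral_coin)
    also have "\<dots> = (\<integral>\<^sup>+b. ennreal (exp (1 * (log_weight (n + k) b - log_weight n b))) * indicator (G n) b \<partial>coin n)"
      unfolding nn_integral_coin mult_1 exp_log_weight_diff * ..
    finally show ?thesis ..
  qed
  have "(\<lambda>N. \<Prod>n\<in>{- int N..int N}. emeasure (coin (n + k)) (G n))
    \<longlonglongrightarrow> (\<integral>\<^sup>+x. ennreal (exp (1 * log_cocycle k x)) * indicator {x. \<forall>n\<in>J. x n \<in> G n} x \<partial>coin_product coin)"
    using nn_integral_exp_log_cocycle_LIMSEQ[OF J, of G 1 k] unfolding factor by (simp add: G_def)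
  moreover have "\<forall>\<^sub>F N in sequentially. (\<Prod>n\<in>{- int N..int N}. emeasure (coin (n + k)) (G n)) = (\<Prod>n\<in>J. emeasure (coin (n + k)) (F n))"
  proof -
    have "\<forall>\<^sub>F N in sequentially. J \<subseteq> {- int N..int N}"
      using filterlim_symmetric_intervals J unfolding filterlim_finite_subsets_at_top by fastforce
    then show ?thesis
    proof eventually_elim
      case (elim N)
      then show ?case
        by (intro prod.mono_neutral_cong_right) (auto simp: G_def)
    qed
  qed
  ultimately have "(\<integral>\<^sup>+x. ennreal (exp (1 * log_cocycle k x)) * indicator {x. \<forall>n\<in>J. x n \<in> G n} x \<partial>coin_product coin)
      = (\<Prod>n\<in>J. emeasure (coin (n + k)) (F n))"
    by (rule LIMSEQ_unique[OF _ tendsto_eventually])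
  then show "emeasure (density (coin_product coin) (\<lambda>x. ennreal (exp (log_cocycle k x)))) {x. \<forall>j\<in>J. x j \<in> F j}
      = (\<Prod>j\<in>J. emeasure (coin (j + k)) (F j))"
    unfolding E using J
    by (subst emeasure_density) (auto simp: sets_coin_product cylinder_measurable countable_finite)
qed (simp add: sets_coin_product)

lemma nn_integral_exp_log_cocycle_le:
  fixes c :: real and u :: "int \<Rightarrow> real"
  assumes "\<And>n. exp (c * (log_weight (n + k) True - log_weight n True)) * coin_prob n True
      + exp (c * (log_weight (n + k) False - log_weight n False)) * coin_prob n False \<le> exp (u n)"
    and "\<forall>\<^sub>F N in sequentially. (\<Sum>n\<in>{- int N..int N}. u n) \<le> v"
  shows "(\<integral>\<^sup>+x. ennreal (exp (c * log_cocycle k x)) \<partial>coin_product coin) \<le> ennreal (exp v)"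
proof -
  have "(\<lambda>N. \<Prod>n\<in>{- int N..int N}. \<integral>\<^sup>+b. ennreal (exp (c * (log_weight (n + k) b - log_weight n b))) \<partial>coin n)
    \<longlonglongrightarrow> (\<integral>\<^sup>+x. ennreal (exp (c * log_cocycle k x)) \<partial>coin_product coin)"
    using nn_integral_exp_log_cocycle_LIMSEQ[of "{}" "\<lambda>_. UNIV" c k] by simp
  moreover have "\<forall>\<^sub>F N in sequentially. (\<Prod>n\<in>{- int N..int N}. \<integral>\<^sup>+b. ennreal (exp (c * (log_weight (n + k) b - log_weight n b))) \<partial>coin n) \<le> ennreal (exp v)"
    using assms(2)
  proof eventually_elim
    case (elim N)
    have "(\<Prod>n\<in>{- int N..int N}. \<integral>\<^sup>+b. ennreal (exp (c * (log_weight (n + k) b - log_weight n b))) \<partial>coin n)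
      \<le> (\<Prod>n\<in>{- int N..int N}. ennreal (exp (u n)))"
    proof (rule prod_mono_ennreal)
      fix n
      show "(\<integral>\<^sup>+b. ennreal (exp (c * (log_weight (n + k) b - log_weight n b))) \<partial>coin n) \<le> ennreal (exp (u n))"
        unfolding nn_integral_coin
        using assms(1)[of n] by (simp add: ennreal_mult[symmetric] ennreal_plus[symmetric] ennreal_leI del: ennreal_plus)
    qed
    also have "\<dots> = ennreal (exp (\<Sum>n\<in>{- int N..int N}. u n))"
      by (simp add: prod_ennreal exp_sum)
    also have "\<dots> \<le> ennreal (exp v)"
      using elim by (intro ennreal_leI) simp
    finally show ?case .
  qed
  ultimately show ?thesis
    by (rule tendsto_upperbound) simp
qed

text \<open>
  The Hellinger affinity of two coins is at most 1 by the inequality of the means. Between a fair coin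
  and one of bias $a$ its square is $(1 + \sqrt{1 - 4 a^2}) / 2 \le 1 - a^2$. The number $d$ is $a^2$ if
  one of the coins is fair, and 0 if the bound 1 is enough.
\<close>
lemma hellinger_factor:
  assumes "n \<le> 0 \<or> m \<le> 0 \<or> d = 0" "d = (bias m)\<^sup>2 + (bias n)\<^sup>2 \<or> d = 0"
  shows "exp (1 / 2 * (log_weight m True - log_weight n True)) * coin_prob n True
      + exp (1 / 2 * (log_weight m False - log_weight n False)) * coin_prob n False \<le> exp (- (d / 2))"
proof -
  have *: "exp (1 / 2 * (log_weight m b - log_weight n b)) * coin_prob n b = sqrt (coin_prob m b * coin_prob n b)" for b
  proof -
    have "exp (1 / 2 * (log_weight m b - log_weight n b)) = sqrt (exp (log_weight m b - log_weight n b))"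
      by (rule real_sqrt_unique[symmetric]) (auto simp: power2_eq_square exp_add[symmetric])
    then show ?thesis
      unfolding exp_log_weight_diff
      using real_div_sqrt[of "coin_prob n b"]
      by (metis coin_prob_pos(2) real_sqrt_divide real_sqrt_mult times_divide_eq_left times_divide_eq_right)
  qed
  let ?s = "sqrt (coin_prob m True * coin_prob n True) + sqrt (coin_prob m False * coin_prob n False)"
  have le1: "?s \<le> 1"
  proof -
    have "sqrt (coin_prob m b * coin_prob n b) \<le> (coin_prob m b + coin_prob n b) / 2" for b
      using arith_geo_mean_sqrt[of "coin_prob m b" "coin_prob n b"] by simp
    from this[of True] this[of False] show ?thesis by (simp add: coin_prob_def)
  qed
  have fair: "?s \<le> exp (- (a\<^sup>2 / 2))" if "{coin_prob m, coin_prob n} = {\<lambda>b. 1 / 2, \<lambda>b. 1 / 2 + (if b then - a else a)}" "\<bar>a\<bar> \<le> 1 / 6" for a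
  proof -
    have a2: "a\<^sup>2 \<le> (1/6)\<^sup>2" using that(2) by (metis abs_ge_zero power2_abs power_mono)
    have "coin_prob m b * coin_prob n b = (1 / 2 + (if b then - a else a)) / 2" for b
      using that(1) by (auto simp: doubleton_eq_iff)
    from this[of True] this[of False]
    have "?s = sqrt ((1 / 2 - a) / 2) + sqrt ((1 / 2 + a) / 2)" by (simp only: if_True if_False) simp
    moreover have "(sqrt ((1 / 2 - a) / 2) + sqrt ((1 / 2 + a) / 2))\<^sup>2 \<le> 1 - a\<^sup>2"
    proof -
      have "(sqrt ((1 / 2 - a) / 2) + sqrt ((1 / 2 + a) / 2))\<^sup>2
          = (1/2 - a)/2 + (1/2 + a)/2 + 2 * (sqrt ((1 / 2 - a) / 2) * sqrt ((1 / 2 + a) / 2))"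
        using that(2) by (simp add: power2_sum)
      also have "sqrt ((1 / 2 - a) / 2) * sqrt ((1 / 2 + a) / 2) = sqrt ((1/4 - a\<^sup>2) / 4)"
        by (subst real_sqrt_mult[symmetric]) (simp add: algebra_simps power2_eq_square)
      also have "sqrt ((1/4 - a\<^sup>2) / 4) \<le> 1/4 - a\<^sup>2 / 2"
      proof (rule real_le_lsqrt)
        have "(1/4 - a\<^sup>2 / 2)\<^sup>2 = (1/4 - a\<^sup>2) / 4 + (a\<^sup>2 / 2)\<^sup>2"
          by (simp add: power2_eq_square field_simps)
        then show "(1/4 - a\<^sup>2) / 4 \<le> (1/4 - a\<^sup>2 / 2)\<^sup>2" by simp
      qed (use a2 in \<open>auto simp: power2_eq_square\<close>)
      finally show ?thesis by (simp add: field_simps)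
    qed
    moreover have "1 - a\<^sup>2 \<le> (exp (- (a\<^sup>2 / 2)))\<^sup>2"
      using exp_ge_add_one_self[of "- a\<^sup>2"] by (simp add: power2_eq_square exp_add[symmetric])
    ultimately show ?thesis
      using power2_le_imp_le[of ?s "exp (- (a\<^sup>2 / 2))"] by force
  qed
  have ab: "\<bar>bias i\<bar> \<le> 1 / 6" for i using bias_le[of i] bias_nonneg[of i] by linarith
  have "?s \<le> exp (- (d / 2))"
  proof (cases "d = 0")
    case False
    then consider "n \<le> 0" | "m \<le> 0" using assms by auto
    then show ?thesis
    proof cases
      case 1
      have "coin_prob n = (\<lambda>b. 1 / 2)" "coin_prob m = (\<lambda>b. 1 / 2 + (if b then - bias m else bias m))"
        using 1 by (auto simp: coin_prob_def)
      then show ?thesis using fair[of "bias m"] ab 1 assms False by (simp add: insert_commute)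
    next
      case 2
      have "coin_prob m = (\<lambda>b. 1 / 2)" "coin_prob n = (\<lambda>b. 1 / 2 + (if b then - bias n else bias n))"
        using 2 by (auto simp: coin_prob_def)
      then show ?thesis using fair[of "bias n"] ab 2 assms False by simp
    qed
  qed (use le1 in simp)
  then show ?thesis unfolding * by simp
qed

lemma sum_bias_squared: "(\<Sum>n\<in>{1..int j}. (bias n)\<^sup>2) = harm j / 36"
proof (induction j)
  case (Suc j)
  have "{1..int (Suc j)} = insert (int (Suc j)) {1..int j}" by auto
  then show ?case using Suc
    by (simp add: harm_Suc bias_squared field_simps)
qed (simp add: harm_def)

text \<open>
  It suffices to use the $|k|$ coordinates at which a fair coin is compared with a biased one: the
  biases there are those of the coins $1, \ldots, |k|$, and their squares have sum $H_{|k|} / 36$.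
\<close>
lemma nn_integral_sqrt_cocycle_le:
  "(\<integral>\<^sup>+x. ennreal (exp (1 / 2 * log_cocycle k x)) \<partial>coin_product coin) \<le> ennreal (exp (- (harm (nat \<bar>k\<bar>) / 72)))"
proof (rule nn_integral_exp_log_cocycle_le)
  define d where "d n = (if n \<le> 0 \<or> n + k \<le> 0 then (bias (n + k))\<^sup>2 + (bias n)\<^sup>2 else 0)" for n
  show "exp (1 / 2 * (log_weight (n + k) True - log_weight n True)) * coin_prob n True
      + exp (1 / 2 * (log_weight (n + k) False - log_weight n False)) * coin_prob n False \<le> exp (- (d n / 2))" for n
    by (rule hellinger_factor) (auto simp: d_def)
  have "(\<Sum>n\<in>{- int N..int N}. - (d n / 2)) \<le> - (harm (nat \<bar>k\<bar>) / 72)" if N: "nat \<bar>k\<bar> \<le> N" for N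
  proof -
    have "harm (nat \<bar>k\<bar>) / 36 = (\<Sum>n\<in>{1..\<bar>k\<bar>}. (bias n)\<^sup>2)"
      using sum_bias_squared[of "nat \<bar>k\<bar>"] by simp
    also have "\<dots> \<le> (\<Sum>n\<in>{- int N..int N}. d n)"
    proof (cases "k \<ge> 0")
      case True
      have "(\<Sum>n\<in>{1..\<bar>k\<bar>}. (bias n)\<^sup>2) = (\<Sum>n\<in>{1-k..0}. (bias (n + k))\<^sup>2)"
        using True by (intro sum.reindex_bij_witness[of _ "\<lambda>n. n + k" "\<lambda>n. n - k"]) auto
      also have "\<dots> \<le> (\<Sum>n\<in>{1-k..0}. d n)"
        by (intro sum_mono) (auto simp: d_def)
      also have "\<dots> \<le> (\<Sum>n\<in>{- int N..int N}. d n)"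
        using N by (intro sum_mono2) (auto simp: d_def)
      finally show ?thesis .
    next
      case False
      have "(\<Sum>n\<in>{1..\<bar>k\<bar>}. (bias n)\<^sup>2) \<le> (\<Sum>n\<in>{1..\<bar>k\<bar>}. d n)"
        using False by (intro sum_mono) (auto simp: d_def)
      also have "\<dots> \<le> (\<Sum>n\<in>{- int N..int N}. d n)"
        using N by (intro sum_mono2) (auto simp: d_def)
      finally show ?thesis .
    qed
    finally show ?thesis by (simp add: sum_negf sum_divide_distrib[symmetric])
  qed
  then show "\<forall>\<^sub>F N in sequentially. (\<Sum>n\<in>{- int N..int N}. - (d n / 2)) \<le> - (harm (nat \<bar>k\<bar>) / 72)"
    by (rule eventually_sequentiallyI)
qed

text \<open>
  The coordinates that compare a fair coin with a biased one, and the first $j$ biased ones, contribute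
  at most $H_j / 36$ each. Beyond $j$ the differences are at most the bias of the coin $j$, and they
  telescope to at most $j$ times this bias; its square is $1 / (36 j)$.
\<close>
lemma sum_bias_diff_squared_pos:
  assumes "j \<ge> 1" "N \<ge> j"
  shows "(\<Sum>n\<in>{- int N..int N}. (bias (n + int j) - bias n)\<^sup>2) \<le> (2 * harm j + 1) / 36"
proof -
  let ?D = "\<lambda>n. (bias (n + int j) - bias n)\<^sup>2"
  have split: "{- int N..int N} = {- int N..0} \<union> {1..int j} \<union> {int j + 1..int N}"
    using assms by auto
  have "(\<Sum>n\<in>{- int N..int N}. ?D n) = (\<Sum>n\<in>{- int N..0}. ?D n) + (\<Sum>n\<in>{1..int j}. ?D n) + (\<Sum>n\<in>{int j + 1..int N}. ?D n)"
    unfolding split by (subst sum.union_disjoint, auto)+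
  moreover have "(\<Sum>n\<in>{- int N..0}. ?D n) \<le> harm j / 36"
  proof -
    have "(\<Sum>n\<in>{- int N..0}. ?D n) = (\<Sum>n\<in>{1 - int j..0}. ?D n)"
      using assms by (intro sum.mono_neutral_right) auto
    also have "\<dots> = (\<Sum>n\<in>{1..int j}. (bias n)\<^sup>2)"
      by (intro sum.reindex_bij_witness[of _ "\<lambda>n. n - int j" "\<lambda>n. n + int j"]) auto
    finally show ?thesis by (simp add: sum_bias_squared)
  qed
  moreover have "(\<Sum>n\<in>{1..int j}. ?D n) \<le> harm j / 36"
    unfolding sum_bias_squared[symmetric]
  proof (intro sum_mono)
    fix n assume "n \<in> {1..int j}"
    then have "bias (n + int j) \<le> bias n" by (intro bias_antimono) auto
    then show "?D n \<le> (bias n)\<^sup>2"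
      using bias_nonneg[of "n + int j"] by (subst power2_commute) (auto intro!: power_mono)
  qed
  moreover have "(\<Sum>n\<in>{int j + 1..int N}. ?D n) \<le> 1 / 36"
  proof -
    have "(\<Sum>n\<in>{int j + 1..int N}. ?D n) \<le> (\<Sum>n\<in>{int j + 1..int N}. bias j * (bias n - bias (n + int j)))"
    proof (intro sum_mono)
      fix n assume n: "n \<in> {int j + 1..int N}"
      then have "bias (n + int j) \<le> bias n" "bias n \<le> bias j" using assms by (auto intro!: bias_antimono)
      then show "?D n \<le> bias j * (bias n - bias (n + int j))"
        using bias_nonneg[of "n + int j"]
        by (subst power2_commute) (auto simp: power2_eq_square intro!: mult_right_mono)
    qed
    also have "\<dots> = bias j * ((\<Sum>n\<in>{int j + 1..int N}. bias n) - (\<Sum>n\<in>{int j + 1..int N}. bias (n + int j)))"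
      by (simp add: sum_distrib_left[symmetric] sum_subtractf)
    also have "(\<Sum>n\<in>{int j + 1..int N}. bias (n + int j)) = (\<Sum>n\<in>{2 * int j + 1..int N + int j}. bias n)"
      by (intro sum.reindex_bij_witness[of _ "\<lambda>n. n - int j" "\<lambda>n. n + int j"]) auto
    also have "(\<Sum>n\<in>{int j + 1..int N}. bias n) - \<dots> \<le> (\<Sum>n\<in>{int j + 1..2 * int j}. bias n)"
    proof -
      have "(\<Sum>n\<in>{int j + 1..int N}. bias n) \<le> (\<Sum>n\<in>{int j + 1..2 * int j} \<union> {2 * int j + 1..int N + int j}. bias n)"
        by (intro sum_mono2) (auto simp: bias_nonneg)
      also have "\<dots> = (\<Sum>n\<in>{int j + 1..2 * int j}. bias n) + (\<Sum>n\<in>{2 * int j + 1..int N + int j}. bias n)"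
        by (intro sum.union_disjoint) auto
      finally show ?thesis by simp
    qed
    also have "(\<Sum>n\<in>{int j + 1..2 * int j}. bias n) \<le> (\<Sum>n\<in>{int j + 1..2 * int j}. bias j)"
      using assms by (intro sum_mono bias_antimono) auto
    also have "\<dots> = real j * bias j" by simp
    also have "bias j * (real j * bias j) = 1 / 36"
      using bias_squared[of j] assms by (simp add: power2_eq_square field_simps)
    finally show ?thesis using bias_nonneg[of j] by (simp add: mult_left_mono)
  qed
  ultimately show ?thesis by (simp add: field_simps)
qed

lemma sum_bias_diff_squared:
  "(\<Sum>n\<in>{- int N..int N}. (bias (n + k) - bias n)\<^sup>2) \<le> (2 * harm (nat \<bar>k\<bar>) + 1) / 36"
proof (cases "k = 0")
  case True
  then show ?thesis by (simp add: harm_def)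
next
  case False
  define j where "j = nat \<bar>k\<bar>"
  \<comment> \<open>The interval $[-K, K]$ contains $[-N, N]$ and its translate by $-j$.\<close>
  define K where "K = N + 2 * j"
  have j: "j \<ge> 1" "K \<ge> j" using False by (auto simp: j_def K_def)
  have "(\<Sum>n\<in>{- int N..int N}. (bias (n + k) - bias n)\<^sup>2) \<le> (\<Sum>n\<in>{- int K..int K}. (bias (n + int j) - bias n)\<^sup>2)"
  proof (cases "k > 0")
    case True
    then have "k = int j" by (simp add: j_def)
    then show ?thesis by (simp only:) (intro sum_mono2, auto simp: K_def)
  next
    case f: False
    have "(\<Sum>n\<in>{- int N..int N}. (bias (n + k) - bias n)\<^sup>2) = (\<Sum>n\<in>{- int N - int j..int N - int j}. (bias (n + int j) - bias n)\<^sup>2)"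
      using f by (intro sum.reindex_bij_witness[of _ "\<lambda>n. n + int j" "\<lambda>n. n - int j"]) (auto simp: j_def power2_commute)
    also have "\<dots> \<le> (\<Sum>n\<in>{- int K..int K}. (bias (n + int j) - bias n)\<^sup>2)"
      by (intro sum_mono2) (auto simp: K_def)
    finally show ?thesis .
  qed
  also have "\<dots> \<le> (2 * harm j + 1) / 36" by (rule sum_bias_diff_squared_pos[OF j])
  finally show ?thesis by (simp add: j_def)
qed

text \<open>
  The left side is 1 plus the chi-square divergence $(a - b)^2 / (1/4 - a^2)$ of the two coins, and the
  denominator is at least $2/9$.
\<close>
lemma inverse_factor:
  "exp (- 1 * (log_weight m True - log_weight n True)) * coin_prob n True
      + exp (- 1 * (log_weight m False - log_weight n False)) * coin_prob n False \<le> exp (9 / 2 * (bias m - bias n)\<^sup>2)"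
proof -
  let ?a = "bias m" and ?b = "bias n"
  have a: "0 \<le> ?a" "?a \<le> 1 / 6" using bias_nonneg bias_le by auto
  have a2: "?a\<^sup>2 \<le> (1/6)\<^sup>2" using a by (intro power_mono) auto
  have *: "exp (- 1 * (log_weight m b - log_weight n b)) = coin_prob n b / coin_prob m b" for b
    using exp_log_weight_diff[of n b m] by (simp add: algebra_simps)
  have "coin_prob n True / coin_prob m True * coin_prob n True + coin_prob n False / coin_prob m False * coin_prob n False
     = 1 + (?a - ?b)\<^sup>2 / (1 / 4 - ?a\<^sup>2)"
  proof -
    have nz: "1/2 - ?a > 0" "1/2 + ?a > 0" using a by auto
    have eq: "1 / 4 - ?a\<^sup>2 = (1/2 - ?a) * (1/2 + ?a)" by (simp add: power2_eq_square algebra_simps)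
    show ?thesis unfolding eq coin_prob_def using nz
      by (simp add: divide_simps) (simp add: algebra_simps power2_eq_square)
  qed
  also have "(?a - ?b)\<^sup>2 / (1 / 4 - ?a\<^sup>2) \<le> (?a - ?b)\<^sup>2 / (2 / 9)"
    using a2 by (intro divide_left_mono) (auto simp: power2_eq_square)
  also have "1 + (?a - ?b)\<^sup>2 / (2 / 9) = 1 + 9 / 2 * (?a - ?b)\<^sup>2"
    by simp
  also have "\<dots> \<le> exp (9 / 2 * (?a - ?b)\<^sup>2)"
    by (rule exp_ge_add_one_self)
  finally show ?thesis unfolding * by simp
qed

text \<open>
  The right side grows like $|k|^{1/4}$. What matters later is that the exponent is below $1/2$.
\<close>
lemma nn_integral_inverse_cocycle_le:
  "(\<integral>\<^sup>+x. ennreal (exp (- log_cocycle k x)) \<partial>coin_product coin) \<le> ennreal (exp (harm (nat \<bar>k\<bar>) / 4 + 1 / 8))"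
proof -
  have "(\<integral>\<^sup>+x. ennreal (exp (- 1 * log_cocycle k x)) \<partial>coin_product coin) \<le> ennreal (exp (harm (nat \<bar>k\<bar>) / 4 + 1 / 8))"
  proof (rule nn_integral_exp_log_cocycle_le[OF inverse_factor])
    have "(\<Sum>n\<in>{- int N..int N}. 9 / 2 * (bias (n + k) - bias n)\<^sup>2) \<le> harm (nat \<bar>k\<bar>) / 4 + 1 / 8" for N
    proof -
      have "(\<Sum>n\<in>{- int N..int N}. 9 / 2 * (bias (n + k) - bias n)\<^sup>2) = 9 / 2 * (\<Sum>n\<in>{- int N..int N}. (bias (n + k) - bias n)\<^sup>2)"
        by (rule sum_distrib_left[symmetric])
      then show ?thesis using sum_bias_diff_squared[of k N] by (simp add: field_simps)
    qed
    then show "\<forall>\<^sub>F N in sequentially. (\<Sum>n\<in>{- int N..int N}. 9 / 2 * (bias (n + k) - bias n)\<^sup>2) \<le> harm (nat \<bar>k\<bar>) / 4 + 1 / 8"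
      by simp
  qed
  then show ?thesis by simp
qed

section \<open>The Bernoulli action\<close>

lemma bernoulli_action_eq: "bernoulli_action = coord_shift"
  by (simp add: bernoulli_action_apply coord_shift_def fun_eq_iff)

lemma sets_bernoulli_measure [measurable_cong]: "sets \<mu> = sets cantor_borel"
  by (simp add: bernoulli_measure_eq sets_coin_product)

lemma space_bernoulli_measure [simp]: "space \<mu> = UNIV"
  by (simp add: bernoulli_measure_eq)

interpretation bernoulli: prob_space \<mu>
  unfolding bernoulli_measure_eq by (rule prob_space_coin_product)

lemma distr_bernoulli_shift:
  "distr \<mu> \<mu> (coord_shift g)
    = density \<mu> (\<lambda>x. ennreal (exp (log_cocycle (- g) x)))"
proof -
  have "distr \<mu> \<mu> (coord_shift g)
      = distr (coin_product coin) cantor_borel (coord_shift g)"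
    unfolding bernoulli_measure_eq by (intro distr_cong) (auto simp: sets_coin_product)
  then show ?thesis
    using density_log_cocycle[of "- g"] by (simp add: distr_shift bernoulli_measure_eq)
qed

lemma measurable_bernoulli_action: "measurable_action bernoulli_action \<mu>"
proof -
  have "coord_shift g \<in> \<mu> \<rightarrow>\<^sub>M \<mu>" for g
    by measurable
  then show ?thesis
    unfolding measurable_action_def bernoulli_action_eq by (simp add: coord_shift_add)
qed

lemma null_sets_density_exp:
  assumes [measurable]: "f \<in> borel_measurable M"
  shows "null_sets (density M (\<lambda>x. ennreal (exp (f x)))) = null_sets M"
proof (intro set_eqI)
  fix A
  have "A \<in> null_sets (density M (\<lambda>x. ennreal (exp (f x)))) \<longleftrightarrow> A \<in> sets M \<and> (AE x in M. x \<in> A \<longrightarrow> ennreal (exp (f x)) = 0)"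
    by (rule null_sets_density_iff) measurable
  also have "\<dots> \<longleftrightarrow> A \<in> sets M \<and> (AE x in M. x \<notin> A)"
    by simp
  also have "\<dots> \<longleftrightarrow> A \<in> null_sets M"
    using AE_iff_null_sets[of A M] by auto
  finally show "A \<in> null_sets (density M (\<lambda>x. ennreal (exp (f x)))) \<longleftrightarrow> A \<in> null_sets M" .
qed

lemma nonsingular_bernoulli_action: "nonsingular_action bernoulli_action \<mu>"
proof -
  have [measurable]: "log_cocycle k \<in> borel_measurable \<mu>" for k
    by measurable
  show ?thesis
    unfolding nonsingular_action_def using measurable_bernoulli_action
    by (simp add: bernoulli_action_eq distr_bernoulli_shift null_sets_density_exp)
qed

lemma rn_cocycle_bernoulli:
  "AE x in \<mu>. rn_cocycle bernoulli_action \<mu> g x = exp (log_cocycle g x)"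
proof -
  have "AE x in \<mu>. ennreal (exp (log_cocycle g x))
      = RN_deriv \<mu> (distr \<mu> \<mu> (bernoulli_action (- g))) x"
    by (rule bernoulli.RN_deriv_unique) (auto simp: bernoulli_action_eq distr_bernoulli_shift)
  then show ?thesis
    by eventually_elim (auto simp: rn_cocycle_def Let_def top.not_eq_extremum dest!: sym[of "ennreal _"])
qed

text \<open>
  A fixed point of the shift by $g$ is constant along the multiples of $-|g|$, and the coins at these
  nonpositive coordinates are fair and independent.
\<close>
lemma essentially_free_bernoulli_action: "essentially_free bernoulli_action \<mu>"
proof -
  have "AE x in \<mu>. coord_shift g x = x \<longrightarrow> g = 0" for g
  proof (cases "g = 0")
    case False
    \<comment> \<open>The coordinates at multiples of \<open>h\<close> are those of fair coins.\<close>
    define h where "h = - \<bar>g\<bar>"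
    have h: "h < 0" using False by (simp add: h_def)
    define E where "E b = {x. \<forall>n\<in>range (\<lambda>j. h * int j). x n \<in> {b}}" for b :: bool
    have E_sets: "E b \<in> sets cantor_borel" for b
      unfolding E_def by (intro cylinder_measurable) auto
    have "emeasure \<mu> (E b) = 0" for b
    proof -
      have "emeasure \<mu> (E b) \<le> ennreal ((1 / 2) ^ N)" for N
      proof -
        let ?J = "(\<lambda>j. h * int j) ` {..<N}"
        have inj: "inj_on (\<lambda>j. h * int j) {..<N}" using h by (auto simp: inj_on_def)
        have "emeasure \<mu> (E b) \<le> emeasure \<mu> {x. \<forall>n\<in>?J. x n \<in> {b}}"
        proof (rule emeasure_mono)
          show "{x. \<forall>n\<in>?J. x n \<in> {b}} \<in> sets \<mu>"
            unfolding sets_bernoulli_measure by (rule cylinder_measurable) (simp add: countable_finite)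
        qed (auto simp: E_def)
        also have "\<dots> = (\<Prod>n\<in>?J. emeasure (coin n) {b})"
          unfolding bernoulli_measure_eq by (intro emeasure_cylinder) auto
        also have "\<dots> = (\<Prod>n\<in>?J. ennreal (1 / 2))"
          using h by (intro prod.cong) (auto simp: emeasure_pmf_single pmf_coin coin_prob_nonpos mult_nonpos_nonneg)
        also have "\<dots> = ennreal ((1 / 2) ^ N)"
          by (simp only: prod_constant card_image[OF inj] card_lessThan ennreal_power)
        finally show ?thesis .
      qed
      moreover have "(\<lambda>N. ennreal ((1 / 2) ^ N)) \<longlonglongrightarrow> ennreal 0"
        by (intro tendsto_ennrealI LIMSEQ_realpow_zero) auto
      ultimately have "emeasure \<mu> (E b) \<le> ennreal 0"
        by (intro LIMSEQ_le_const) auto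
      then show ?thesis by simp
    qed
    then have "E True \<union> E False \<in> null_sets \<mu>"
      using E_sets by (intro null_sets.Un) (auto simp: null_sets_def sets_bernoulli_measure)
    then have "AE x in \<mu>. x \<notin> E True \<union> E False"
      by (rule AE_not_in)
    then show ?thesis
    proof eventually_elim
      case (elim x)
      show ?case
      proof
        assume "coord_shift g x = x"
        then have s: "x (n - g) = x n" for n by (metis coord_shift_def)
        have step: "x (n + h) = x n" for n
          using s[of n] s[of "n + g"] by (cases "g > 0") (simp_all add: h_def)
        have "x (h * int j) = x 0" for j
        proof (induction j)
          case (Suc j)
          have "h * int (Suc j) = h * int j + h" by (simp add: algebra_simps)
          then show ?case using Suc step[of "h * int j"] by (simp only:)
        qed simp
        then have "x \<in> E (x 0)" by (auto simp: E_def)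
        with elim show "g = 0" by (cases "x 0") auto
      qed
    qed
  qed simp
  then show ?thesis
    unfolding essentially_free_def bernoulli_action_eq by (simp add: AE_all_countable)
qed

section \<open>Dissipativity of the high powers\<close>

definition power_shift :: "nat \<Rightarrow> int \<Rightarrow> (nat \<Rightarrow> int \<Rightarrow> bool) \<Rightarrow> nat \<Rightarrow> int \<Rightarrow> bool" where
  "power_shift m k x = (\<lambda>i\<in>{..<m}. coord_shift k (x i))"

definition power_log_cocycle :: "nat \<Rightarrow> int \<Rightarrow> (nat \<Rightarrow> int \<Rightarrow> bool) \<Rightarrow> real" where
  "power_log_cocycle m k x = (\<Sum>i<m. log_cocycle k (x i))"

lemma space_power_measure: "space (power_measure m \<mu>) = (\<Pi>\<^sub>E i\<in>{..<m}. UNIV)"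
  by (simp add: power_measure_def space_PiM)

lemma power_shift_in_space [simp]: "power_shift m k x \<in> space (power_measure m \<mu>)"
  by (auto simp: power_shift_def space_power_measure)

lemma power_shift_add: "power_shift m (k + l) x = power_shift m k (power_shift m l x)"
  by (auto simp: power_shift_def coord_shift_add fun_eq_iff)

lemma power_shift_0: "x \<in> space (power_measure m \<mu>) \<Longrightarrow> power_shift m 0 x = x"
  by (auto simp: power_shift_def space_power_measure fun_eq_iff PiE_iff extensional_def)

lemma power_log_cocycle_add: "power_log_cocycle m (k + l) x = power_log_cocycle m k (power_shift m l x) + power_log_cocycle m l x"
  by (simp add: power_log_cocycle_def power_shift_def log_cocycle_add sum.distrib)

lemma generated_action_power:
  assumes x: "x \<in> space (power_measure m \<mu>)"
  shows "generated_action (power_measure m \<mu>) (power_transformation m bernoulli_shift) k x = power_shift m k x"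
proof -
  let ?T = "power_transformation m bernoulli_shift :: _ \<Rightarrow> nat \<Rightarrow> int \<Rightarrow> bool" and ?S = "space (power_measure m \<mu>)"
  have T: "?T y = power_shift m 1 y" for y
    by (auto simp: power_transformation_def power_shift_def bernoulli_shift_def coord_shift_def fun_eq_iff)
  have pos: "(?T ^^ j) x = power_shift m (int j) x" for j
  proof (induction j)
    case (Suc j)
    then show ?case using power_shift_add[of m 1 "int j" x] by (simp add: T add.commute)
  qed (simp add: power_shift_0 x)
  have inv: "inv_into ?S ?T y = power_shift m (- 1) y" if "y \<in> ?S" for y
  proof (rule inv_into_f_eq)
    show "inj_on ?T ?S"
    proof (rule inj_on_inverseI)
      fix z assume "z \<in> ?S"
      then show "power_shift m (- 1) (?T z) = z"
        by (simp add: T power_shift_add[symmetric] power_shift_0)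
    qed
    show "?T (power_shift m (- 1) y) = y"
      using that by (simp add: T power_shift_add[symmetric] power_shift_0)
  qed simp
  have neg: "(inv_into ?S ?T ^^ j) x = power_shift m (- int j) x" for j
  proof (induction j)
    case (Suc j)
    then show ?case using power_shift_add[of m "- 1" "- int j" x] by (simp add: inv)
  qed (simp add: power_shift_0 x)
  show ?thesis
    by (cases "k \<ge> 0") (simp_all add: generated_action_def pos neg)
qed

lemma prob_space_power_measure: "prob_space (power_measure m \<mu>)"
  unfolding power_measure_def by (rule prob_space_PiM) (rule bernoulli.prob_space_axioms)

lemma power_shift_measurable [measurable]:
  "power_shift m k \<in> power_measure m \<mu> \<rightarrow>\<^sub>M power_measure m \<mu>"
  unfolding power_shift_def power_measure_def
proof (rule measurable_restrict)
  fix i assume "i \<in> {..<m}"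
  then show "(\<lambda>x. coord_shift k (x i)) \<in> Pi\<^sub>M {..<m} (\<lambda>_. \<mu>) \<rightarrow>\<^sub>M \<mu>"
    by (rule measurable_compose[OF measurable_component_singleton]) measurable
qed

lemma power_log_cocycle_measurable [measurable]:
  "power_log_cocycle m k \<in> borel_measurable (power_measure m \<mu>)"
  unfolding power_log_cocycle_def power_measure_def
proof (rule borel_measurable_sum)
  fix i assume "i \<in> {..<m}"
  then show "(\<lambda>x. log_cocycle k (x i)) \<in> borel_measurable (Pi\<^sub>M {..<m} (\<lambda>_. \<mu>))"
    by (rule measurable_compose[OF measurable_component_singleton]) measurable
qed

lemma distr_power_shift:
  "distr (power_measure m \<mu>) (power_measure m \<mu>) (power_shift m g)
    = density (power_measure m \<mu>) (\<lambda>x. ennreal (exp (power_log_cocycle m (- g) x)))"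
proof -
  let ?P = "power_measure m \<mu>"
  let ?N = "distr \<mu> \<mu> (coord_shift g)"
  interpret N: prob_space ?N
    by (rule bernoulli.prob_space_distr) measurable
  interpret M: product_sigma_finite "\<lambda>_::nat. \<mu>" by standard
  interpret PN: product_sigma_finite "\<lambda>_::nat. ?N" by standard
  have setsP: "sets ?P = sets (PiM {..<m} (\<lambda>_. ?N))"
    unfolding power_measure_def by (intro sets_PiM_cong) auto
  have "distr ?P ?P (power_shift m g) = PiM {..<m} (\<lambda>_. ?N)"
  proof (rule PN.PiM_eqI)
    fix A assume A: "\<And>i. i \<in> {..<m} \<Longrightarrow> A i \<in> sets ?N"
    then have A': "A i \<in> sets \<mu>" if "i < m" for i using that by simp
    have "emeasure (distr ?P ?P (power_shift m g)) (Pi\<^sub>E {..<m} A) = emeasure ?P (power_shift m g -` Pi\<^sub>E {..<m} A \<inter> space ?P)"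
      using A' by (intro emeasure_distr power_shift_measurable) (auto simp: power_measure_def intro!: sets_PiM_I_finite)
    also have "power_shift m g -` Pi\<^sub>E {..<m} A \<inter> space ?P = (\<Pi>\<^sub>E i\<in>{..<m}. coord_shift g -` A i)"
      by (auto simp: space_power_measure power_shift_def PiE_iff)
    also have "emeasure ?P \<dots> = (\<Prod>i<m. emeasure \<mu> (coord_shift g -` A i))"
      unfolding power_measure_def
    proof (rule M.emeasure_PiM)
      fix i assume "i \<in> {..<m}"
      then show "coord_shift g -` A i \<in> sets \<mu>"
        using measurable_sets[of "coord_shift g" \<mu> \<mu> "A i"] A' by simp
    qed simp
    also have "\<dots> = (\<Prod>i<m. emeasure ?N (A i))"
      using A' by (intro prod.cong refl) (subst emeasure_distr, auto)
    finally show "emeasure (distr ?P ?P (power_shift m g)) (Pi\<^sub>E {..<m} A) = (\<Prod>i<m. emeasure ?N (A i))" .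
  qed (simp_all add: setsP)
  moreover have "density ?P (\<lambda>x. ennreal (exp (power_log_cocycle m (- g) x))) = PiM {..<m} (\<lambda>_. ?N)"
  proof (rule PN.PiM_eqI)
    fix A assume A: "\<And>i. i \<in> {..<m} \<Longrightarrow> A i \<in> sets ?N"
    then have A' [measurable]: "A i \<in> sets \<mu>" if "i < m" for i using that by simp
    have "emeasure (density ?P (\<lambda>x. ennreal (exp (power_log_cocycle m (- g) x)))) (Pi\<^sub>E {..<m} A)
      = (\<integral>\<^sup>+x. ennreal (exp (power_log_cocycle m (- g) x)) * indicator (Pi\<^sub>E {..<m} A) x \<partial>?P)"
      using A' by (intro emeasure_density) (auto simp: power_measure_def[symmetric] intro!: sets_PiM_I_finite[of "{..<m}" A "\<lambda>_. \<mu>", folded power_measure_def])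
    also have "\<dots> = (\<integral>\<^sup>+x. (\<Prod>i<m. ennreal (exp (log_cocycle (- g) (x i))) * indicator (A i) (x i)) \<partial>?P)"
    proof (intro nn_integral_cong)
      fix x assume "x \<in> space ?P"
      then have "(indicator (Pi\<^sub>E {..<m} A) x :: ennreal) = (\<Prod>i<m. indicator (A i) (x i))"
        by (auto simp: indicator_def space_power_measure PiE_iff)
      then show "ennreal (exp (power_log_cocycle m (- g) x)) * indicator (Pi\<^sub>E {..<m} A) x
          = (\<Prod>i<m. ennreal (exp (log_cocycle (- g) (x i))) * indicator (A i) (x i))"
        by (simp add: prod.distrib power_log_cocycle_def exp_sum prod_ennreal)
    qed
    also have "\<dots> = (\<Prod>i<m. \<integral>\<^sup>+x. ennreal (exp (log_cocycle (- g) x)) * indicator (A i) x \<partial>\<mu>)"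
      unfolding power_measure_def by (rule M.product_nn_integral_prod) auto
    also have "\<dots> = (\<Prod>i<m. emeasure ?N (A i))"
      unfolding distr_bernoulli_shift by (intro prod.cong refl) (subst emeasure_density, auto)
    finally show "emeasure (density ?P (\<lambda>x. ennreal (exp (power_log_cocycle m (- g) x)))) (Pi\<^sub>E {..<m} A) = (\<Prod>i<m. emeasure ?N (A i))" .
  qed (simp_all add: setsP)
  ultimately show ?thesis by simp
qed

lemma nonsingular_power_action:
  "nonsingular_action (generated_action (power_measure m \<mu>) (power_transformation m bernoulli_shift))
     (power_measure m \<mu>)"
    (is "nonsingular_action ?a ?P")
proof -
  have meas: "?a g \<in> ?P \<rightarrow>\<^sub>M ?P" for g
    using power_shift_measurable[of m g] by (subst measurable_cong[OF generated_action_power]) auto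
  moreover have "distr ?P ?P (?a g) = distr ?P ?P (power_shift m g)" for g
    by (intro distr_cong) (auto simp: generated_action_power)
  then have "null_sets (distr ?P ?P (?a g)) = null_sets ?P" for g
    by (simp add: distr_power_shift null_sets_density_exp)
  ultimately show ?thesis
    unfolding nonsingular_action_def measurable_action_def
    by (auto simp: generated_action_power power_shift_0 power_shift_add)
qed

text \<open>
  Markov's inequality for the square root of the cocycle. The $m$-th power of $|k|^{-1/72}$ is summable
  over $k$ as soon as $m > 72$.
\<close>
lemma emeasure_power_cocycle_ge_1:
  assumes "m \<ge> 73" "k \<noteq> 0"
  shows "emeasure (power_measure m \<mu>) {x \<in> space (power_measure m \<mu>). 0 \<le> power_log_cocycle m k x}
    \<le> ennreal (real (nat \<bar>k\<bar>) powr (- 73 / 72))"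
proof -
  let ?P = "power_measure m \<mu>" and ?j = "nat \<bar>k\<bar>"
  interpret M: product_sigma_finite "\<lambda>_::nat. \<mu>" by standard
  have "emeasure ?P {x \<in> space ?P. 0 \<le> power_log_cocycle m k x} = (\<integral>\<^sup>+x. indicator {x \<in> space ?P. 0 \<le> power_log_cocycle m k x} x \<partial>?P)"
    by (rule nn_integral_indicator[symmetric]) measurable
  also have "\<dots> \<le> (\<integral>\<^sup>+x. ennreal (exp (1 / 2 * power_log_cocycle m k x)) \<partial>?P)"
    by (intro nn_integral_mono) (auto simp: indicator_def ennreal_1[symmetric] simp del: ennreal_1 intro!: ennreal_leI)
  also have "\<dots> = (\<integral>\<^sup>+x. (\<Prod>i<m. ennreal (exp (1 / 2 * log_cocycle k (x i)))) \<partial>?P)"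
    by (simp add: power_log_cocycle_def sum_distrib_left exp_sum prod_ennreal sum_divide_distrib)
  also have "\<dots> = (\<Prod>i<m. \<integral>\<^sup>+x. ennreal (exp (1 / 2 * log_cocycle k x)) \<partial>\<mu>)"
    unfolding power_measure_def by (rule M.product_nn_integral_prod) auto
  also have "\<dots> \<le> (\<Prod>i<m. ennreal (exp (- (harm ?j / 72))))"
    using nn_integral_sqrt_cocycle_le[of k] by (intro prod_mono_ennreal) (simp add: bernoulli_measure_eq)
  also have "\<dots> = ennreal (exp (- (real m * (harm ?j / 72))))"
    by (simp add: ennreal_power exp_of_nat_mult[symmetric])
  also have "\<dots> \<le> ennreal (real ?j powr (- 73 / 72))"
  proof (intro ennreal_leI)
    have "ln (real ?j) \<le> ln (real ?j + 1)" using assms by (subst ln_le_cancel_iff) auto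
    also have "\<dots> \<le> harm ?j" by (rule ln_le_harm)
    finally have ln: "ln (real ?j) \<le> harm ?j" .
    have "73 * (harm ?j / 72) \<le> real m * (harm ?j / 72)"
      using assms harm_nonneg[of ?j, where 'a = real] by (intro mult_right_mono) auto
    then have "- (real m * (harm ?j / 72)) \<le> (- 73 / 72) * ln (real ?j)"
      using ln by linarith
    then show "exp (- (real m * (harm ?j / 72))) \<le> real ?j powr (- 73 / 72)"
      using assms by (simp add: powr_def)
  qed
  finally show ?thesis .
qed

lemma finite_power_cocycle_ge_1:
  assumes m: "m \<ge> 73"
  shows "AE x in power_measure m \<mu>. finite {k. 0 \<le> power_log_cocycle m k x}"
proof -
  let ?P = "power_measure m \<mu>"
  interpret P: prob_space ?P by (rule prob_space_power_measure)
  have "AE x in ?P. finite {j::nat. 0 \<le> power_log_cocycle m (s * int j) x}" if s: "s = 1 \<or> s = - 1" for s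
  proof -
    let ?A = "\<lambda>j::nat. {x \<in> space ?P. 0 \<le> power_log_cocycle m (s * int j) x}"
    have "AE x in ?P. eventually (\<lambda>j. x \<in> space ?P - ?A j) sequentially"
    proof (rule borel_cantelli_AE1)
      show "summable (\<lambda>j. measure ?P (?A j))"
      proof (rule summable_comparison_test_ev)
        show "summable (\<lambda>j. real j powr (- 73 / 72))"
          by (subst summable_real_powr_iff) simp
        show "\<forall>\<^sub>F j in sequentially. norm (measure ?P (?A j)) \<le> real j powr (- 73 / 72)"
        proof (rule eventually_sequentiallyI[of 1])
          fix j :: nat assume "1 \<le> j"
          then have "emeasure ?P (?A j) \<le> ennreal (real j powr (- 73 / 72))"
            using emeasure_power_cocycle_ge_1[OF m, of "s * int j"] s by auto
          then show "norm (measure ?P (?A j)) \<le> real j powr (- 73 / 72)"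
            by (simp add: P.emeasure_eq_measure)
        qed
      qed
    qed (auto simp: P.emeasure_eq_measure)
    then show ?thesis
    proof eventually_elim
      case (elim x)
      then obtain N where "\<And>j. j \<ge> N \<Longrightarrow> \<not> 0 \<le> power_log_cocycle m (s * int j) x"
        by (auto simp: eventually_sequentially)
      then have "{j::nat. 0 \<le> power_log_cocycle m (s * int j) x} \<subseteq> {..<N}"
        by (auto simp: not_le[symmetric])
      then show ?case by (rule finite_subset) simp
    qed
  qed
  from this[of 1, simplified] this[of "- 1", simplified] show ?thesis
  proof eventually_elim
    case (elim x)
    have "{k. 0 \<le> power_log_cocycle m k x} \<subseteq> int ` {j. 0 \<le> power_log_cocycle m (int j) x}
        \<union> (\<lambda>j. - int j) ` {j. 0 \<le> power_log_cocycle m (- int j) x}"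
    proof
      fix k assume "k \<in> {k. 0 \<le> power_log_cocycle m k x}"
      then show "k \<in> int ` {j. 0 \<le> power_log_cocycle m (int j) x} \<union> (\<lambda>j. - int j) ` {j. 0 \<le> power_log_cocycle m (- int j) x}"
        by (cases "k \<ge> 0") (auto intro: image_eqI[of _ _ "nat k"] image_eqI[of _ _ "nat (- k)"])
    qed
    then show ?case using elim by (auto intro: finite_subset)
  qed
qed

text \<open>
  Along almost every orbit the cocycle is at least 1, its value at time 0, only finitely often. So it
  attains a maximum, and there is a first time at which this happens. By the cocycle identity moving
  the point translates this time, and \<open>U\<close> is the set of points for which it is 0.
\<close>
lemma dissipative_power_action:
  assumes m: "m \<ge> 73"
  shows "dissipative_action (generated_action (power_measure m \<mu>) (power_transformation m bernoulli_shift))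
     (power_measure m \<mu>)"
    (is "dissipative_action ?a ?P")
proof -
  define w where "w = power_log_cocycle m"
  have [measurable]: "w k \<in> borel_measurable ?P" for k unfolding w_def by measurable
  define U where "U = {x \<in> space ?P. (\<forall>k. w k x \<le> 0) \<and> (\<forall>k<0. w k x < 0)}"
  have U_sets [measurable]: "U \<in> sets ?P" unfolding U_def by measurable
  have w_add: "w (k + l) x = w k (power_shift m l x) + w l x" for k l x
    unfolding w_def by (rule power_log_cocycle_add)
  have image: "?a g ` U = {x \<in> space ?P. power_shift m (- g) x \<in> U}" for g
  proof (intro set_eqI iffI)
    fix y assume "y \<in> ?a g ` U"
    then obtain x where "x \<in> U" "y = power_shift m g x" by (auto simp: U_def generated_action_power)
    then show "y \<in> {x \<in> space ?P. power_shift m (- g) x \<in> U}"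
      by (auto simp: power_shift_add[symmetric] power_shift_0 U_def)
  next
    fix y assume y: "y \<in> {x \<in> space ?P. power_shift m (- g) x \<in> U}"
    then have "y = ?a g (power_shift m (- g) y)"
      by (auto simp: generated_action_power power_shift_add[symmetric] power_shift_0)
    then show "y \<in> ?a g ` U" using y by auto
  qed
  have first_max: "(\<forall>k. w k x \<le> w (- g) x) \<and> (\<forall>k. k < - g \<longrightarrow> w k x < w (- g) x)" if "x \<in> ?a g ` U" for g x
  proof -
    have x: "power_shift m (- g) x \<in> U" using that image by auto
    have *: "w k x = w (k + g) (power_shift m (- g) x) + w (- g) x" for k
      using w_add[of "k + g" "- g" x] by simp
    have "w k x \<le> w (- g) x" for k using x unfolding *[of k] U_def by auto
    moreover have "w k x < w (- g) x" if "k < - g" for k using x that unfolding *[of k] U_def by auto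
    ultimately show ?thesis by blast
  qed
  have "disjoint_family (\<lambda>g. ?a g ` U)"
    unfolding disjoint_family_on_def
  proof (intro ballI impI)
    fix g h :: int assume "g \<noteq> h"
    show "?a g ` U \<inter> ?a h ` U = {}"
    proof (rule ccontr)
      assume "?a g ` U \<inter> ?a h ` U \<noteq> {}"
      then obtain x where "x \<in> ?a g ` U" "x \<in> ?a h ` U" by blast
      from this[THEN first_max] \<open>g \<noteq> h\<close> show False
        by (cases "- g < - h") (force simp: not_le[symmetric])+
    qed
  qed
  moreover have "space ?P - (\<Union>g. ?a g ` U) \<in> null_sets ?P"
  proof -
    have [measurable]: "?a g ` U \<in> sets ?P" for g
      unfolding image by measurable
    have "AE x in ?P. x \<in> (\<Union>g. ?a g ` U)"
      using finite_power_cocycle_ge_1[OF m] AE_space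
    proof eventually_elim
      case (elim x)
      let ?K = "{k. 0 \<le> w k x}"
      have "w 0 x = 0" by (simp add: w_def power_log_cocycle_def)
      then have K: "finite ?K" "0 \<in> ?K" using elim by (auto simp: w_def)
      define M where "M = Max ((\<lambda>k. w k x) ` ?K)"
      let ?L = "{k \<in> ?K. w k x = M}"
      have le_M: "w k x \<le> M" for k
      proof (cases "k \<in> ?K")
        case False
        then have "w k x < w 0 x" by (simp add: \<open>w 0 x = 0\<close>)
        also have "\<dots> \<le> M" unfolding M_def using K by (intro Max_ge) auto
        finally show ?thesis by simp
      qed (use K in \<open>auto simp: M_def\<close>)
      have "M \<in> (\<lambda>k. w k x) ` ?K" unfolding M_def using K by (intro Max_in) auto
      then have L: "finite ?L" "?L \<noteq> {}" using K by auto
      define l where "l = Min ?L"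
      have l: "l \<in> ?L" unfolding l_def using L by (rule Min_in)
      have max: "w k x \<le> w l x" for k using le_M[of k] l by simp
      have first: "w k x < w l x" if "k < l" for k
      proof -
        have "k \<notin> ?L" using L that unfolding l_def by (meson Min_le leD)
        then have "w k x \<noteq> M" using l K(2) by auto
        then show ?thesis using le_M[of k] l by simp
      qed
      have "w k (power_shift m l x) = w (k + l) x - w l x" for k
        using w_add[of k l x] by simp
      then have "power_shift m l x \<in> U"
        unfolding U_def using max first by (auto simp: less_diff_eq[symmetric])
      then have "x \<in> ?a (- l) ` U" unfolding image using elim by simp
      then show ?case by blast
    qed
    then show ?thesis
      by (subst (asm) AE_iff_null) (auto simp: set_diff_eq)
  qed
  ultimately show ?thesis
    unfolding dissipative_action_def using nonsingular_power_action U_sets by blast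
qed

section \<open>Averaging over the past\<close>

abbreviation fair_measure :: "(int \<Rightarrow> bool) measure" where
  "fair_measure \<equiv> coin_product (\<lambda>_. bernoulli_pmf (1 / 2))"

interpretation fair: prob_space fair_measure
  by (rule prob_space_coin_product)

lemma mix_law_bernoulli:
  "distr (\<mu> \<Otimes>\<^sub>M \<mu>) cantor_borel (\<lambda>(x, x'). mix I x x') = \<mu>"
  unfolding bernoulli_measure_eq distr_mix by simp

lemma mix_law_fair:
  "distr (fair_measure \<Otimes>\<^sub>M fair_measure) cantor_borel (\<lambda>(x, x'). mix I x x') = fair_measure"
  unfolding distr_mix by simp

lemma mix_law_past:
  "distr (\<mu> \<Otimes>\<^sub>M fair_measure) cantor_borel (\<lambda>(x, x'). mix {- int L<..} x x') = \<mu>"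
proof -
  have "(\<lambda>n. if n \<in> {- int L<..} then coin n else bernoulli_pmf (1 / 2)) = coin"
    by (auto simp: coin_nonpos)
  then show ?thesis unfolding bernoulli_measure_eq distr_mix by simp
qed

lemma nn_integral_mix_law:
  assumes law: "distr (M \<Otimes>\<^sub>M N) cantor_borel (\<lambda>(x, x'). mix I x x') = M"
    and [measurable_cong]: "sets M = sets cantor_borel" "sets N = sets cantor_borel"
    and "sigma_finite_measure N"
    and [measurable]: "g \<in> borel_measurable cantor_borel"
  shows "(\<integral>\<^sup>+x. g x \<partial>M) = (\<integral>\<^sup>+x. \<integral>\<^sup>+x'. g (mix I x x') \<partial>N \<partial>M)"
proof -
  interpret N: sigma_finite_measure N by fact
  have "(\<integral>\<^sup>+x. g x \<partial>M) = (\<integral>\<^sup>+x. g x \<partial>distr (M \<Otimes>\<^sub>M N) cantor_borel (\<lambda>(x, x'). mix I x x'))"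
    by (simp add: law)
  also have "\<dots> = (\<integral>\<^sup>+z. g (case z of (x, x') \<Rightarrow> mix I x x') \<partial>(M \<Otimes>\<^sub>M N))"
    by (rule nn_integral_distr) measurable
  also have "\<dots> = (\<integral>\<^sup>+x. \<integral>\<^sup>+x'. g (mix I x x') \<partial>N \<partial>M)"
    by (subst N.nn_integral_fst[symmetric]) auto
  finally show ?thesis .
qed

lemma nn_integral_mix:
  fixes g :: "(int \<Rightarrow> bool) \<times> 'v \<Rightarrow> ennreal"
  assumes law: "distr (\<mu> \<Otimes>\<^sub>M N) cantor_borel (\<lambda>(x, x'). mix I x x') = \<mu>"
    and sets_N [measurable_cong]: "sets N = sets cantor_borel"
    and N: "prob_space N" and V: "sigma_finite_measure V"
    and [measurable]: "g \<in> borel_measurable (\<mu> \<Otimes>\<^sub>M V)"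
  shows "(\<integral>\<^sup>+z. g z \<partial>(\<mu> \<Otimes>\<^sub>M V))
    = (\<integral>\<^sup>+z. \<integral>\<^sup>+x'. g (mix I (fst z) x', snd z) \<partial>N \<partial>(\<mu> \<Otimes>\<^sub>M V))"
proof -
  interpret N: prob_space N by fact
  interpret V: sigma_finite_measure V by fact
  interpret P: pair_sigma_finite \<mu> V by standard
  have "(\<integral>\<^sup>+z. g z \<partial>(\<mu> \<Otimes>\<^sub>M V)) = (\<integral>\<^sup>+v. \<integral>\<^sup>+x. g (x, v) \<partial>\<mu> \<partial>V)"
    by (rule P.nn_integral_snd[symmetric]) measurable
  also have "\<dots> = (\<integral>\<^sup>+v. \<integral>\<^sup>+x. \<integral>\<^sup>+x'. g (mix I x x', v) \<partial>N \<partial>\<mu> \<partial>V)"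
    by (intro nn_integral_cong nn_integral_mix_law[OF law])
      (auto simp: sets_bernoulli_measure sets_N N.sigma_finite_measure_axioms)
  also have "\<dots> = (\<integral>\<^sup>+z. \<integral>\<^sup>+x'. g (mix I (fst z) x', snd z) \<partial>N \<partial>(\<mu> \<Otimes>\<^sub>M V))"
    using P.nn_integral_snd[of "\<lambda>z. \<integral>\<^sup>+x'. g (mix I (fst z) x', snd z) \<partial>N"] by simp
  finally show ?thesis .
qed

lemma mix_section_measurable:
  assumes f [measurable]: "f \<in> borel_measurable (\<mu> \<Otimes>\<^sub>M V)" and v: "v \<in> space V"
  shows "(\<lambda>x'. f (mix I x x', v)) \<in> borel_measurable cantor_borel"
proof -
  have "x \<in> space cantor_borel" by (simp add: space_PiM)
  then have "(\<lambda>x'. mix I x x') \<in> cantor_borel \<rightarrow>\<^sub>M \<mu>"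
    unfolding measurable_cong_sets[OF refl sets_bernoulli_measure]
    by (intro mix_measurable measurable_const measurable_ident_sets[OF refl])
  then show ?thesis
    by (intro measurable_compose[OF measurable_Pair f] measurable_const v)
qed

lemma AE_mix:
  fixes P :: "(int \<Rightarrow> bool) \<times> 'v \<Rightarrow> bool"
  assumes law: "distr (\<mu> \<Otimes>\<^sub>M N) cantor_borel (\<lambda>(x, x'). mix I x x') = \<mu>"
    and sets_N [measurable_cong]: "sets N = sets cantor_borel"
    and N: "prob_space N" and V: "sigma_finite_measure V"
    and P: "AE z in \<mu> \<Otimes>\<^sub>M V. P z"
  shows "AE z in \<mu> \<Otimes>\<^sub>M V. AE x' in N. P (mix I (fst z) x', snd z)"
proof -
  interpret N: prob_space N by fact
  have space_N: "space N = UNIV" using sets_eq_imp_space_eq[OF sets_N] by (simp add: space_PiM)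
  obtain B where B: "B \<in> null_sets (\<mu> \<Otimes>\<^sub>M V)" "{z \<in> space (\<mu> \<Otimes>\<^sub>M V). \<not> P z} \<subseteq> B"
    using P by (auto simp: eventually_ae_filter)
  then have [measurable]: "B \<in> sets (\<mu> \<Otimes>\<^sub>M V)" by auto
  have "(\<integral>\<^sup>+z. \<integral>\<^sup>+x'. indicator B (mix I (fst z) x', snd z) \<partial>N \<partial>(\<mu> \<Otimes>\<^sub>M V)) = (\<integral>\<^sup>+z. indicator B z \<partial>(\<mu> \<Otimes>\<^sub>M V))"
    by (rule nn_integral_mix[OF law sets_N N V, symmetric]) measurable
  also have "\<dots> = 0" using null_setsD1[OF B(1)] by simp
  finally have "AE z in \<mu> \<Otimes>\<^sub>M V. (\<integral>\<^sup>+x'. indicator B (mix I (fst z) x', snd z) \<partial>N) = 0"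
    by (subst (asm) nn_integral_0_iff_AE) auto
  then show ?thesis
    using AE_space
  proof eventually_elim
    case (elim z)
    then have v: "snd z \<in> space V" by (auto simp: space_pair_measure)
    have [measurable]: "(\<lambda>x'. indicator B (mix I (fst z) x', snd z) :: ennreal) \<in> borel_measurable N"
      unfolding measurable_cong_sets[OF sets_N refl]
      by (rule mix_section_measurable[OF _ v]) measurable
    have "AE x' in N. indicator B (mix I (fst z) x', snd z) = (0 :: ennreal)"
      using elim by (subst (asm) nn_integral_0_iff_AE) auto
    then show ?case
      by eventually_elim (use B v in \<open>auto simp: indicator_def space_pair_measure split: if_splits\<close>)
  qed
qed

lemma mix_mix_left: "mix I (mix I x x') x'' = mix I x x''"
  by (auto simp: mix_def)

lemma mix_mix_assoc: "I \<subseteq> I' \<Longrightarrow> mix I' (mix I x x') x'' = mix I x (mix I' x' x'')"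
  by (auto simp: mix_def fun_eq_iff)

text \<open>
  The conditional expectation given the coordinates $n > -L$ and the second component. The resampled
  coordinates are at most 0, hence fair, so that the average can be taken over a measure that the shift
  preserves.
\<close>
definition past_average :: "nat \<Rightarrow> ((int \<Rightarrow> bool) \<times> 'v \<Rightarrow> ennreal) \<Rightarrow> (int \<Rightarrow> bool) \<times> 'v \<Rightarrow> ennreal" where
  "past_average L f z = (\<integral>\<^sup>+x'. f (mix {- int L<..} (fst z) x', snd z) \<partial>fair_measure)"

lemma past_average_measurable [measurable]:
  assumes [measurable]: "f \<in> borel_measurable (\<mu> \<Otimes>\<^sub>M V)"
  shows "past_average L f \<in> borel_measurable (\<mu> \<Otimes>\<^sub>M V)"
  unfolding past_average_def by measurable

lemma past_average_le_1:
  assumes "\<And>z. f z \<le> 1"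
  shows "past_average L f z \<le> 1"
proof -
  have "past_average L f z \<le> (\<integral>\<^sup>+x'. 1 \<partial>fair_measure)"
    unfolding past_average_def using assms by (intro nn_integral_mono) auto
  then show ?thesis by simp
qed

lemma past_average_mix: "past_average L f (mix {- int L<..} x x', v) = past_average L f (x, v)"
  by (simp add: past_average_def mix_mix_left)

lemma past_average_tower:
  assumes [measurable]: "f \<in> borel_measurable (\<mu> \<Otimes>\<^sub>M V)" and "L \<le> L'" and v [measurable]: "v \<in> space V"
  shows "(\<integral>\<^sup>+x'. past_average L' f (mix {- int L<..} x x', v) \<partial>fair_measure) = past_average L f (x, v)"
proof -
  have "past_average L f (x, v) = (\<integral>\<^sup>+x'. f (mix {- int L<..} x x', v) \<partial>fair_measure)"
    by (simp add: past_average_def)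
  also have "\<dots> = (\<integral>\<^sup>+x'. \<integral>\<^sup>+x''. f (mix {- int L<..} x (mix {- int L'<..} x' x''), v) \<partial>fair_measure \<partial>fair_measure)"
    by (rule nn_integral_mix_law[OF mix_law_fair])
      (simp_all add: sets_coin_product fair.sigma_finite_measure_axioms mix_section_measurable[OF assms(1) v])
  also have "\<dots> = (\<integral>\<^sup>+x'. past_average L' f (mix {- int L<..} x x', v) \<partial>fair_measure)"
    using assms(2) by (simp add: past_average_def mix_mix_assoc)
  finally show ?thesis ..
qed

lemma nn_integral_past_average:
  fixes f h :: "(int \<Rightarrow> bool) \<times> 'v \<Rightarrow> ennreal"
  assumes [measurable]: "f \<in> borel_measurable (\<mu> \<Otimes>\<^sub>M V)" "h \<in> borel_measurable (\<mu> \<Otimes>\<^sub>M V)"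
    and V: "sigma_finite_measure V" and h: "\<And>x x' v. h (mix {- int L<..} x x', v) = h (x, v)"
  shows "(\<integral>\<^sup>+z. h z * f z \<partial>(\<mu> \<Otimes>\<^sub>M V)) = (\<integral>\<^sup>+z. h z * past_average L f z \<partial>(\<mu> \<Otimes>\<^sub>M V))"
proof -
  have "(\<integral>\<^sup>+z. h z * f z \<partial>(\<mu> \<Otimes>\<^sub>M V))
    = (\<integral>\<^sup>+z. \<integral>\<^sup>+x'. h (mix {- int L<..} (fst z) x', snd z) * f (mix {- int L<..} (fst z) x', snd z) \<partial>fair_measure \<partial>(\<mu> \<Otimes>\<^sub>M V))"
    by (rule nn_integral_mix[OF mix_law_past]) (auto simp: sets_coin_product V fair.prob_space_axioms)
  also have "\<dots> = (\<integral>\<^sup>+z. h z * past_average L f z \<partial>(\<mu> \<Otimes>\<^sub>M V))"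
  proof (intro nn_integral_cong)
    fix z assume "z \<in> space (\<mu> \<Otimes>\<^sub>M V)"
    then have "snd z \<in> space V" by (auto simp: space_pair_measure)
    from mix_section_measurable[OF assms(1) this]
    have "(\<lambda>x'. f (mix {- int L<..} (fst z) x', snd z)) \<in> borel_measurable fair_measure"
      unfolding measurable_cong_sets[OF sets_coin_product refl] .
    then show "(\<integral>\<^sup>+x'. h (mix {- int L<..} (fst z) x', snd z) * f (mix {- int L<..} (fst z) x', snd z) \<partial>fair_measure) = h z * past_average L f z"
      unfolding h past_average_def by (subst nn_integral_cmult) auto
  qed
  finally show ?thesis .
qed

lemma nn_integral_past_average_tower:
  fixes f h :: "(int \<Rightarrow> bool) \<times> 'v \<Rightarrow> ennreal"
  assumes [measurable]: "f \<in> borel_measurable (\<mu> \<Otimes>\<^sub>M V)" "h \<in> borel_measurable (\<mu> \<Otimes>\<^sub>M V)"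
    and V: "sigma_finite_measure V" and h: "\<And>x x' v. h (mix {- int L<..} x x', v) = h (x, v)" and L: "L \<le> L'"
  shows "(\<integral>\<^sup>+z. h z * past_average L' f z \<partial>(\<mu> \<Otimes>\<^sub>M V)) = (\<integral>\<^sup>+z. h z * past_average L f z \<partial>(\<mu> \<Otimes>\<^sub>M V))"
proof -
  have "(\<integral>\<^sup>+z. h z * past_average L' f z \<partial>(\<mu> \<Otimes>\<^sub>M V))
      = (\<integral>\<^sup>+z. h z * past_average L (past_average L' f) z \<partial>(\<mu> \<Otimes>\<^sub>M V))"
    by (rule nn_integral_past_average[OF _ _ V h]) measurable
  also have "\<dots> = (\<integral>\<^sup>+z. h z * past_average L f z \<partial>(\<mu> \<Otimes>\<^sub>M V))"
  proof (intro nn_integral_cong)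
    fix z assume "z \<in> space (\<mu> \<Otimes>\<^sub>M V)"
    then have v: "snd z \<in> space V" by (auto simp: space_pair_measure)
    have "past_average L (past_average L' f) z = (\<integral>\<^sup>+x'. past_average L' f (mix {- int L<..} (fst z) x', snd z) \<partial>fair_measure)"
      by (simp add: past_average_def[of L "past_average L' f"])
    also have "\<dots> = past_average L f (fst z, snd z)"
      by (rule past_average_tower[OF assms(1) L v])
    finally show "h z * past_average L (past_average L' f) z = h z * past_average L f z" by simp
  qed
  finally show ?thesis .
qed

text \<open>
  The difference is taken in the reals, since subtraction in the extended nonnegative numbers
  truncates at 0.
\<close>
definition sq_diff :: "ennreal \<Rightarrow> ennreal \<Rightarrow> ennreal" where
  "sq_diff a b = ennreal ((enn2real a - enn2real b)\<^sup>2)"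

lemma sq_diff_measurable [measurable (raw)]:
  assumes [measurable]: "f \<in> borel_measurable M" "g \<in> borel_measurable M"
  shows "(\<lambda>x. sq_diff (f x) (g x)) \<in> borel_measurable M"
  unfolding sq_diff_def by measurable

lemma sq_diff_expand:
  assumes "a \<le> 1" "b \<le> 1"
  shows "sq_diff a b + (b * a + b * a) = a * a + b * b"
proof -
  obtain a' where a: "a = ennreal a'" "0 \<le> a'"
    using assms(1) by (cases a) (auto simp: top_unique)
  obtain b' where b: "b = ennreal b'" "0 \<le> b'"
    using assms(2) by (cases b) (auto simp: top_unique)
  have "(a' - b')\<^sup>2 + (b' * a' + b' * a') = a' * a' + b' * b'"
    by (simp add: power2_eq_square algebra_simps)
  then show ?thesis
    using a(2) b(2) unfolding sq_diff_def a(1) b(1)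
    by (simp add: ennreal_mult[symmetric] ennreal_plus[symmetric] del: ennreal_plus)
qed

lemma le_of_add_eq: "a + b = c \<Longrightarrow> (a :: ennreal) \<le> c"
  by (auto intro: add_increasing2)

text \<open>
  The averages form a martingale, and \<open>B\<close> is measurable for all of its stages. The integrals of
  the squared increments over \<open>B\<close> therefore telescope to a difference of integrals of squares.
\<close>
lemma past_average_orthogonal:
  fixes f :: "(int \<Rightarrow> bool) \<times> 'v \<Rightarrow> ennreal"
  assumes [measurable]: "f \<in> borel_measurable (\<mu> \<Otimes>\<^sub>M V)" and f1: "\<And>z. f z \<le> 1"
    and V: "sigma_finite_measure V" and [measurable]: "B \<in> sets V" and B: "emeasure V B < \<infinity>"
  shows "(\<Sum>L<n. \<integral>\<^sup>+z. indicator B (snd z) * sq_diff (past_average (Suc L) f z) (past_average L f z) \<partial>(\<mu> \<Otimes>\<^sub>M V)) \<le> emeasure V B"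
proof -
  let ?Z = "\<mu> \<Otimes>\<^sub>M V"
  let ?Q = "\<lambda>L. past_average L f"
  let ?S = "\<lambda>L. \<integral>\<^sup>+z. indicator B (snd z) * (?Q L z * ?Q L z) \<partial>?Z"
  interpret V: sigma_finite_measure V by fact
  have Q1: "?Q L z \<le> 1" for L z by (rule past_average_le_1[OF f1])
  have QQ: "?Q L z * ?Q L z \<le> 1" for L z
    using mult_mono[OF Q1[of L z] Q1[of L z]] by simp
  have S_le: "?S L \<le> emeasure V B" for L
  proof -
    have "?S L \<le> (\<integral>\<^sup>+z. indicator (UNIV \<times> B) z \<partial>?Z)"
      using QQ by (intro nn_integral_mono) (auto simp: indicator_def)
    also have "\<dots> = emeasure ?Z (UNIV \<times> B)"
      using sets.top[of \<mu>] by (intro nn_integral_indicator) auto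
    also have "\<dots> = emeasure \<mu> UNIV * emeasure V B"
      using sets.top[of \<mu>] by (intro V.emeasure_pair_measure_Times) auto
    finally show ?thesis using bernoulli.emeasure_space_1 by simp
  qed
  have step: "(\<integral>\<^sup>+z. indicator B (snd z) * sq_diff (?Q (Suc L) z) (?Q L z) \<partial>?Z) + ?S L = ?S (Suc L)" for L
  proof -
    have cross: "(\<integral>\<^sup>+z. indicator B (snd z) * (?Q L z * ?Q (Suc L) z) \<partial>?Z) = ?S L"
      using nn_integral_past_average_tower[of f V "\<lambda>z. indicator B (snd z) * ?Q L z" L "Suc L"] V
      by (simp add: past_average_mix mult.assoc)
    have "(\<integral>\<^sup>+z. indicator B (snd z) * sq_diff (?Q (Suc L) z) (?Q L z) \<partial>?Z) + (?S L + ?S L)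
      = (\<integral>\<^sup>+z. indicator B (snd z) * (sq_diff (?Q (Suc L) z) (?Q L z) + (?Q L z * ?Q (Suc L) z + ?Q L z * ?Q (Suc L) z)) \<partial>?Z)"
      unfolding cross[symmetric] by (simp add: nn_integral_add distrib_left)
    also have "\<dots> = ?S (Suc L) + ?S L"
      unfolding sq_diff_expand[OF Q1 Q1] by (simp add: nn_integral_add distrib_left)
    finally have "((\<integral>\<^sup>+z. indicator B (snd z) * sq_diff (?Q (Suc L) z) (?Q L z) \<partial>?Z) + ?S L) + ?S L = ?S (Suc L) + ?S L"
      by (simp add: add.assoc)
    moreover have "?S L \<noteq> \<infinity>" using S_le[of L] B by auto
    ultimately show ?thesis by (simp add: add.commute[of _ "?S L"] ennreal_add_left_cancel)
  qed
  have "(\<Sum>L<n. \<integral>\<^sup>+z. indicator B (snd z) * sq_diff (?Q (Suc L) z) (?Q L z) \<partial>?Z) + ?S 0 = ?S n"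
  proof (induction n)
    case (Suc n)
    have "(\<Sum>L<Suc n. \<integral>\<^sup>+z. indicator B (snd z) * sq_diff (?Q (Suc L) z) (?Q L z) \<partial>?Z) + ?S 0
      = (\<integral>\<^sup>+z. indicator B (snd z) * sq_diff (?Q (Suc n) z) (?Q n z) \<partial>?Z)
        + ((\<Sum>L<n. \<integral>\<^sup>+z. indicator B (snd z) * sq_diff (?Q (Suc L) z) (?Q L z) \<partial>?Z) + ?S 0)"
      by (simp add: ac_simps)
    also have "\<dots> = ?S (Suc n)" unfolding Suc by (rule step)
    finally show ?case .
  qed simp
  then have "(\<Sum>L<n. \<integral>\<^sup>+z. indicator B (snd z) * sq_diff (?Q (Suc L) z) (?Q L z) \<partial>?Z) \<le> ?S n"
    by (rule le_of_add_eq)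
  also have "\<dots> \<le> emeasure V B" by (rule S_le)
  finally show ?thesis .
qed

section \<open>Skew products over the Bernoulli shift\<close>

definition level_measure :: "real measure"  ("\<nu>") where
  "\<nu> = density lborel (\<lambda>s. ennreal (exp (- s)))"

lemma sets_level_measure [measurable_cong]: "sets \<nu> = sets borel"
  by (simp add: level_measure_def)

lemma space_level_measure [simp]: "space \<nu> = UNIV"
  by (simp add: level_measure_def)

lemma nn_integral_level_measure:
  assumes [measurable]: "g \<in> borel_measurable borel"
  shows "(\<integral>\<^sup>+s. g s \<partial>\<nu>) = (\<integral>\<^sup>+s. ennreal (exp (- s)) * g s \<partial>lborel)"
  unfolding level_measure_def by (subst nn_integral_density) auto

lemma sigma_finite_level_measure: "sigma_finite_measure \<nu>"
  unfolding level_measure_def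
  by (subst sigma_finite_measure.sigma_finite_iff_density_finite[OF sigma_finite_lborel]) auto

lemma emeasure_level_measure_ge: "emeasure \<nu> {- a..} = ennreal (exp a)"
proof -
  have "emeasure \<nu> {- a..} = (\<integral>\<^sup>+s. ennreal (exp (- s)) * indicator {- a..} s \<partial>lborel)"
    unfolding level_measure_def by (subst emeasure_density) auto
  also have "\<dots> = ennreal (0 - (- exp (- (- a))))"
  proof (rule nn_integral_FTC_atLeast)
    show "DERIV (\<lambda>s. - exp (- s)) x :> exp (- x)" for x :: real
      by (auto intro!: derivative_eq_intros)
    have "((\<lambda>s::real. exp (- s)) \<longlongrightarrow> 0) at_top"
      by (rule filterlim_compose[OF exp_at_bot filterlim_uminus_at_bot_at_top])
    then show "((\<lambda>s::real. - exp (- s)) \<longlongrightarrow> 0) at_top"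
      using tendsto_minus by fastforce
  qed auto
  finally show ?thesis by simp
qed

lemma nn_integral_level_translate:
  assumes [measurable]: "g \<in> borel_measurable borel"
  shows "(\<integral>\<^sup>+s. g (s + c) \<partial>\<nu>) = ennreal (exp c) * (\<integral>\<^sup>+s. g s \<partial>\<nu>)"
proof -
  have "(\<integral>\<^sup>+s. g s \<partial>\<nu>) = (\<integral>\<^sup>+s. ennreal (exp (- s)) * g s \<partial>lborel)"
    by (rule nn_integral_level_measure) measurable
  also have "\<dots> = (\<integral>\<^sup>+s. ennreal (exp (- (c + 1 * s))) * g (c + 1 * s) \<partial>lborel)"
    by (subst nn_integral_real_affine[where c = 1 and t = c]) auto
  also have "\<dots> = (\<integral>\<^sup>+s. ennreal (exp (- c)) * (ennreal (exp (- s)) * g (s + c)) \<partial>lborel)"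
  proof (intro nn_integral_cong)
    fix s
    have "ennreal (exp (- (c + 1 * s))) = ennreal (exp (- c)) * ennreal (exp (- s))"
      by (simp add: ennreal_mult[symmetric] exp_add[symmetric])
    then show "ennreal (exp (- (c + 1 * s))) * g (c + 1 * s) = ennreal (exp (- c)) * (ennreal (exp (- s)) * g (s + c))"
      by (simp add: mult.assoc add.commute)
  qed
  also have "\<dots> = ennreal (exp (- c)) * (\<integral>\<^sup>+s. g (s + c) \<partial>\<nu>)"
    by (subst nn_integral_cmult) (auto simp: nn_integral_level_measure)
  finally have "ennreal (exp c) * (\<integral>\<^sup>+s. g s \<partial>\<nu>)
      = (ennreal (exp c) * ennreal (exp (- c))) * (\<integral>\<^sup>+s. g (s + c) \<partial>\<nu>)"
    by (simp add: mult.assoc)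
  then show ?thesis by (simp add: ennreal_mult[symmetric] exp_minus)
qed

text \<open>
  The product of the Maharam extension with a probability measure preserving action, in an order that
  puts the shift space first: the coordinates of $x$ are resampled and the point $(y, s)$ of the fibre
  stays fixed. Using the explicit cocycle instead of a Radon-Nikodym derivative makes the identities of
  an action hold everywhere.
\<close>
locale skew_product =
  fixes Y :: "'y measure" and b :: "int \<Rightarrow> 'y \<Rightarrow> 'y"
  assumes prob_Y: "prob_space Y" and pmp: "measure_preserving_action b Y"
begin

sublocale Y: prob_space Y by (rule prob_Y)

abbreviation fibre :: "('y \<times> real) measure" where
  "fibre \<equiv> Y \<Otimes>\<^sub>M \<nu>"

abbreviation skew_space :: "((int \<Rightarrow> bool) \<times> 'y \<times> real) measure" where
  "skew_space \<equiv> \<mu> \<Otimes>\<^sub>M fibre"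

sublocale level: sigma_finite_measure \<nu>
  by (rule sigma_finite_level_measure)

sublocale Yl: pair_sigma_finite Y \<nu> ..

lemma sigma_finite_fibre: "sigma_finite_measure fibre" ..

definition skew :: "int \<Rightarrow> (int \<Rightarrow> bool) \<times> 'y \<times> real \<Rightarrow> (int \<Rightarrow> bool) \<times> 'y \<times> real" where
  "skew k = (\<lambda>(x, y, s). (coord_shift k x, b k y, s + log_cocycle k x))"

lemma b_measurable [measurable]: "b k \<in> Y \<rightarrow>\<^sub>M Y"
  using pmp by (simp add: measure_preserving_action_def measurable_action_def)

lemma b_0: "y \<in> space Y \<Longrightarrow> b 0 y = y"
  using pmp by (simp add: measure_preserving_action_def measurable_action_def)

lemma b_add: "y \<in> space Y \<Longrightarrow> b (k + l) y = b k (b l y)"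
  using pmp by (simp add: measure_preserving_action_def measurable_action_def)

lemma nn_integral_b:
  assumes [measurable]: "g \<in> borel_measurable Y"
  shows "(\<integral>\<^sup>+y. g (b k y) \<partial>Y) = (\<integral>\<^sup>+y. g y \<partial>Y)"
proof -
  have "(\<integral>\<^sup>+y. g y \<partial>Y) = (\<integral>\<^sup>+y. g y \<partial>distr Y Y (b k))"
    using pmp by (simp add: measure_preserving_action_def)
  then show ?thesis by (simp add: nn_integral_distr)
qed

lemma skew_measurable [measurable]: "skew k \<in> skew_space \<rightarrow>\<^sub>M skew_space"
  unfolding skew_def by measurable

lemma skew_in_space: "z \<in> space skew_space \<Longrightarrow> skew k z \<in> space skew_space"
  by (rule measurable_space[OF skew_measurable])

lemma skew_0: "z \<in> space skew_space \<Longrightarrow> skew 0 z = z"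
  by (auto simp: skew_def space_pair_measure b_0)

lemma skew_add: "z \<in> space skew_space \<Longrightarrow> skew (k + l) z = skew k (skew l z)"
  by (auto simp: skew_def space_pair_measure b_add log_cocycle_add coord_shift_add)

lemma nn_integral_total:
  assumes [measurable]: "g \<in> borel_measurable skew_space"
  shows "(\<integral>\<^sup>+z. g z \<partial>skew_space) = (\<integral>\<^sup>+x. \<integral>\<^sup>+y. \<integral>\<^sup>+s. g (x, y, s) \<partial>\<nu> \<partial>Y \<partial>\<mu>)"
proof -
  have "(\<integral>\<^sup>+z. g z \<partial>skew_space) = (\<integral>\<^sup>+x. \<integral>\<^sup>+v. g (x, v) \<partial>fibre \<partial>\<mu>)"
    by (rule sigma_finite_measure.nn_integral_fst[OF sigma_finite_fibre, symmetric]) measurable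
  also have "\<dots> = (\<integral>\<^sup>+x. \<integral>\<^sup>+y. \<integral>\<^sup>+s. g (x, y, s) \<partial>\<nu> \<partial>Y \<partial>\<mu>)"
    by (intro nn_integral_cong level.nn_integral_fst[symmetric]) measurable
  finally show ?thesis .
qed

lemma nn_integral_log_cocycle_shift:
  assumes [measurable]: "G \<in> borel_measurable \<mu>"
  shows "(\<integral>\<^sup>+x. ennreal (exp (log_cocycle k x)) * G (coord_shift k x) \<partial>\<mu>) = (\<integral>\<^sup>+x. G x \<partial>\<mu>)"
proof -
  have "(\<integral>\<^sup>+x. ennreal (exp (log_cocycle k x)) * G (coord_shift k x) \<partial>\<mu>)
      = (\<integral>\<^sup>+x. G (coord_shift k x) \<partial>density \<mu> (\<lambda>x. ennreal (exp (log_cocycle k x))))"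
    by (subst nn_integral_density) auto
  also have "\<dots> = (\<integral>\<^sup>+x. G (coord_shift k x) \<partial>distr \<mu> \<mu> (coord_shift (- k)))"
    by (simp add: distr_bernoulli_shift)
  also have "\<dots> = (\<integral>\<^sup>+x. G x \<partial>\<mu>)"
    by (subst nn_integral_distr) (auto simp: coord_shift_add[symmetric])
  finally show ?thesis .
qed

text \<open>
  Translating the level by the logarithm of the cocycle multiplies $e^{-s} ds$ by the cocycle, and this
  compensates the change of \<open>\<mu>\<close> under the shift.
\<close>
lemma nn_integral_skew:
  assumes g [measurable]: "g \<in> borel_measurable skew_space"
  shows "(\<integral>\<^sup>+z. g (skew k z) \<partial>skew_space) = (\<integral>\<^sup>+z. g z \<partial>skew_space)"
proof -
  define G where "G x = (\<integral>\<^sup>+y. \<integral>\<^sup>+s. g (x, y, s) \<partial>\<nu> \<partial>Y)" for x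
  have G [measurable]: "G \<in> borel_measurable \<mu>"
    unfolding G_def by measurable
  have "(\<integral>\<^sup>+z. g (skew k z) \<partial>skew_space)
      = (\<integral>\<^sup>+x. \<integral>\<^sup>+y. \<integral>\<^sup>+s. g (skew k (x, y, s)) \<partial>\<nu> \<partial>Y \<partial>\<mu>)"
    by (rule nn_integral_total) measurable
  also have "\<dots> = (\<integral>\<^sup>+x. ennreal (exp (log_cocycle k x)) * G (coord_shift k x) \<partial>\<mu>)"
  proof (rule nn_integral_cong)
    fix x :: "int \<Rightarrow> bool"
    have sx: "coord_shift k x \<in> space \<mu>" by simp
    have gx [measurable]: "(\<lambda>(y, s). g (coord_shift k x, y, s)) \<in> borel_measurable fibre"
      using measurable_compose[OF measurable_Pair1'[OF sx] g] by (simp add: case_prod_beta')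
    have "(\<integral>\<^sup>+y. \<integral>\<^sup>+s. g (skew k (x, y, s)) \<partial>\<nu> \<partial>Y)
        = (\<integral>\<^sup>+y. ennreal (exp (log_cocycle k x)) * (\<integral>\<^sup>+s. g (coord_shift k x, b k y, s) \<partial>\<nu>) \<partial>Y)"
    proof (rule nn_integral_cong)
      fix y assume y: "y \<in> space Y"
      then have "b k y \<in> space Y" by (rule measurable_space[OF b_measurable])
      then have "(\<lambda>s. g (coord_shift k x, b k y, s)) \<in> borel_measurable \<nu>"
        using measurable_compose[OF measurable_Pair1' gx] by simp
      then have "(\<lambda>s. g (coord_shift k x, b k y, s)) \<in> borel_measurable borel"
        unfolding measurable_cong_sets[OF sets_level_measure refl] .
      then show "(\<integral>\<^sup>+s. g (skew k (x, y, s)) \<partial>\<nu>) = ennreal (exp (log_cocycle k x)) * (\<integral>\<^sup>+s. g (coord_shift k x, b k y, s) \<partial>\<nu>)"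
        using nn_integral_level_translate[of "\<lambda>s. g (coord_shift k x, b k y, s)" "log_cocycle k x"] by (simp add: skew_def)
    qed
    also have "\<dots> = ennreal (exp (log_cocycle k x)) * (\<integral>\<^sup>+y. \<integral>\<^sup>+s. g (coord_shift k x, b k y, s) \<partial>\<nu> \<partial>Y)"
    proof (rule nn_integral_cmult)
      have "(\<lambda>y. \<integral>\<^sup>+s. g (coord_shift k x, y, s) \<partial>\<nu>) \<in> borel_measurable Y"
        using level.borel_measurable_nn_integral_fst[OF gx] by simp
      then show "(\<lambda>y. \<integral>\<^sup>+s. g (coord_shift k x, b k y, s) \<partial>\<nu>) \<in> borel_measurable Y"
        by (rule measurable_compose[OF b_measurable])
    qed
    also have "(\<integral>\<^sup>+y. \<integral>\<^sup>+s. g (coord_shift k x, b k y, s) \<partial>\<nu> \<partial>Y) = G (coord_shift k x)"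
      unfolding G_def
      by (rule nn_integral_b) (use level.borel_measurable_nn_integral_fst[OF gx] in simp)
    finally show "(\<integral>\<^sup>+y. \<integral>\<^sup>+s. g (skew k (x, y, s)) \<partial>\<nu> \<partial>Y) = ennreal (exp (log_cocycle k x)) * G (coord_shift k x)" .
  qed
  also have "\<dots> = (\<integral>\<^sup>+x. G x \<partial>\<mu>)"
    by (rule nn_integral_log_cocycle_shift[OF G])
  also have "\<dots> = (\<integral>\<^sup>+z. g z \<partial>skew_space)"
    unfolding G_def by (rule nn_integral_total[symmetric, OF g])
  finally show ?thesis .
qed

lemma AE_skew:
  assumes "AE z in skew_space. P z"
  shows "AE z in skew_space. P (skew k z)"
proof (rule AE_distrD[OF skew_measurable])
  have eq: "distr skew_space skew_space (skew k) = skew_space"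
  proof (rule measure_eqI)
    fix A assume "A \<in> sets (distr skew_space skew_space (skew k))"
    then have A [measurable]: "A \<in> sets skew_space" by simp
    have "emeasure (distr skew_space skew_space (skew k)) A = (\<integral>\<^sup>+z. indicator A z \<partial>distr skew_space skew_space (skew k))"
      by simp
    also have "\<dots> = (\<integral>\<^sup>+z. indicator A (skew k z) \<partial>skew_space)"
      by (rule nn_integral_distr) measurable
    also have "\<dots> = (\<integral>\<^sup>+z. indicator A z \<partial>skew_space)"
      by (rule nn_integral_skew) measurable
    finally show "emeasure (distr skew_space skew_space (skew k)) A = emeasure skew_space A" by simp
  qed simp
  show "AE z in distr skew_space skew_space (skew k). P z" unfolding eq by (rule assms)
qed

text \<open>
  At the coordinates $n \le -L$ the cocycle of a positive time $L$ compares fair coins.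
\<close>
lemma log_cocycle_mix:
  assumes "L \<le> M"
  shows "log_cocycle (int L) (mix {- int M<..} x x') = log_cocycle (int L) x"
  unfolding log_cocycle_def
proof (rule infsum_cong)
  fix n
  show "log_weight (n + int L) (mix {- int M<..} x x' n) - log_weight n (mix {- int M<..} x x' n)
      = log_weight (n + int L) (x n) - log_weight n (x n)"
    using assms by (cases "n > - int M") (simp_all add: mix_def)
qed

lemma skew_mix:
  "skew (int L) (mix {- int (L + j)<..} x x', y, s)
    = (mix {- int j<..} (coord_shift (int L) x) (coord_shift (int L) x'), b (int L) y, s + log_cocycle (int L) x)"
  by (simp add: skew_def log_cocycle_mix del: of_nat_add) (auto simp: mix_def coord_shift_def fun_eq_iff)

lemma nn_integral_fair_shift:
  assumes [measurable]: "g \<in> borel_measurable cantor_borel"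
  shows "(\<integral>\<^sup>+x. g (coord_shift k x) \<partial>fair_measure) = (\<integral>\<^sup>+x. g x \<partial>fair_measure)"
proof -
  have "(\<integral>\<^sup>+x. g x \<partial>fair_measure) = (\<integral>\<^sup>+x. g x \<partial>distr fair_measure cantor_borel (coord_shift k))"
    by (simp add: distr_shift)
  then show ?thesis by (simp add: nn_integral_distr)
qed

text \<open>
  The shift by $L$ maps the coordinates $n > -(L + j)$ to the coordinates $n > -j$, the cocycle does not
  see the resampled coordinates, and the shift preserves the law of their replacements.
\<close>
lemma past_average_skew:
  assumes f [measurable]: "f \<in> borel_measurable skew_space" and inv: "AE z in skew_space. f (skew (int L) z) = f z"
  shows "AE z in skew_space. past_average (L + j) f z = past_average j f (skew (int L) z)"
  using AE_mix[OF mix_law_past sets_coin_product fair.prob_space_axioms sigma_finite_fibre inv, of "L + j"] AE_space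
proof eventually_elim
  case (elim z)
  obtain x y s where z: "z = (x, y, s)" by (cases z)
  let ?v = "(b (int L) y, s + log_cocycle (int L) x)"
  have v: "?v \<in> space fibre"
    using elim(2) measurable_space[OF b_measurable] by (auto simp: z space_pair_measure)
  have "past_average (L + j) f z = (\<integral>\<^sup>+x'. f (mix {- int (L + j)<..} x x', y, s) \<partial>fair_measure)"
    by (simp add: past_average_def z)
  also have "\<dots> = (\<integral>\<^sup>+x'. f (skew (int L) (mix {- int (L + j)<..} x x', y, s)) \<partial>fair_measure)"
    using elim(1) by (intro nn_integral_cong_AE) (auto simp: z elim: eventually_mono)
  also have "\<dots> = (\<integral>\<^sup>+x'. f (mix {- int j<..} (coord_shift (int L) x) (coord_shift (int L) x'), ?v) \<partial>fair_measure)"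
    by (simp only: skew_mix)
  also have "\<dots> = (\<integral>\<^sup>+x'. f (mix {- int j<..} (coord_shift (int L) x) x', ?v) \<partial>fair_measure)"
    by (rule nn_integral_fair_shift) (rule mix_section_measurable[OF f v])
  also have "\<dots> = past_average j f (skew (int L) z)"
    by (simp add: past_average_def z skew_def)
  finally show ?case .
qed

end

section \<open>Invariant functions do not depend on the past\<close>

lemma AE_eqI_rectangles:
  fixes F G :: "'a \<times> 'b \<Rightarrow> ennreal"
  assumes A: "sigma_finite_measure A" and B: "sigma_finite_measure B"
    and [measurable]: "F \<in> borel_measurable (A \<Otimes>\<^sub>M B)" "G \<in> borel_measurable (A \<Otimes>\<^sub>M B)"
    and fin: "(\<integral>\<^sup>+z. F z \<partial>(A \<Otimes>\<^sub>M B)) \<noteq> \<infinity>"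
    and eq: "\<And>a b. a \<in> sets A \<Longrightarrow> b \<in> sets B \<Longrightarrow>
      (\<integral>\<^sup>+z. F z * indicator (a \<times> b) z \<partial>(A \<Otimes>\<^sub>M B)) = (\<integral>\<^sup>+z. G z * indicator (a \<times> b) z \<partial>(A \<Otimes>\<^sub>M B))"
  shows "AE z in A \<Otimes>\<^sub>M B. F z = G z"
proof -
  interpret A: sigma_finite_measure A by fact
  interpret B: sigma_finite_measure B by fact
  interpret AB: pair_sigma_finite A B ..
  have "density (A \<Otimes>\<^sub>M B) F = density (A \<Otimes>\<^sub>M B) G"
  proof (rule measure_eqI_generator_eq)
    let ?E = "{a \<times> b | a b. a \<in> sets A \<and> b \<in> sets B}"
    show "Int_stable ?E" by (rule Int_stable_pair_measure_generator)
    show "?E \<subseteq> Pow (space A \<times> space B)" by (rule pair_measure_closed)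
    show "sets (density (A \<Otimes>\<^sub>M B) F) = sigma_sets (space A \<times> space B) ?E"
      "sets (density (A \<Otimes>\<^sub>M B) G) = sigma_sets (space A \<times> space B) ?E"
      by (simp_all add: sets_pair_measure)
    show "emeasure (density (A \<Otimes>\<^sub>M B) F) X = emeasure (density (A \<Otimes>\<^sub>M B) G) X" if "X \<in> ?E" for X
    proof -
      from that obtain a c where X: "X = a \<times> c" "a \<in> sets A" "c \<in> sets B" by auto
      then have "X \<in> sets (A \<Otimes>\<^sub>M B)" by auto
      then show ?thesis using eq[OF X(2,3)] by (simp add: emeasure_density X(1))
    qed
    show "range (\<lambda>_::nat. space A \<times> space B) \<subseteq> ?E" by auto
    show "(\<Union>i::nat. space A \<times> space B) = space A \<times> space B" by auto
    have "emeasure (density (A \<Otimes>\<^sub>M B) F) (space A \<times> space B) = (\<integral>\<^sup>+z. F z \<partial>(A \<Otimes>\<^sub>M B))"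
      by (subst emeasure_density) (auto simp: space_pair_measure[symmetric] intro!: nn_integral_cong)
    then show "emeasure (density (A \<Otimes>\<^sub>M B) F) (space A \<times> space B) \<noteq> \<infinity>" for i :: nat
      using fin by simp
  qed
  then show ?thesis
    by (subst (asm) AB.density_unique_iff) auto
qed

lemma AE_eqI_cylinder_pair:
  fixes f g :: "(int \<Rightarrow> bool) \<times> 'v \<Rightarrow> ennreal"
  assumes V: "sigma_finite_measure V"
    and [measurable]: "f \<in> borel_measurable (\<mu> \<Otimes>\<^sub>M V)" "g \<in> borel_measurable (\<mu> \<Otimes>\<^sub>M V)"
    and f1: "\<And>z. f z \<le> 1"
    and eq: "\<And>J F h. finite J \<Longrightarrow> h \<in> borel_measurable V \<Longrightarrow>
      (\<integral>\<^sup>+z. (h (snd z) * indicator {x. \<forall>j\<in>J. x j \<in> F j} (fst z)) * f z \<partial>(\<mu> \<Otimes>\<^sub>M V))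
      = (\<integral>\<^sup>+z. (h (snd z) * indicator {x. \<forall>j\<in>J. x j \<in> F j} (fst z)) * g z \<partial>(\<mu> \<Otimes>\<^sub>M V))"
  shows "AE z in \<mu> \<Otimes>\<^sub>M V. f z = g z"
proof -
  interpret V: sigma_finite_measure V by fact
  let ?Z = "\<mu> \<Otimes>\<^sub>M V"
  \<comment> \<open>A positive integrable weight makes the second factor finite.\<close>
  obtain w where w [measurable]: "w \<in> borel_measurable V" and wfin: "(\<integral>\<^sup>+v. w v \<partial>V) \<noteq> \<infinity>"
    and wpos: "\<And>v. v \<in> space V \<Longrightarrow> 0 < w v \<and> w v < \<infinity>"
    using V.Ex_finite_integrable_function by auto
  have fubini: "(\<integral>\<^sup>+z. (w (snd z) * u z) * indicator (a \<times> d) z \<partial>?Z)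
      = (\<integral>\<^sup>+x. (\<integral>\<^sup>+v. w v * indicator d v * u (x, v) \<partial>V) * indicator a x \<partial>\<mu>)"
    if [measurable]: "u \<in> borel_measurable ?Z" "a \<in> sets \<mu>" "d \<in> sets V" for u a d
  proof -
    have "(\<integral>\<^sup>+z. (w (snd z) * u z) * indicator (a \<times> d) z \<partial>?Z)
        = (\<integral>\<^sup>+x. \<integral>\<^sup>+v. w v * u (x, v) * indicator (a \<times> d) (x, v) \<partial>V \<partial>\<mu>)"
      by (subst V.nn_integral_fst[symmetric]) auto
    also have "\<dots> = (\<integral>\<^sup>+x. (\<integral>\<^sup>+v. w v * indicator d v * u (x, v) \<partial>V) * indicator a x \<partial>\<mu>)"
      by (intro nn_integral_cong) (auto simp: indicator_def intro!: nn_integral_cong)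
    finally show ?thesis .
  qed
  have "AE z in ?Z. w (snd z) * f z = w (snd z) * g z"
  proof (rule AE_eqI_rectangles[OF bernoulli.sigma_finite_measure_axioms V])
    have "(\<integral>\<^sup>+z. w (snd z) * f z \<partial>?Z) \<le> (\<integral>\<^sup>+z. w (snd z) \<partial>?Z)"
      using mult_left_mono[OF f1] by (intro nn_integral_mono) fastforce
    also have "\<dots> = (\<integral>\<^sup>+v. w v \<partial>V)"
      by (subst V.nn_integral_fst[symmetric]) (auto simp: bernoulli.emeasure_space_1[simplified])
    finally show "(\<integral>\<^sup>+z. w (snd z) * f z \<partial>?Z) \<noteq> \<infinity>"
      using wfin by (auto simp: top_unique)
  next
    fix a d assume a [measurable]: "a \<in> sets \<mu>" and d [measurable]: "d \<in> sets V"
    let ?\<phi> = "\<lambda>u x. \<integral>\<^sup>+v. w v * indicator d v * u (x, v) \<partial>V"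
    have meas: "?\<phi> u \<in> borel_measurable cantor_borel" if [measurable]: "u \<in> borel_measurable ?Z" for u
      unfolding measurable_cong_sets[OF sets_bernoulli_measure[symmetric] refl] by measurable
    have "AE x in coin_product coin. ?\<phi> f x = ?\<phi> g x"
    proof (rule AE_eqI_cylinder)
      have "(\<integral>\<^sup>+x. ?\<phi> f x \<partial>coin_product coin) \<le> (\<integral>\<^sup>+x. \<integral>\<^sup>+v. w v \<partial>V \<partial>coin_product coin)"
      proof (intro nn_integral_mono)
        fix x v
        have "w v * indicator d v * f (x, v) \<le> w v * 1 * 1"
          using f1 by (intro mult_mono) (auto simp: indicator_def)
        then show "w v * indicator d v * f (x, v) \<le> w v" by simp
      qed
      also have "\<dots> = (\<integral>\<^sup>+v. w v \<partial>V)" by simp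
      finally show "(\<integral>\<^sup>+x. ?\<phi> f x \<partial>coin_product coin) \<noteq> \<infinity>"
        using wfin by (auto simp: top_unique)
      fix J :: "int set" and F :: "int \<Rightarrow> bool set" assume J: "finite J"
      let ?E = "{x. \<forall>j\<in>J. x j \<in> F j}"
      have [measurable]: "?E \<in> sets \<mu>"
        using J by (simp add: sets_bernoulli_measure cylinder_measurable countable_finite)
      have *: "(\<integral>\<^sup>+x. ?\<phi> u x * indicator ?E x \<partial>coin_product coin)
          = (\<integral>\<^sup>+z. ((w (snd z) * indicator d (snd z)) * indicator ?E (fst z)) * u z \<partial>?Z)"
        if [measurable]: "u \<in> borel_measurable ?Z" for u
      proof -
        have "(\<integral>\<^sup>+x. ?\<phi> u x * indicator ?E x \<partial>coin_product coin) = (\<integral>\<^sup>+z. (w (snd z) * u z) * indicator (?E \<times> d) z \<partial>?Z)"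
          unfolding bernoulli_measure_eq[symmetric] by (rule fubini[symmetric]) measurable
        also have "\<dots> = (\<integral>\<^sup>+z. ((w (snd z) * indicator d (snd z)) * indicator ?E (fst z)) * u z \<partial>?Z)"
          by (intro nn_integral_cong) (auto simp: indicator_def)
        finally show ?thesis .
      qed
      show "(\<integral>\<^sup>+x. ?\<phi> f x * indicator ?E x \<partial>coin_product coin) = (\<integral>\<^sup>+x. ?\<phi> g x * indicator ?E x \<partial>coin_product coin)"
        using eq[OF J, of "\<lambda>v. w v * indicator d v" F] by (simp add: *)
    qed (auto intro: meas)
    then have "AE x in \<mu>. ?\<phi> f x = ?\<phi> g x"
      unfolding bernoulli_measure_eq .
    then have "(\<integral>\<^sup>+x. ?\<phi> f x * indicator a x \<partial>\<mu>) = (\<integral>\<^sup>+x. ?\<phi> g x * indicator a x \<partial>\<mu>)"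
      by (intro nn_integral_cong_AE) auto
    then show "(\<integral>\<^sup>+z. w (snd z) * f z * indicator (a \<times> d) z \<partial>?Z) = (\<integral>\<^sup>+z. w (snd z) * g z * indicator (a \<times> d) z \<partial>?Z)"
      by (simp add: fubini)
  qed measurable
  then show ?thesis
    using AE_space
  proof eventually_elim
    case (elim z)
    then have "0 < w (snd z)" "w (snd z) < \<infinity>" using wpos by (auto simp: space_pair_measure)
    then show ?case using elim(1) by (auto simp: ennreal_mult_cancel_left)
  qed
qed

lemma harm_le_1_plus_ln: "n \<ge> 1 \<Longrightarrow> harm n \<le> 1 + ln (real n)"
proof (cases n)
  case (Suc m)
  have "harm (Suc m) - ln (real (Suc m)) \<le> harm (Suc 0) - ln (real (Suc 0))"
    by (rule decseqD[OF decseq_harm_diff_ln]) simp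
  then show ?thesis using Suc by (simp add: harm_Suc harm_def)
qed simp

lemma sq_diff_eq_0:
  assumes "sq_diff a b = 0" "a \<le> 1" "b \<le> 1"
  shows "a = b"
proof -
  have "enn2real a = enn2real b" using assms(1) by (simp add: sq_diff_def ennreal_eq_0_iff)
  moreover have "a < top" "b < top"
    using assms(2,3) by (auto intro: order.strict_trans1 simp: ennreal_one_less_top)
  ultimately show ?thesis by (metis ennreal_enn2real)
qed

lemma sq_diff_le_1:
  assumes "a \<le> 1" "b \<le> 1"
  shows "sq_diff a b \<le> 1"
proof -
  have "enn2real a \<le> 1" "enn2real b \<le> 1"
    using enn2real_mono[OF assms(1)] enn2real_mono[OF assms(2)] by auto
  then have "\<bar>enn2real a - enn2real b\<bar> \<le> 1"
    using enn2real_nonneg[of a] enn2real_nonneg[of b] by linarith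
  then have "(enn2real a - enn2real b)\<^sup>2 \<le> 1"
    by (simp add: abs_square_le_1)
  then show ?thesis by (simp add: sq_diff_def)
qed

context skew_product
begin

lemma emeasure_fibre_ge: "emeasure fibre (space Y \<times> {- a..}) = ennreal (exp a)"
  by (subst level.emeasure_pair_measure_Times) (auto simp: Y.emeasure_space_1 emeasure_level_measure_ge)

text \<open>
  For an invariant function every increment of the martingale is the first increment composed with the
  dynamics. Moving the dynamics to the set, the orthogonality bound becomes a bound for the visits
  to the levels above $-a$, weighted with the first increment.
\<close>
lemma sum_return_integral_le:
  assumes f [measurable]: "f \<in> borel_measurable skew_space" and f1: "\<And>z. f z \<le> 1"
    and inv: "\<And>k. AE z in skew_space. f (skew k z) = f z"
  shows "(\<Sum>L<n. \<integral>\<^sup>+z. indicator {- a..} (snd (snd (skew (- int L) z))) * sq_diff (past_average 1 f z) (past_average 0 f z) \<partial>skew_space) \<le> ennreal (exp a)"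
proof -
  let ?v = "\<lambda>z. sq_diff (past_average 1 f z) (past_average 0 f z)"
  let ?B = "space Y \<times> {- a..}"
  have term_eq: "(\<integral>\<^sup>+z. indicator {- a..} (snd (snd (skew (- int L) z))) * ?v z \<partial>skew_space)
    = (\<integral>\<^sup>+z. indicator ?B (snd z) * sq_diff (past_average (Suc L) f z) (past_average L f z) \<partial>skew_space)" for L
  proof -
    have [measurable]: "(\<lambda>z. indicator {- a..} (snd (snd z)) * ?v (skew (int L) z)) \<in> borel_measurable skew_space"
      by measurable
    have "(\<integral>\<^sup>+z. indicator ?B (snd z) * sq_diff (past_average (Suc L) f z) (past_average L f z) \<partial>skew_space)
        = (\<integral>\<^sup>+z. indicator {- a..} (snd (snd z)) * ?v (skew (int L) z) \<partial>skew_space)"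
    proof (rule nn_integral_cong_AE)
      show "AE z in skew_space. indicator ?B (snd z) * sq_diff (past_average (Suc L) f z) (past_average L f z)
          = indicator {- a..} (snd (snd z)) * ?v (skew (int L) z)"
        using past_average_skew[OF f inv, of L 1] past_average_skew[OF f inv, of L 0] AE_space
        by eventually_elim (auto simp: indicator_def space_pair_measure)
    qed
    also have "\<dots> = (\<integral>\<^sup>+z. indicator {- a..} (snd (snd (skew (- int L) z))) * ?v (skew (int L) (skew (- int L) z)) \<partial>skew_space)"
      by (rule nn_integral_skew[symmetric]) measurable
    also have "\<dots> = (\<integral>\<^sup>+z. indicator {- a..} (snd (snd (skew (- int L) z))) * ?v z \<partial>skew_space)"
      by (intro nn_integral_cong) (simp add: skew_add[symmetric] skew_0)
    finally show ?thesis ..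
  qed
  have "(\<Sum>L<n. \<integral>\<^sup>+z. indicator ?B (snd z) * sq_diff (past_average (Suc L) f z) (past_average L f z) \<partial>skew_space) \<le> emeasure fibre ?B"
    by (rule past_average_orthogonal[OF f f1 sigma_finite_fibre]) (auto simp: emeasure_fibre_ge)
  then show ?thesis by (simp only: term_eq emeasure_fibre_ge)
qed

lemma nn_integral_slow_return_le:
  assumes "L < n"
  shows "(\<integral>\<^sup>+z. indicator {- c..} (snd (snd z)) * ennreal (exp (- log_cocycle (- int L) (fst z)) / sqrt (real n)) \<partial>skew_space)
    \<le> ennreal (exp c * (exp (harm n / 4 + 1 / 8) / sqrt (real n)))"
proof -
  let ?g = "\<lambda>x. ennreal (exp (- log_cocycle (- int L) x) / sqrt (real n))"
  have "(\<integral>\<^sup>+z. indicator {- c..} (snd (snd z)) * ?g (fst z) \<partial>skew_space)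
      = (\<integral>\<^sup>+x. \<integral>\<^sup>+y. \<integral>\<^sup>+s. indicator {- c..} s * ?g x \<partial>\<nu> \<partial>Y \<partial>\<mu>)"
    by (subst nn_integral_total) auto
  also have "\<dots> = (\<integral>\<^sup>+x. ennreal (exp c / sqrt (real n)) * ennreal (exp (- log_cocycle (- int L) x)) \<partial>\<mu>)"
    by (intro nn_integral_cong)
      (simp add: nn_integral_multc emeasure_level_measure_ge Y.emeasure_space_1 ennreal_mult[symmetric])
  also have "\<dots> = ennreal (exp c / sqrt (real n)) * (\<integral>\<^sup>+x. ennreal (exp (- log_cocycle (- int L) x)) \<partial>\<mu>)"
    by (rule nn_integral_cmult) measurable
  also have "\<dots> \<le> ennreal (exp c / sqrt (real n)) * ennreal (exp (harm n / 4 + 1 / 8))"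
  proof (rule mult_left_mono)
    have "harm (nat \<bar>- int L\<bar>) \<le> (harm n :: real)" using assms by (intro harm_mono) auto
    then have "ennreal (exp (harm (nat \<bar>- int L\<bar>) / 4 + 1 / 8)) \<le> ennreal (exp (harm n / 4 + 1 / 8))"
      by (intro ennreal_leI) simp
    then show "(\<integral>\<^sup>+x. ennreal (exp (- log_cocycle (- int L) x)) \<partial>\<mu>) \<le> ennreal (exp (harm n / 4 + 1 / 8))"
      using nn_integral_inverse_cocycle_le[of "- int L"] unfolding bernoulli_measure_eq by (rule order_trans[rotated])
  qed simp
  also have "\<dots> = ennreal (exp c * (exp (harm n / 4 + 1 / 8) / sqrt (real n)))"
    by (simp add: ennreal_mult[symmetric])
  finally show ?thesis .
qed

text \<open>
  This is where recurrence enters. Let $v$ be the squared increment and start from a level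
  $s \ge -c$. At a time $L < n$ the backward orbit can be below $-a = -c - \ln(n) / 2$ only if the
  cocycle is below $n^{-1/2}$, and the starting points for which this happens have measure at most
  of order $n^{-1/2} n^{1/4}$. At all other times the mass of $v$ is above $-a$, and by
  \<open>sum_return_integral_le\<close> its total over the $n$ times is at most $e^a = e^c n^{1/2}$. Division by
  $n$ leaves $n^{-1/2} + n^{-1/4}$, up to constants, as a bound for the integral of $v$.
\<close>
lemma past_average_increment_null:
  assumes f [measurable]: "f \<in> borel_measurable skew_space" and f1: "\<And>z. f z \<le> 1"
    and inv: "\<And>k. AE z in skew_space. f (skew k z) = f z"
  shows "AE z in skew_space. past_average 1 f z = past_average 0 f z"
proof -
  let ?v = "\<lambda>z. sq_diff (past_average 1 f z) (past_average 0 f z)"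
  have v1: "?v z \<le> 1" for z
    by (intro sq_diff_le_1 past_average_le_1 f1)
  have "(\<integral>\<^sup>+z. indicator {- c..} (snd (snd z)) * ?v z \<partial>skew_space) = 0" (is "?I = 0") for c
  proof -
    define r where "r n = exp c * (real n powr (- 1 / 2) + exp (3 / 8) * real n powr (- 1 / 4))" for n :: nat
    have bound: "?I \<le> ennreal (r n)" if n: "n \<ge> 1" for n
    proof -
      \<comment> \<open>With this choice $e^a = e^c \sqrt n$, and falling from above $-c$ to below $-a$ needs a cocycle below $n^{-1/2}$.\<close>
      define a where "a = c + ln (real n) / 2"
      let ?e = "exp c * (exp (harm n / 4 + 1 / 8) / sqrt (real n))"
      have sqrt_n: "exp (ln (real n) / 2) = sqrt (real n)"
        using n by (simp add: powr_half_sqrt[symmetric] powr_def)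
      have le: "?I \<le> (\<integral>\<^sup>+z. indicator {- a..} (snd (snd (skew (- int L) z))) * ?v z \<partial>skew_space) + ennreal ?e" if L: "L < n" for L
      proof -
        let ?s = "\<lambda>z. ennreal (exp (- log_cocycle (- int L) (fst z)) / sqrt (real n))"
        have "?I \<le> (\<integral>\<^sup>+z. indicator {- a..} (snd (snd (skew (- int L) z))) * ?v z + indicator {- c..} (snd (snd z)) * ?s z \<partial>skew_space)"
        proof (rule nn_integral_mono)
          fix z :: "(int \<Rightarrow> bool) \<times> 'y \<times> real"
          obtain x y s where z: "z = (x, y, s)" by (cases z)
          show "indicator {- c..} (snd (snd z)) * ?v z
            \<le> indicator {- a..} (snd (snd (skew (- int L) z))) * ?v z + indicator {- c..} (snd (snd z)) * ?s z"
          proof (cases "s \<ge> - c")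
            case s: True
            show ?thesis
            proof (cases "- (ln (real n) / 2) \<le> log_cocycle (- int L) x")
              case True
              then have "- a \<le> s + log_cocycle (- int L) x" using s by (simp add: a_def)
              then show ?thesis using s by (simp add: z skew_def)
            next
              case False
              then have "exp (ln (real n) / 2) \<le> exp (- log_cocycle (- int L) x)" by simp
              then have "1 \<le> exp (- log_cocycle (- int L) x) / sqrt (real n)"
                using n by (simp add: sqrt_n)
              then have "1 \<le> ?s z" by (simp add: z)
              then have "?v z \<le> ?s z" using v1 order_trans by blast
              then show ?thesis using s by (simp add: z add_increasing)
            qed
          qed (simp add: z)
        qed
        also have "\<dots> = (\<integral>\<^sup>+z. indicator {- a..} (snd (snd (skew (- int L) z))) * ?v z \<partial>skew_space)
            + (\<integral>\<^sup>+z. indicator {- c..} (snd (snd z)) * ?s z \<partial>skew_space)"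
        proof (rule nn_integral_add)
          have "(\<lambda>z. indicator {- a..} (snd (snd z)) :: ennreal) \<in> borel_measurable skew_space"
            by measurable
          then have "(\<lambda>z. indicator {- a..} (snd (snd (skew (- int L) z))) :: ennreal) \<in> borel_measurable skew_space"
            by (rule measurable_compose[OF skew_measurable])
          moreover have "?v \<in> borel_measurable skew_space"
            by (intro sq_diff_measurable past_average_measurable f)
          ultimately show "(\<lambda>z. indicator {- a..} (snd (snd (skew (- int L) z))) * ?v z) \<in> borel_measurable skew_space"
            by (rule borel_measurable_times_ennreal)
          show "(\<lambda>z. indicator {- c..} (snd (snd z)) * ?s z) \<in> borel_measurable skew_space"
            by measurable
        qed
        also have "\<dots> \<le> (\<integral>\<^sup>+z. indicator {- a..} (snd (snd (skew (- int L) z))) * ?v z \<partial>skew_space) + ennreal ?e"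
          by (intro add_left_mono nn_integral_slow_return_le L)
        finally show ?thesis .
      qed
      have "of_nat n * ?I = (\<Sum>L<n. ?I)" by simp
      also have "\<dots> \<le> (\<Sum>L<n. (\<integral>\<^sup>+z. indicator {- a..} (snd (snd (skew (- int L) z))) * ?v z \<partial>skew_space) + ennreal ?e)"
        by (intro sum_mono le) auto
      also have "\<dots> \<le> ennreal (exp a) + of_nat n * ennreal ?e"
        using sum_return_integral_le[OF f f1 inv, where n = n and a = a] by (simp add: sum.distrib)
      also have "\<dots> = ennreal (exp c * sqrt (real n) + real n * ?e)"
        by (simp add: a_def exp_add sqrt_n ennreal_of_nat_eq_real_of_nat ennreal_mult[symmetric] ennreal_plus[symmetric] del: ennreal_plus)
      finally have total_le: "of_nat n * ?I \<le> ennreal (exp c * sqrt (real n) + real n * ?e)" .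
      have "?I = ennreal (1 / real n) * (of_nat n * ?I)"
        using n by (simp add: mult.assoc[symmetric] ennreal_mult[symmetric] ennreal_of_nat_eq_real_of_nat)
      also have "\<dots> \<le> ennreal (1 / real n) * ennreal (exp c * sqrt (real n) + real n * ?e)"
        by (intro mult_left_mono total_le) simp
      also have "\<dots> = ennreal ((exp c * sqrt (real n) + real n * ?e) / real n)"
        by (subst ennreal_mult[symmetric]) auto
      also have "\<dots> \<le> ennreal (r n)"
      proof (rule ennreal_leI)
        have inv_sqrt: "1 / sqrt (real n) = real n powr (- 1 / 2)"
          using n by (simp add: powr_half_sqrt[symmetric] powr_minus_divide)
        have sqrt_div: "sqrt (real n) / real n = 1 / sqrt (real n)"
          using n real_sqrt_mult_self[of "real n"] by (simp add: field_simps)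
        have "(exp c * sqrt (real n) + real n * ?e) / real n = exp c * (sqrt (real n) / real n) + ?e"
          using n by (simp add: add_divide_distrib)
        also have "\<dots> = exp c * (1 / sqrt (real n) + exp (harm n / 4 + 1 / 8) * (1 / sqrt (real n)))"
          unfolding sqrt_div by (simp add: distrib_left)
        also have "\<dots> \<le> exp c * (1 / sqrt (real n) + exp (3 / 8) * real n powr (1 / 4) * (1 / sqrt (real n)))"
        proof -
          have "exp (harm n / 4 + 1 / 8) \<le> exp (3 / 8 + 1 / 4 * ln (real n))"
            using harm_le_1_plus_ln[OF n] by simp
          also have "\<dots> = exp (3 / 8) * real n powr (1 / 4)"
            using n by (simp add: exp_add powr_def)
          finally show ?thesis by (intro mult_left_mono add_left_mono mult_right_mono) auto
        qed
        also have "\<dots> = r n"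
          unfolding r_def inv_sqrt mult.assoc powr_add[symmetric] by simp
        finally show "(exp c * sqrt (real n) + real n * ?e) / real n \<le> r n" .
      qed
      finally show ?thesis .
    qed
    have "(\<lambda>n. ennreal (r n)) \<longlonglongrightarrow> ennreal 0"
    proof (rule tendsto_ennrealI)
      have "(\<lambda>n. real n powr (- p)) \<longlonglongrightarrow> 0" if "p > 0" for p :: real
        using that by (intro tendsto_neg_powr filterlim_real_sequentially) auto
      from this[of "1/2"] this[of "1/4"] have "(\<lambda>n. r n) \<longlonglongrightarrow> exp c * (0 + exp (3 / 8) * 0)"
        unfolding r_def by (intro tendsto_intros) auto
      then show "r \<longlonglongrightarrow> 0" by simp
    qed
    then have "?I \<le> ennreal 0"
      using bound by (intro LIMSEQ_le_const) auto
    then show ?thesis by simp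
  qed
  then have "AE z in skew_space. indicator {- real m..} (snd (snd z)) * ?v z = 0" for m :: nat
    by (subst nn_integral_0_iff_AE[symmetric]) auto
  then have "AE z in skew_space. \<forall>m::nat. indicator {- real m..} (snd (snd z)) * ?v z = 0"
    by (subst AE_all_countable) auto
  then show ?thesis
  proof eventually_elim
    case (elim z)
    obtain m :: nat where "- snd (snd z) \<le> real m" using real_arch_simple by blast
    then have "snd (snd z) \<in> {- real m..}" by simp
    then have "?v z = 0" using elim[rule_format, of m] by simp
    then show ?case by (rule sq_diff_eq_0) (intro past_average_le_1 f1)+
  qed
qed

lemma past_average_constant:
  assumes f [measurable]: "f \<in> borel_measurable skew_space" and f1: "\<And>z. f z \<le> 1"
    and inv: "\<And>k. AE z in skew_space. f (skew k z) = f z"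
  shows "AE z in skew_space. past_average L f z = past_average 0 f z"
proof (induction L)
  case (Suc L)
  have "AE z in skew_space. past_average 1 f (skew (int L) z) = past_average 0 f (skew (int L) z)"
    by (rule AE_skew) (rule past_average_increment_null[OF f f1 inv])
  then show ?case
    using Suc past_average_skew[OF f inv, of L 1] past_average_skew[OF f inv, of L 0]
    by eventually_elim simp
qed simp

text \<open>
  Over a cylinder given by coordinates $n > -L$ the function has the same integrals as its average
  \<open>past_average L\<close>, and all these averages coincide with \<open>past_average 0\<close>.
\<close>
lemma invariant_eq_past_average:
  assumes f [measurable]: "f \<in> borel_measurable skew_space" and f1: "\<And>z. f z \<le> 1"
    and inv: "\<And>k. AE z in skew_space. f (skew k z) = f z"
  shows "AE z in skew_space. f z = past_average 0 f z"
proof (rule AE_eqI_cylinder_pair[OF sigma_finite_fibre f _ f1])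
  fix J :: "int set" and F :: "int \<Rightarrow> bool set" and h :: "'y \<times> real \<Rightarrow> ennreal"
  assume J: "finite J" and [measurable]: "h \<in> borel_measurable fibre"
  let ?E = "{x. \<forall>j\<in>J. x j \<in> F j}"
  have [measurable]: "?E \<in> sets \<mu>"
    using J by (simp add: sets_bernoulli_measure cylinder_measurable countable_finite)
  obtain L :: nat where L: "J \<subseteq> {- int L<..}"
  proof -
    obtain N where "\<forall>i\<in>J. nat \<bar>i\<bar> \<le> N"
      using J finite_nat_set_iff_bounded_le[of "(\<lambda>i. nat \<bar>i\<bar>) ` J"] by auto
    then have "J \<subseteq> {- int (Suc N)<..}" by fastforce
    then show ?thesis by (rule that)
  qed
  have "(\<integral>\<^sup>+z. (h (snd z) * indicator ?E (fst z)) * f z \<partial>skew_space)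
      = (\<integral>\<^sup>+z. (h (snd z) * indicator ?E (fst z)) * past_average L f z \<partial>skew_space)"
  proof (rule nn_integral_past_average[OF f _ sigma_finite_fibre])
    show "h (snd (mix {- int L<..} x x', v)) * indicator ?E (fst (mix {- int L<..} x x', v))
        = h (snd (x, v)) * indicator ?E (fst (x, v))" for x x' v
    proof -
      have "mix {- int L<..} x x' \<in> ?E \<longleftrightarrow> x \<in> ?E" using L by (auto simp: mix_def)
      then show ?thesis by (simp add: indicator_def)
    qed
  qed measurable
  also have "\<dots> = (\<integral>\<^sup>+z. (h (snd z) * indicator ?E (fst z)) * past_average 0 f z \<partial>skew_space)"
    using past_average_constant[OF f f1 inv, of L] by (intro nn_integral_cong_AE) auto
  finally show "(\<integral>\<^sup>+z. (h (snd z) * indicator ?E (fst z)) * f z \<partial>skew_space)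
      = (\<integral>\<^sup>+z. (h (snd z) * indicator ?E (fst z)) * past_average 0 f z \<partial>skew_space)" .
qed measurable

lemma invariant_eq_past_average_skew:
  assumes f [measurable]: "f \<in> borel_measurable skew_space" and f1: "\<And>z. f z \<le> 1"
    and inv: "\<And>k. AE z in skew_space. f (skew k z) = f z"
  shows "AE z in skew_space. f z = past_average 0 f (skew k z)"
  using AE_skew[OF invariant_eq_past_average[OF f f1 inv], of k] inv[of k]
  by eventually_elim simp

end

section \<open>Functions whose level is moved by every coordinate\<close>

lemma coin_prob_nonzero [simp]: "coin_prob n b \<noteq> 0"
  using coin_prob_pos(1)[of n b] by (rule less_imp_neq[symmetric])

definition log_ratio :: "int \<Rightarrow> real" where
  "log_ratio n = log_weight n False - log_weight n True"

lemma log_ratio_bounds: "2 * bias n \<le> log_ratio n" "log_ratio n \<le> 6 * bias n"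
proof -
  let ?p = "coin_prob n False" and ?q = "coin_prob n True"
  have pq: "?p - ?q = 2 * bias n" by (simp add: coin_prob_def)
  have eq: "log_ratio n = ln ?p - ln ?q"
    unfolding log_ratio_def log_weight_def
    by (simp add: ln_mult)
  have "ln (?q / ?p) \<le> ?q / ?p - 1" by (rule ln_le_minus_one) simp
  then have "(?p - ?q) / ?p \<le> log_ratio n"
    unfolding eq using coin_prob_pos(1)[of n False] by (simp add: ln_div diff_divide_distrib)
  moreover have "(?p - ?q) / 1 \<le> (?p - ?q) / ?p"
    using coin_prob_pos(1)[of n False] coin_prob_le[of n False] bias_nonneg[of n] unfolding pq
    by (intro divide_left_mono) auto
  ultimately show "2 * bias n \<le> log_ratio n" unfolding pq by simp
  have "log_ratio n \<le> \<bar>ln ?p - ln ?q\<bar>" unfolding eq by simp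
  also have "\<dots> \<le> \<bar>?p - ?q\<bar> / (1 / 3)"
    by (intro abs_ln_diff_le coin_prob_ge) auto
  also have "\<dots> = 6 * bias n" unfolding pq using bias_nonneg[of n] by simp
  finally show "log_ratio n \<le> 6 * bias n" .
qed

text \<open>
  The variance of the difference of two independent steps \<open>log_weight n\<close>.
\<close>
definition ratio_variance :: "int \<Rightarrow> real" where
  "ratio_variance n = 2 * coin_prob n False * coin_prob n True * (log_ratio n)\<^sup>2"

text \<open>
  The divergence of $\sum_n n^{-1}$ makes the walk oscillate; this is the source of type III$_1$.
\<close>
lemma ratio_variance_ge:
  assumes "n \<ge> 1"
  shows "4 / (81 * real_of_int n) \<le> ratio_variance n"
proof -
  have e: "0 \<le> bias n" "bias n \<le> 1 / 6" by (rule bias_nonneg bias_le)+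
  have "coin_prob n False * coin_prob n True = 1 / 4 - (bias n)\<^sup>2"
    by (simp add: coin_prob_def algebra_simps power2_eq_square)
  moreover have "(bias n)\<^sup>2 \<le> (1 / 6)\<^sup>2" using e by (intro power_mono) auto
  ultimately have pq: "2 / 9 \<le> coin_prob n False * coin_prob n True"
    by (simp add: power2_eq_square)
  have r: "(2 * bias n)\<^sup>2 \<le> (log_ratio n)\<^sup>2"
    using e by (intro power_mono log_ratio_bounds) auto
  have "4 / (81 * real_of_int n) = 2 * (2 / 9) * (2 * bias n)\<^sup>2"
    using bias_squared[OF assms] assms by (simp add: power_mult_distrib field_simps)
  also have "\<dots> \<le> 2 * (coin_prob n False * coin_prob n True) * (log_ratio n)\<^sup>2"
    using pq r by (intro mult_mono) auto
  finally show ?thesis by (simp add: ratio_variance_def mult.assoc)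
qed

text \<open>
  Both arguments take a step with independent coins of index $n + 1$. Their difference stays the
  same unless the two coins differ, and then it changes by \<open>log_ratio\<close> in either direction with equal
  probability.
\<close>
lemma harmonic_difference:
  fixes g :: "nat \<Rightarrow> real \<Rightarrow> real"
  assumes harmonic: "\<And>n u. g n u = coin_prob (int (Suc n)) False * g (Suc n) (u - log_weight (int (Suc n)) False)
      + coin_prob (int (Suc n)) True * g (Suc n) (u - log_weight (int (Suc n)) True)"
    and V: "\<And>w w'. w - w' \<in> {u - u', u - u' - log_ratio (int (Suc n)), u - u' + log_ratio (int (Suc n))} \<Longrightarrow>
      \<bar>g (Suc n) w - g (Suc n) w'\<bar> \<le> V (w - w')"
  shows "\<bar>g n u - g n u'\<bar> \<le> (1 - 2 * coin_prob (int (Suc n)) False * coin_prob (int (Suc n)) True) * V (u - u')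
    + coin_prob (int (Suc n)) False * coin_prob (int (Suc n)) True
      * (V (u - u' - log_ratio (int (Suc n))) + V (u - u' + log_ratio (int (Suc n))))"
proof -
  define p where "p = coin_prob (int (Suc n)) False"
  define q where "q = coin_prob (int (Suc n)) True"
  define r where "r = log_ratio (int (Suc n))"
  define G where "G b w = g (Suc n) (w - log_weight (int (Suc n)) b)" for b w
  have pq: "p + q = 1" "0 \<le> p" "0 \<le> q" by (simp_all add: p_def q_def coin_prob_def[of _ False] coin_prob_def[of _ True])
    (use coin_prob_pos(2)[of "int (Suc n)" False] coin_prob_pos(2)[of "int (Suc n)" True] in \<open>simp_all add: coin_prob_def\<close>)
  have q: "q = 1 - p" using pq by simp
  have "g n u - g n u' = p * p * (G False u - G False u') + p * q * (G False u - G True u')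
      + q * p * (G True u - G False u') + q * q * (G True u - G True u')"
    unfolding harmonic[of n u] harmonic[of n u'] G_def[symmetric] p_def[symmetric] q_def[symmetric] q
    by (simp add: algebra_simps)
  also have "\<bar>\<dots>\<bar> \<le> p * p * \<bar>G False u - G False u'\<bar> + p * q * \<bar>G False u - G True u'\<bar>
      + q * p * \<bar>G True u - G False u'\<bar> + q * q * \<bar>G True u - G True u'\<bar>"
    using pq by (intro order_trans[OF abs_triangle_ineq] add_mono) (simp_all add: abs_mult)
  also have "\<dots> \<le> p * p * V (u - u') + p * q * V (u - u' - r) + q * p * V (u - u' + r) + q * q * V (u - u')"
  proof -
    have "\<bar>G False u - G False u'\<bar> \<le> V (u - u')" "\<bar>G True u - G True u'\<bar> \<le> V (u - u')"
      unfolding G_def using V[of "u - log_weight (int (Suc n)) False" "u' - log_weight (int (Suc n)) False"]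
        V[of "u - log_weight (int (Suc n)) True" "u' - log_weight (int (Suc n)) True"] by simp_all
    moreover have "\<bar>G False u - G True u'\<bar> \<le> V (u - u' - r)"
    proof -
      have eq: "u - log_weight (int (Suc n)) False - (u' - log_weight (int (Suc n)) True) = u - u' - r"
        by (simp add: r_def log_ratio_def)
      show ?thesis
        using V[of "u - log_weight (int (Suc n)) False" "u' - log_weight (int (Suc n)) True"]
        unfolding G_def eq by (simp add: r_def)
    qed
    moreover have "\<bar>G True u - G False u'\<bar> \<le> V (u - u' + r)"
    proof -
      have eq: "u - log_weight (int (Suc n)) True - (u' - log_weight (int (Suc n)) False) = u - u' + r"
        by (simp add: r_def log_ratio_def)
      show ?thesis
        using V[of "u - log_weight (int (Suc n)) True" "u' - log_weight (int (Suc n)) False"]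
        unfolding G_def eq by (simp add: r_def)
    qed
    ultimately show ?thesis using pq by (intro add_mono mult_left_mono) auto
  qed
  also have "\<dots> = (1 - 2 * p * q) * V (u - u') + p * q * (V (u - u' - r) + V (u - u' + r))"
    unfolding q by (simp add: algebra_simps)
  finally show ?thesis unfolding p_def q_def r_def .
qed

lemma le_mult_one_minus:
  fixes v W X :: real
  assumes "0 \<le> v" "W \<le> X" "0 < X"
  shows "W - v \<le> W * (1 - v / X)"
proof -
  have "v * W \<le> v * X" using assms by (intro mult_left_mono)
  then have "v * W / X \<le> v" using assms by (simp add: field_simps)
  then show ?thesis by (simp add: algebra_simps)
qed

text \<open>
  Start two walks at distance $z = u - u'$ and give them independent coins. Their distance is a
  martingale with steps at most $\eta$. On the right is a barrier for this martingale: the first term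
  pays for stopping at distance at most $\eta$, where $g$ hardly differs, the second one for leaving
  $[0, R]$ at the top, which has probability about $z / R$, and the third one for staying until the
  time $N$. A step lowers $4 R^2 - z^2$ in the mean by the variance, at least $4 / (81 n)$, and hence by
  at least the proportion $1 / (81 R^2 n)$; the product of these losses gives the exponential of
  harmonic numbers. The estimate is proved backwards in time from $N$.
\<close>
lemma harmonic_family_barrier:
  fixes g :: "nat \<Rightarrow> real \<Rightarrow> real" and K c \<eta> R :: real
  assumes bound: "\<And>n u. \<bar>g n u\<bar> \<le> K" and lip: "\<And>n u u'. \<bar>g n u - g n u'\<bar> \<le> c * \<bar>u - u'\<bar>"
    and harmonic: "\<And>n u. g n u = coin_prob (int (Suc n)) False * g (Suc n) (u - log_weight (int (Suc n)) False)
      + coin_prob (int (Suc n)) True * g (Suc n) (u - log_weight (int (Suc n)) True)"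
    and eta: "0 < \<eta>" "\<eta> \<le> R" and small: "\<And>n. n > n0 \<Longrightarrow> log_ratio (int n) \<le> \<eta>"
    and n: "n0 \<le> n" "n \<le> N" and z: "- \<eta> \<le> u - u'" "u - u' \<le> 2 * R"
  shows "\<bar>g n u - g n u'\<bar> \<le> c * \<eta> + 2 * K * (u - u' + \<eta>) / R
      + 2 * K / R\<^sup>2 * exp (- ((harm N - harm n) / (81 * R\<^sup>2))) * (4 * R\<^sup>2 - (u - u')\<^sup>2)"
proof -
  have K: "0 \<le> K" using bound[of 0 0] by linarith
  have R: "0 < R" using eta by simp
  have c: "0 \<le> c" using order_trans[OF abs_ge_zero lip[of 0 1 0]] by simp
  define B where "B n = 2 * K / R\<^sup>2 * exp (- ((harm N - harm n) / (81 * R\<^sup>2)))" for n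
  define V where "V n z = c * \<eta> + 2 * K * (z + \<eta>) / R + B n * (4 * R\<^sup>2 - z\<^sup>2)" for n z
  have B: "0 \<le> B n" for n using K by (simp add: B_def)
  have sq: "z\<^sup>2 \<le> 4 * R\<^sup>2" if "- \<eta> \<le> z" "z \<le> 2 * R" for z
  proof -
    have "\<bar>z\<bar> \<le> 2 * R" using that eta by linarith
    then have "z\<^sup>2 \<le> (2 * R)\<^sup>2" by (metis abs_ge_zero power2_abs power_mono)
    then show ?thesis by (simp add: power_mult_distrib)
  qed
  \<comment> \<open>Outside $[0, R]$ the first or the second term of the barrier is enough.\<close>
  have outside: "\<bar>g n u - g n u'\<bar> \<le> V n (u - u')"
    if z: "- \<eta> \<le> u - u'" "u - u' \<le> 2 * R" and out: "u - u' < 0 \<or> R < u - u'" for n u u'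
  proof -
    have last: "0 \<le> B n * (4 * R\<^sup>2 - (u - u')\<^sup>2)" using B sq[OF z] by simp
    have mid: "0 \<le> 2 * K * (u - u' + \<eta>) / R" using K R z by simp
    show ?thesis
    proof (cases "u - u' < 0")
      case True
      have "\<bar>g n u - g n u'\<bar> \<le> c * \<bar>u - u'\<bar>" by (rule lip)
      also have "\<dots> \<le> c * \<eta>" using True z c by (intro mult_left_mono) auto
      finally show ?thesis unfolding V_def using last mid by linarith
    next
      case False
      then have "R \<le> u - u' + \<eta>" using out eta by simp
      then have "2 * K * R / R \<le> 2 * K * (u - u' + \<eta>) / R"
        using K R by (intro divide_right_mono mult_left_mono) auto
      moreover have "\<bar>g n u - g n u'\<bar> \<le> 2 * K" using bound[of n u] bound[of n u'] by linarith
      moreover have "0 \<le> c * \<eta>" using c eta by simp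
      ultimately show ?thesis unfolding V_def using last R by simp
    qed
  qed
  have "\<bar>g n u - g n u'\<bar> \<le> V n (u - u')" if "n + k = N" "n0 \<le> n" "- \<eta> \<le> u - u'" "u - u' \<le> 2 * R" for n k u u'
    using that
  proof (induction k arbitrary: n u u')
    case 0
    show ?case
    proof (cases "u - u' < 0 \<or> R < u - u'")
      case True
      then show ?thesis using 0 by (intro outside)
    next
      case False
      then have "(u - u')\<^sup>2 \<le> R\<^sup>2" by (intro power_mono) auto
      then have "B n * (3 * R\<^sup>2) \<le> B n * (4 * R\<^sup>2 - (u - u')\<^sup>2)"
        using B by (intro mult_left_mono) auto
      moreover have "B n * (3 * R\<^sup>2) = 6 * K" using 0 R by (simp add: B_def)
      moreover have "\<bar>g n u - g n u'\<bar> \<le> 2 * K" using bound[of n u] bound[of n u'] by linarith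
      moreover have "0 \<le> c * \<eta>" using c eta by simp
      moreover have "0 \<le> 2 * K * (u - u' + \<eta>) / R" using K R 0 by simp
      ultimately show ?thesis unfolding V_def using K by linarith
    qed
  next
    case (Suc k)
    define z where "z = u - u'"
    define r where "r = log_ratio (int (Suc n))"
    define pq where "pq = coin_prob (int (Suc n)) False * coin_prob (int (Suc n)) True"
    have r: "0 \<le> r" "r \<le> \<eta>"
      using small[of "Suc n"] Suc.prems log_ratio_bounds(1)[of "int (Suc n)"] bias_nonneg[of "int (Suc n)"] by (auto simp: r_def)
    show ?case
    proof (cases "u - u' < 0 \<or> R < u - u'")
      case True
      then show ?thesis using Suc.prems by (intro outside)
    next
      case False
      then have z: "0 \<le> z" "z \<le> R" by (auto simp: z_def)
      have "\<bar>g n u - g n u'\<bar> \<le> (1 - 2 * pq) * V (Suc n) z + pq * (V (Suc n) (z - r) + V (Suc n) (z + r))"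
        unfolding z_def pq_def r_def mult.assoc[symmetric]
      proof (rule harmonic_difference[OF harmonic])
        fix w w' assume "w - w' \<in> {u - u', u - u' - log_ratio (int (Suc n)), u - u' + log_ratio (int (Suc n))}"
        then have "- \<eta> \<le> w - w'" "w - w' \<le> 2 * R"
          using z r eta by (auto simp: z_def r_def)
        then show "\<bar>g (Suc n) w - g (Suc n) w'\<bar> \<le> V (Suc n) (w - w')"
          using Suc.prems by (intro Suc.IH) auto
      qed
      also have "\<dots> = c * \<eta> + 2 * K * (z + \<eta>) / R + B (Suc n) * (4 * R\<^sup>2 - z\<^sup>2 - 2 * pq * r\<^sup>2)"
        using R unfolding V_def by (simp add: field_simps power2_eq_square)
      also have "\<dots> \<le> V n z"
      proof -
        let ?W = "4 * R\<^sup>2 - z\<^sup>2" and ?v = "2 * pq * r\<^sup>2"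
        have W: "0 \<le> ?W" "?W \<le> 4 * R\<^sup>2" using sq[of z] z eta R by auto
        have v: "4 / (81 * real (Suc n)) \<le> ?v"
          using ratio_variance_ge[of "int (Suc n)"] by (simp add: ratio_variance_def pq_def r_def mult.assoc)
        then have v0: "0 \<le> ?v" by (rule order_trans[rotated]) simp
        \<comment> \<open>As $W \le 4 R^2$, losing $v$ is at least as much as losing the proportion $v / (4 R^2)$ of it.\<close>
        have "?W - ?v \<le> ?W * (1 - ?v / (4 * R\<^sup>2))"
          using W v0 R by (intro le_mult_one_minus) auto
        also have "\<dots> \<le> ?W * exp (- (?v / (4 * R\<^sup>2)))"
          using W exp_ge_add_one_self[of "- (?v / (4 * R\<^sup>2))"] by (intro mult_left_mono) auto
        also have "\<dots> \<le> ?W * exp (- (1 / (81 * R\<^sup>2 * real (Suc n))))"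
        proof -
          have "1 / (81 * b * a) = 4 / (81 * a) / (4 * b)" for a b :: real by (simp add: divide_simps)
          from this[of "R\<^sup>2" "real (Suc n)"]
          have "1 / (81 * R\<^sup>2 * real (Suc n)) = 4 / (81 * real (Suc n)) / (4 * R\<^sup>2)" .
          also have "\<dots> \<le> ?v / (4 * R\<^sup>2)" using v by (intro divide_right_mono) auto
          finally show ?thesis using W by (intro mult_left_mono) auto
        qed
        finally have "B (Suc n) * (?W - ?v) \<le> B (Suc n) * (?W * exp (- (1 / (81 * R\<^sup>2 * real (Suc n)))))"
          using B by (intro mult_left_mono) auto
        also have "\<dots> = (B (Suc n) * exp (- (1 / (81 * R\<^sup>2 * real (Suc n))))) * ?W"
          by (simp add: ac_simps)
        also have "B (Suc n) * exp (- (1 / (81 * R\<^sup>2 * real (Suc n)))) = B n"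
        proof -
          have "- ((harm N - harm (Suc n)) / (81 * R\<^sup>2)) + - (1 / (81 * R\<^sup>2 * real (Suc n))) = - ((harm N - harm n) / (81 * R\<^sup>2))"
            using R by (simp add: harm_Suc divide_simps) (simp add: algebra_simps)
          then show ?thesis unfolding B_def mult.assoc exp_add[symmetric] by simp
        qed
        finally show ?thesis unfolding V_def by simp
      qed
      finally show ?thesis unfolding z_def .
    qed
  qed
  from this[of n "N - n"] n z show ?thesis by (simp add: V_def B_def)
qed

text \<open>
  In the barrier let first $N$, then $R$ tend to infinity, and finally $\eta$ to 0. The steps are at
  most $\eta$ only from some index on; the recursion carries the bound back to all indices.
\<close>
lemma harmonic_family_constant:
  fixes g :: "nat \<Rightarrow> real \<Rightarrow> real" and K c :: real
  assumes bound: "\<And>n u. \<bar>g n u\<bar> \<le> K" and lip: "\<And>n u u'. \<bar>g n u - g n u'\<bar> \<le> c * \<bar>u - u'\<bar>"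
    and harmonic: "\<And>n u. g n u = coin_prob (int (Suc n)) False * g (Suc n) (u - log_weight (int (Suc n)) False)
      + coin_prob (int (Suc n)) True * g (Suc n) (u - log_weight (int (Suc n)) True)"
  shows "g n u = g n u'"
proof -
  have c: "0 \<le> c" using order_trans[OF abs_ge_zero lip[of 0 1 0]] by simp
  have small: "\<bar>g n u - g n u'\<bar> \<le> c * \<eta>" if eta: "0 < \<eta>" for \<eta> n u u'
  proof -
    \<comment> \<open>The ratio is at most 6 times the bias, that is $n^{-1/2}$.\<close>
    obtain n0 :: nat where n0: "1 / \<eta>\<^sup>2 \<le> real n0" using real_arch_simple by blast
    have ratio: "log_ratio (int n) \<le> \<eta>" if "n > n0" for n
    proof -
      have n: "n \<ge> 1" "1 / \<eta>\<^sup>2 \<le> real n" using that n0 by auto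
      have "1 / \<eta> = sqrt (1 / \<eta>\<^sup>2)" using eta by (simp add: real_sqrt_divide)
      also have "\<dots> \<le> sqrt (real n)" using n by (intro real_sqrt_le_mono)
      finally have "1 / sqrt (real n) \<le> \<eta>" using eta n by (simp add: field_simps)
      moreover have "6 * bias (int n) = 1 / sqrt (real n)" using n by (simp add: bias_pos_eq)
      ultimately show ?thesis using log_ratio_bounds(2)[of "int n"] by simp
    qed
    have pos: "\<bar>g n u - g n u'\<bar> \<le> c * \<eta>" if n: "n0 \<le> n" and z: "0 \<le> u - u'" for n u u'
    proof -
      have R_bound: "\<bar>g n u - g n u'\<bar> \<le> c * \<eta> + 2 * K * (u - u' + \<eta>) / R" if R: "\<eta> \<le> R" "u - u' \<le> R" for R
      proof -
        have R0: "0 < R" using R eta by simp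
        let ?X = "\<lambda>N. c * \<eta> + 2 * K * (u - u' + \<eta>) / R
          + 2 * K / R\<^sup>2 * exp (- ((harm N - harm n) / (81 * R\<^sup>2))) * (4 * R\<^sup>2 - (u - u')\<^sup>2)"
        have "((\<lambda>N. exp (- ((harm N - harm n) / (81 * R\<^sup>2)))) \<longlongrightarrow> 0) sequentially"
        proof (rule filterlim_compose[OF exp_at_bot])
          have "filterlim (\<lambda>N. - harm n + harm N :: real) at_top sequentially"
            by (rule filterlim_tendsto_add_at_top[OF tendsto_const harm_at_top])
          then have "filterlim (\<lambda>N. 1 / (81 * R\<^sup>2) * (- harm n + harm N :: real)) at_top sequentially"
            using R0 by (intro filterlim_tendsto_pos_mult_at_top[OF tendsto_const]) auto
          then show "filterlim (\<lambda>N. - ((harm N - harm n) / (81 * R\<^sup>2))) at_bot sequentially"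
            by (simp add: filterlim_uminus_at_bot)
        qed
        then have "?X \<longlonglongrightarrow> c * \<eta> + 2 * K * (u - u' + \<eta>) / R + 2 * K / R\<^sup>2 * 0 * (4 * R\<^sup>2 - (u - u')\<^sup>2)"
          by (intro tendsto_intros)
        moreover have "\<forall>N\<ge>n. \<bar>g n u - g n u'\<bar> \<le> ?X N"
          using harmonic_family_barrier[OF bound lip harmonic eta R(1) ratio n] z R eta by auto
        ultimately show ?thesis
          using LIMSEQ_le_const[of ?X _ "\<bar>g n u - g n u'\<bar>"] by auto
      qed
      let ?Y = "\<lambda>m::nat. c * \<eta> + 2 * K * (u - u' + \<eta>) / real m"
      have "?Y \<longlonglongrightarrow> c * \<eta> + 0"
        by (intro tendsto_intros tendsto_divide_0[OF tendsto_const] filterlim_at_top_imp_at_infinity filterlim_real_sequentially)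
      moreover obtain m0 :: nat where "max \<eta> (u - u') \<le> real m0" using real_arch_simple by blast
      then have "\<forall>m\<ge>m0. \<bar>g n u - g n u'\<bar> \<le> ?Y m" using R_bound by auto
      ultimately show ?thesis
        using LIMSEQ_le_const[of ?Y _ "\<bar>g n u - g n u'\<bar>"] by auto
    qed
    have large: "\<bar>g n u - g n u'\<bar> \<le> c * \<eta>" if "n0 \<le> n" for n u u'
      using pos[OF that, of u' u] pos[OF that, of u u'] by (cases "u' \<le> u") (auto simp: abs_minus_commute)
    show ?thesis
    proof (cases "n0 \<le> n")
      case False
      then have "n \<le> n0" by simp
      then show ?thesis
      proof (induction arbitrary: u u' rule: inc_induct)
        case base
        then show ?case by (rule large) simp
      next
        case (step n)
        have "\<bar>g n u - g n u'\<bar> \<le> (1 - 2 * coin_prob (int (Suc n)) False * coin_prob (int (Suc n)) True) * (c * \<eta>)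
          + coin_prob (int (Suc n)) False * coin_prob (int (Suc n)) True * (c * \<eta> + c * \<eta>)"
          by (rule harmonic_difference[OF harmonic, where V = "\<lambda>_. c * \<eta>"]) (rule step.IH)
        then show ?case by (simp add: algebra_simps)
      qed
    qed (rule large)
  qed
  have "\<bar>g n u - g n u'\<bar> \<le> 0"
  proof (rule field_le_epsilon)
    fix e :: real assume e: "0 < e"
    have "\<bar>g n u - g n u'\<bar> \<le> c * (e / (c + 1))" using e c by (intro small) simp
    also have "\<dots> \<le> 0 + e" using e c by (simp add: field_simps)
    finally show "\<bar>g n u - g n u'\<bar> \<le> 0 + e" .
  qed
  then show ?thesis by simp
qed

text \<open>
  The amount by which the coordinates up to \<open>M\<close> move the level.
\<close>
definition cylinder_weight :: "nat \<Rightarrow> (int \<Rightarrow> bool) \<Rightarrow> real" where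
  "cylinder_weight M x = (\<Sum>n\<in>{1..int M}. log_weight n (x n))"

lemma cylinder_weight_Suc: "cylinder_weight (Suc M) x = cylinder_weight M x + log_weight (int (Suc M)) (x (int (Suc M)))"
proof -
  have "{1..int (Suc M)} = insert (int (Suc M)) {1..int M}" by auto
  then show ?thesis by (simp add: cylinder_weight_def)
qed

lemma cylinder_weight_mix: "cylinder_weight M (mix {..int M} w x) = cylinder_weight M w"
  unfolding cylinder_weight_def by (intro sum.cong) (auto simp: mix_def)

lemma cylinder_weight_measurable [measurable]: "cylinder_weight M \<in> borel_measurable cantor_borel"
  unfolding cylinder_weight_def
  by (intro borel_measurable_sum coordinate_compose_measurable[OF measurable_ident_sets[OF refl]])

lemma nn_integral_coordinate:
  "(\<integral>\<^sup>+x. \<phi> (x n) \<partial>\<mu>) = \<phi> True * ennreal (coin_prob n True) + \<phi> False * ennreal (coin_prob n False)"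
  using nn_integral_coin_product_prod[where J = "{n}" and f = "\<lambda>_. \<phi>" and p = coin] by (simp add: bernoulli_measure_eq nn_integral_coin)

text \<open>
  The hypothesis says that $p(x, s)$ depends on the coordinates up to $M$ only through
  $s$ minus \<open>cylinder_weight M x\<close>. The integrals of the functions $h_M$ are then a family as in
  \<open>harmonic_family_constant\<close>, so they do not depend on the level. Hence $p(\cdot, s)$ has the same
  mean over all cylinders.
\<close>
lemma level_function_constant:
  fixes p :: "(int \<Rightarrow> bool) \<Rightarrow> real \<Rightarrow> ennreal" and h :: "nat \<Rightarrow> (int \<Rightarrow> bool) \<Rightarrow> real \<Rightarrow> ennreal" and K c :: real
  assumes p_meas [measurable]: "\<And>s. (\<lambda>x. p x s) \<in> borel_measurable \<mu>"
    and p_bound: "\<And>x s. p x s \<le> ennreal K" and K: "0 \<le> K"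
    and p_lip: "\<And>x s s'. p x s \<le> p x s' + ennreal (c * \<bar>s - s'\<bar>)" and c: "0 \<le> c"
    and h_meas [measurable]: "\<And>M. (\<lambda>(x, u). h M x u) \<in> borel_measurable (\<mu> \<Otimes>\<^sub>M borel)"
    and h_eq: "\<And>M. AE x in \<mu>. \<forall>u. p x (u + cylinder_weight M x) = h M x u"
    and h_mix: "\<And>M w x u. h M (mix {..int M} w x) u = h M x u"
  shows "\<exists>\<kappa>. \<forall>s. AE x in \<mu>. p x s = \<kappa>"
proof -
  define G where "G M u = (\<integral>\<^sup>+x. h M x u \<partial>\<mu>)" for M u
  have h_meas1 [measurable]: "(\<lambda>x. h M x u) \<in> borel_measurable \<mu>" for M u
    using measurable_compose[OF measurable_Pair2' h_meas, of u M] by simp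
  have G_meas [measurable]: "G M \<in> borel_measurable borel" for M
    unfolding G_def by measurable
  have G_bound: "G M u \<le> ennreal K" for M u
  proof -
    have "G M u \<le> (\<integral>\<^sup>+x. ennreal K \<partial>\<mu>)"
      unfolding G_def
    proof (rule nn_integral_mono_AE)
      show "AE x in \<mu>. h M x u \<le> ennreal K"
        using h_eq[of M]
      proof eventually_elim
        case (elim x)
        then show ?case using p_bound[of x "u + cylinder_weight M x"] by simp
      qed
    qed
    then show ?thesis using bernoulli.emeasure_space_1 by simp
  qed
  have G_lip: "G M u \<le> G M u' + ennreal (c * \<bar>u - u'\<bar>)" for M u u'
  proof -
    have "G M u \<le> (\<integral>\<^sup>+x. h M x u' + ennreal (c * \<bar>u - u'\<bar>) \<partial>\<mu>)"
      unfolding G_def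
    proof (rule nn_integral_mono_AE)
      show "AE x in \<mu>. h M x u \<le> h M x u' + ennreal (c * \<bar>u - u'\<bar>)"
        using h_eq[of M]
      proof eventually_elim
        case (elim x)
        show ?case
          using p_lip[of x "u + cylinder_weight M x" "u' + cylinder_weight M x"]
          unfolding elim[rule_format] by simp
      qed
    qed
    also have "\<dots> = G M u' + ennreal (c * \<bar>u - u'\<bar>)"
      unfolding G_def using bernoulli.emeasure_space_1 by (subst nn_integral_add) auto
    finally show ?thesis .
  qed
  have mix_int: "(\<integral>\<^sup>+x. \<phi> x \<partial>\<mu>) = (\<integral>\<^sup>+w. \<integral>\<^sup>+x. \<phi> (mix I w x) \<partial>\<mu> \<partial>\<mu>)"
    if "\<phi> \<in> borel_measurable \<mu>" for \<phi> I
  proof (rule nn_integral_mix_law[OF mix_law_bernoulli sets_bernoulli_measure sets_bernoulli_measure bernoulli.sigma_finite_measure_axioms])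
    show "\<phi> \<in> borel_measurable cantor_borel"
      using that unfolding measurable_cong_sets[OF sets_bernoulli_measure refl] .
  qed
  have h_shift_meas: "(\<lambda>x. h M x (v x)) \<in> borel_measurable \<mu>" if [measurable]: "v \<in> borel_measurable \<mu>" for M v
    using measurable_compose[OF _ h_meas, of "\<lambda>x. (x, v x)" \<mu> M] by simp
  have G_harmonic: "G M u = G (Suc M) (u - log_weight (int (Suc M)) True) * ennreal (coin_prob (int (Suc M)) True)
      + G (Suc M) (u - log_weight (int (Suc M)) False) * ennreal (coin_prob (int (Suc M)) False)" for M u
  proof -
    let ?n = "int (Suc M)"
    have [measurable]: "(\<lambda>x. log_weight ?n (x ?n)) \<in> borel_measurable \<mu>"
      unfolding measurable_cong_sets[OF sets_bernoulli_measure refl]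
      by (rule coordinate_compose_measurable[OF measurable_ident_sets[OF refl]])
    have "G M u = (\<integral>\<^sup>+x. h (Suc M) x (u - log_weight ?n (x ?n)) \<partial>\<mu>)"
      unfolding G_def
    proof (rule nn_integral_cong_AE)
      show "AE x in \<mu>. h M x u = h (Suc M) x (u - log_weight ?n (x ?n))"
        using h_eq[of M] h_eq[of "Suc M"]
      proof eventually_elim
        case (elim x)
        have "h M x u = p x (u + cylinder_weight M x)" using elim(1) by simp
        also have "u + cylinder_weight M x = (u - log_weight ?n (x ?n)) + cylinder_weight (Suc M) x"
          by (simp add: cylinder_weight_Suc)
        also have "p x \<dots> = h (Suc M) x (u - log_weight ?n (x ?n))" using elim(2) by blast
        finally show ?case .
      qed
    qed
    \<comment> \<open>The coordinates that \<open>h (Suc M)\<close> does not depend on can be taken from an independent point \<open>w\<close>.\<close>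
    also have "\<dots> = (\<integral>\<^sup>+w. \<integral>\<^sup>+x. h (Suc M) (mix {..?n} w x) (u - log_weight ?n (mix {..?n} w x ?n)) \<partial>\<mu> \<partial>\<mu>)"
      by (rule mix_int, rule h_shift_meas) measurable
    also have "\<dots> = (\<integral>\<^sup>+w. G (Suc M) (u - log_weight ?n (w ?n)) \<partial>\<mu>)"
      unfolding h_mix G_def by (simp add: mix_def)
    also have "\<dots> = G (Suc M) (u - log_weight ?n True) * ennreal (coin_prob ?n True) + G (Suc M) (u - log_weight ?n False) * ennreal (coin_prob ?n False)"
      by (rule nn_integral_coordinate)
    finally show ?thesis .
  qed
  define g where "g M u = enn2real (G M u)" for M u
  have G_g: "G M u = ennreal (g M u)" for M u
  proof -
    have "G M u < top" using G_bound[of M u] ennreal_less_top by (rule order.strict_trans1)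
    then show ?thesis by (simp add: g_def ennreal_enn2real)
  qed
  have g_nonneg: "0 \<le> g M u" for M u by (simp add: g_def)
  have g_const: "g M u = g M u'" for M u u'
  proof (rule harmonic_family_constant[where g = g and K = K and c = c])
    show "\<bar>g M u\<bar> \<le> K" for M u
      using G_bound[of M u] g_nonneg[of M u] K by (simp add: G_g)
    show "\<bar>g M u - g M u'\<bar> \<le> c * \<bar>u - u'\<bar>" for M u u'
    proof -
      have "g M u \<le> g M u' + c * \<bar>u - u'\<bar>" for u u'
        using G_lip[of M u u'] g_nonneg c unfolding G_g
        by (subst (asm) ennreal_plus[symmetric]) (auto simp del: ennreal_plus)
      from this[of u u'] this[of u' u] show ?thesis by (simp add: abs_minus_commute abs_le_iff)
    qed
    show "g M u = coin_prob (int (Suc M)) False * g (Suc M) (u - log_weight (int (Suc M)) False)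
        + coin_prob (int (Suc M)) True * g (Suc M) (u - log_weight (int (Suc M)) True)" for M u
    proof -
      have "ennreal (g M u) = ennreal (coin_prob (int (Suc M)) False * g (Suc M) (u - log_weight (int (Suc M)) False)
        + coin_prob (int (Suc M)) True * g (Suc M) (u - log_weight (int (Suc M)) True))"
        using G_harmonic[of M u] g_nonneg unfolding G_g
        by (simp add: ennreal_mult[symmetric] ennreal_plus[symmetric] mult.commute add.commute del: ennreal_plus of_nat_Suc)
      then show ?thesis using g_nonneg by (subst (asm) ennreal_inj) (auto simp del: of_nat_Suc)
    qed
  qed
  define \<kappa> where "\<kappa> = G 0 0"
  have G_const: "G M u = \<kappa>" for M u
  proof -
    have G_0: "G M u = G M 0" for M u
      using g_const[of M u 0] by (simp only: G_g)
    have "G M 0 = G 0 0"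
    proof (induction M)
      case (Suc M)
      let ?n = "int (Suc M)"
      have "G M 0 = G (Suc M) (0 - log_weight ?n True) * ennreal (coin_prob ?n True)
          + G (Suc M) (0 - log_weight ?n False) * ennreal (coin_prob ?n False)"
        by (rule G_harmonic)
      also have "\<dots> = G (Suc M) 0 * (ennreal (coin_prob ?n True) + ennreal (coin_prob ?n False))"
        by (simp only: G_0[of _ "0 - log_weight ?n True"] G_0[of _ "0 - log_weight ?n False"] distrib_left)
      also have "ennreal (coin_prob ?n True) + ennreal (coin_prob ?n False) = 1"
        using nn_integral_coin[of ?n "\<lambda>_. 1"] by simp
      finally show ?case using Suc by simp
    qed simp
    then show ?thesis using G_0[of M u] by (simp only: \<kappa>_def)
  qed
  have "AE x in coin_product coin. p x s = \<kappa>" for s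
  proof (rule AE_eqI_cylinder)
    show "(\<lambda>x. p x s) \<in> borel_measurable cantor_borel"
      using p_meas[of s] unfolding measurable_cong_sets[OF sets_bernoulli_measure refl] .
    have "(\<integral>\<^sup>+x. p x s \<partial>coin_product coin) \<le> (\<integral>\<^sup>+x. ennreal K \<partial>coin_product coin)"
      by (intro nn_integral_mono p_bound)
    then show "(\<integral>\<^sup>+x. p x s \<partial>coin_product coin) \<noteq> \<infinity>"
      by (auto simp: top_unique)
    fix J :: "int set" and F :: "int \<Rightarrow> bool set" assume J: "finite J"
    let ?E = "{x. \<forall>j\<in>J. x j \<in> F j}"
    have E [measurable]: "?E \<in> sets \<mu>"
      using J by (simp add: sets_bernoulli_measure cylinder_measurable countable_finite)
    obtain M :: nat where M: "J \<subseteq> {..int M}"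
    proof -
      obtain N where "\<forall>i\<in>J. nat \<bar>i\<bar> \<le> N"
        using J finite_nat_set_iff_bounded_le[of "(\<lambda>i. nat \<bar>i\<bar>) ` J"] by auto
      then have "J \<subseteq> {..int N}" by fastforce
      then show ?thesis by (rule that)
    qed
    have E_mix: "mix {..int M} w x \<in> ?E \<longleftrightarrow> w \<in> ?E" for w x
      using M by (auto simp: mix_def)
    have ind_mix: "(indicator ?E (mix {..int M} w x) :: ennreal) = indicator ?E w" for w x
      using E_mix[of w x] by (simp only: indicator_def)
    have [measurable]: "(\<lambda>x. h M x (s - cylinder_weight M x)) \<in> borel_measurable \<mu>"
      by (rule h_shift_meas) measurable
    have "(\<integral>\<^sup>+x. p x s * indicator ?E x \<partial>\<mu>)
        = (\<integral>\<^sup>+x. h M x (s - cylinder_weight M x) * indicator ?E x \<partial>\<mu>)"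
    proof (rule nn_integral_cong_AE)
      show "AE x in \<mu>. p x s * indicator ?E x = h M x (s - cylinder_weight M x) * indicator ?E x"
        using h_eq[of M]
      proof eventually_elim
        case (elim x)
        have "p x s = h M x (s - cylinder_weight M x)"
          using elim[rule_format, of "s - cylinder_weight M x"] by simp
        then show ?case by simp
      qed
    qed
    also have "\<dots> = (\<integral>\<^sup>+w. \<integral>\<^sup>+x. h M (mix {..int M} w x) (s - cylinder_weight M (mix {..int M} w x)) * indicator ?E (mix {..int M} w x) \<partial>\<mu> \<partial>\<mu>)"
      by (rule mix_int) measurable
    also have "\<dots> = (\<integral>\<^sup>+w. G M (s - cylinder_weight M w) * indicator ?E w \<partial>\<mu>)"
      unfolding h_mix cylinder_weight_mix ind_mix G_def by (intro nn_integral_cong nn_integral_multc) measurable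
    also have "\<dots> = (\<integral>\<^sup>+w. \<kappa> * indicator ?E w \<partial>\<mu>)"
      unfolding G_const ..
    finally show "(\<integral>\<^sup>+x. p x s * indicator ?E x \<partial>coin_product coin) = (\<integral>\<^sup>+x. \<kappa> * indicator ?E x \<partial>coin_product coin)"
      unfolding bernoulli_measure_eq .
  qed simp
  then show ?thesis unfolding bernoulli_measure_eq by blast
qed

section \<open>Integrating invariant functions over windows of levels\<close>

lemma additive_bounded_imp_linear:
  fixes k :: "real \<Rightarrow> real"
  assumes add: "\<And>a b. 0 \<le> a \<Longrightarrow> 0 \<le> b \<Longrightarrow> k (a + b) = k a + k b"
    and bounds: "\<And>a. 0 \<le> a \<Longrightarrow> 0 \<le> k a" "\<And>a. 0 \<le> a \<Longrightarrow> k a \<le> a" and a: "0 \<le> a"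
  shows "k a = a * k 1"
proof -
  have mono: "k a \<le> k b" if "0 \<le> a" "a \<le> b" for a b
    using add[of a "b - a"] bounds(1)[of "b - a"] that by simp
  have k0: "k 0 = 0" using bounds(1)[of 0] bounds(2)[of 0] by simp
  have mult: "k (real n * a) = real n * k a" if "0 \<le> a" for n a
  proof (induction n)
    case (Suc n)
    have "k (real (Suc n) * a) = k (real n * a + a)" by (simp add: algebra_simps)
    also have "\<dots> = k (real n * a) + k a" using that by (intro add) auto
    finally show ?case using Suc by (simp add: algebra_simps)
  qed (simp add: k0)
  have k1: "0 \<le> k 1" "k 1 \<le> 1" using bounds(1)[of 1] bounds(2)[of 1] by auto
  have approx: "real n * \<bar>k a - a * k 1\<bar> \<le> 1" for n
  proof -
    define m where "m = nat \<lfloor>real n * a\<rfloor>"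
    have m: "real m \<le> real n * a" "real n * a \<le> real (Suc m)"
      using a by (simp_all add: m_def) linarith
    have "k (real m * 1) \<le> k (real n * a)" using m by (intro mono) auto
    moreover have "k (real n * a) \<le> k (real (Suc m) * 1)" using m a by (intro mono) auto
    ultimately have 1: "real m * k 1 \<le> real n * k a" "real n * k a \<le> real (Suc m) * k 1"
      using mult[of 1 m] mult[of 1 "Suc m"] mult[of a n] a by simp_all
    have 2: "real m * k 1 \<le> real n * a * k 1" "real n * a * k 1 \<le> real (Suc m) * k 1"
      using m k1 by (auto intro!: mult_right_mono simp del: of_nat_Suc)
    have "real (Suc m) * k 1 = real m * k 1 + k 1" by (simp add: algebra_simps)
    then have "\<bar>real n * k a - real n * a * k 1\<bar> \<le> 1" using 1 2 k1 by linarith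
    moreover have "real n * k a - real n * a * k 1 = real n * (k a - a * k 1)" by (simp add: algebra_simps)
    ultimately show ?thesis by (simp add: abs_mult)
  qed
  show ?thesis
  proof (rule ccontr)
    assume "k a \<noteq> a * k 1"
    then have d: "0 < \<bar>k a - a * k 1\<bar>" by simp
    then obtain n :: nat where "1 / \<bar>k a - a * k 1\<bar> < real n" using reals_Archimedean2 by blast
    then have "1 < real n * \<bar>k a - a * k 1\<bar>" using d by (simp add: field_simps)
    then show False using approx[of n] by simp
  qed
qed

text \<open>
  The cocycle of the time $-M$ replaces the first $M$ biased coins by fair ones, and so takes back the
  weight that they contributed.
\<close>
lemma cylinder_weight_tail:
  "cylinder_weight M x + log_cocycle (- int M) x
    = (\<Sum>\<^sub>\<infinity>n. if n > int M then log_weight (n - int M) (x n) - log_weight n (x n) else 0)"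
proof -
  let ?g = "\<lambda>n. if n \<in> {1..int M} then log_weight n (x n) else 0"
  have "?g summable_on {1..int M}" by (rule summable_on_finite) simp
  then have g: "?g summable_on UNIV"
    by (subst summable_on_cong_neutral[where T = "{1..int M}" and g = ?g]) auto
  have "(\<Sum>\<^sub>\<infinity>n. ?g n) = (\<Sum>\<^sub>\<infinity>n\<in>{1..int M}. ?g n)"
    by (rule infsum_cong_neutral) auto
  also have "\<dots> = cylinder_weight M x"
    unfolding cylinder_weight_def by simp
  finally have "cylinder_weight M x + log_cocycle (- int M) x
      = (\<Sum>\<^sub>\<infinity>n. ?g n + (log_weight (n + - int M) (x n) - log_weight n (x n)))"
    unfolding log_cocycle_def by (subst infsum_add[OF g log_cocycle_summable]) simp
  also have "\<dots> = (\<Sum>\<^sub>\<infinity>n. if n > int M then log_weight (n - int M) (x n) - log_weight n (x n) else 0)"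
    by (rule infsum_cong) auto
  finally show ?thesis .
qed

lemma cylinder_weight_tail_mix:
  "cylinder_weight M (mix {..int M} w x) + log_cocycle (- int M) (mix {..int M} w x)
    = cylinder_weight M x + log_cocycle (- int M) x"
  unfolding cylinder_weight_tail by (rule infsum_cong) (simp add: mix_def)

lemma indicator_window_le:
  fixes s s' \<delta> t :: real
  assumes "0 \<le> \<delta>"
  shows "(indicator {s<..s + \<delta>} t :: ennreal) \<le> indicator {s'<..s' + \<delta>} t
    + (indicator {min s s'<..max s s'} t + indicator {min s s' + \<delta><..max s s' + \<delta>} t)"
  using assms by (auto simp: indicator_def min_def max_def)

context skew_product
begin

text \<open>
  Integrating over an interval of levels makes an invariant function Lipschitz in the level, without
  changing how it depends on \<open>x\<close>.
\<close>
definition window :: "'y set \<Rightarrow> real \<Rightarrow> ((int \<Rightarrow> bool) \<times> 'y \<times> real \<Rightarrow> ennreal) \<Rightarrow> (int \<Rightarrow> bool) \<Rightarrow> real \<Rightarrow> ennreal" where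
  "window C \<delta> f x s = (\<integral>\<^sup>+y. indicator C y * (\<integral>\<^sup>+t. indicator {s<..s + \<delta>} t * f (x, y, t) \<partial>lborel) \<partial>Y)"

lemma sets_skew_space: "sets skew_space = sets (\<mu> \<Otimes>\<^sub>M (Y \<Otimes>\<^sub>M borel))"
  by (intro sets_pair_measure_cong sets_level_measure refl)

lemma skew_space_function_measurable:
  assumes f [measurable]: "f \<in> borel_measurable skew_space"
    and [measurable]: "g \<in> N \<rightarrow>\<^sub>M \<mu>" "h \<in> N \<rightarrow>\<^sub>M Y" "k \<in> borel_measurable N"
  shows "(\<lambda>w. f (g w, h w, k w)) \<in> borel_measurable N"
proof -
  have "f \<in> borel_measurable (\<mu> \<Otimes>\<^sub>M (Y \<Otimes>\<^sub>M borel))"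
    using f unfolding measurable_cong_sets[OF sets_skew_space refl] .
  then show ?thesis by (rule measurable_compose[rotated]) measurable
qed

lemma window_inner_measurable:
  assumes f: "f \<in> borel_measurable skew_space" and v [measurable]: "v \<in> borel_measurable \<mu>"
  shows "(\<lambda>((x, u), y). \<integral>\<^sup>+t. indicator {u<..u + \<delta>} t * f (x, y, t + v x) \<partial>lborel) \<in> borel_measurable ((\<mu> \<Otimes>\<^sub>M borel) \<Otimes>\<^sub>M Y)"
proof -
  let ?N = "((\<mu> \<Otimes>\<^sub>M borel) \<Otimes>\<^sub>M Y) \<Otimes>\<^sub>M lborel :: ((((int \<Rightarrow> bool) \<times> real) \<times> 'y) \<times> real) measure"
  have x [measurable]: "(\<lambda>q. fst (fst (fst q))) \<in> ?N \<rightarrow>\<^sub>M \<mu>"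
    by (intro measurable_compose[OF measurable_fst] measurable_fst)
  have u [measurable]: "(\<lambda>q. snd (fst (fst q))) \<in> borel_measurable ?N"
    by (intro measurable_compose[OF measurable_fst] measurable_snd)
  have y [measurable]: "(\<lambda>q. snd (fst q)) \<in> ?N \<rightarrow>\<^sub>M Y"
    by (intro measurable_compose[OF measurable_fst] measurable_snd)
  have t [measurable]: "snd \<in> borel_measurable ?N"
    using measurable_snd[of "(\<mu> \<Otimes>\<^sub>M borel) \<Otimes>\<^sub>M Y" lborel] by simp
  have vx [measurable]: "(\<lambda>q. v (fst (fst (fst q)))) \<in> borel_measurable ?N"
    by (rule measurable_compose[OF x v])
  have 1: "(\<lambda>q. f (fst (fst (fst q)), snd (fst q), snd q + v (fst (fst (fst q))))) \<in> borel_measurable ?N"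
    by (intro skew_space_function_measurable[OF f] x y borel_measurable_add t vx)
  have "(\<lambda>q. if snd (fst (fst q)) < snd q \<and> snd q \<le> snd (fst (fst q)) + \<delta> then 1 else 0 :: ennreal) \<in> borel_measurable ?N"
    by measurable
  moreover have "(if u < t \<and> t \<le> u + \<delta> then 1 else 0) = (indicator {u<..u + \<delta>} t :: ennreal)" for u t :: real
    by (simp add: indicator_def)
  ultimately have 2: "(\<lambda>q. indicator {snd (fst (fst q))<..snd (fst (fst q)) + \<delta>} (snd q) :: ennreal) \<in> borel_measurable ?N"
    by simp
  have "(\<lambda>w. \<integral>\<^sup>+t. indicator {snd (fst w)<..snd (fst w) + \<delta>} t * f (fst (fst w), snd w, t + v (fst (fst w))) \<partial>lborel)
      \<in> borel_measurable ((\<mu> \<Otimes>\<^sub>M borel) \<Otimes>\<^sub>M Y)"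
    using borel_measurable_times_ennreal[OF 2 1]
    by (intro lborel.borel_measurable_nn_integral) (simp add: case_prod_beta')
  then show ?thesis by (simp add: case_prod_beta')
qed

lemma window_translate_measurable:
  assumes f [measurable]: "f \<in> borel_measurable skew_space" and [measurable]: "v \<in> borel_measurable \<mu>"
    and [measurable]: "C \<in> sets Y"
  shows "(\<lambda>(x, u). \<integral>\<^sup>+y. indicator C y * (\<integral>\<^sup>+t. indicator {u<..u + \<delta>} t * f (x, y, t + v x) \<partial>lborel) \<partial>Y) \<in> borel_measurable (\<mu> \<Otimes>\<^sub>M borel)"
proof -
  let ?I = "\<lambda>((x, u), y). \<integral>\<^sup>+t. indicator {u<..u + \<delta>} t * f (x, y, t + v x) \<partial>lborel"
  have "(\<lambda>q. indicator C (snd q) * ?I q) \<in> borel_measurable ((\<mu> \<Otimes>\<^sub>M borel) \<Otimes>\<^sub>M Y)"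
    by (intro borel_measurable_times_ennreal window_inner_measurable assms
        measurable_compose[OF measurable_snd borel_measurable_indicator])
  then have "(\<lambda>w. \<integral>\<^sup>+y. indicator C y * ?I (w, y) \<partial>Y) \<in> borel_measurable (\<mu> \<Otimes>\<^sub>M borel)"
    by (intro Y.borel_measurable_nn_integral) (simp add: case_prod_beta')
  then show ?thesis by (simp add: case_prod_beta')
qed

lemma window_measurable [measurable]:
  assumes f: "f \<in> borel_measurable skew_space" and C: "C \<in> sets Y"
  shows "(\<lambda>x. window C \<delta> f x s) \<in> borel_measurable \<mu>"
  using measurable_compose[OF measurable_Pair2' window_translate_measurable[OF f measurable_const C, of 0 \<delta>], of s]
  by (simp add: window_def)

lemma window_translate:
  assumes f: "f \<in> borel_measurable skew_space" and x: "x \<in> space \<mu>"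
  shows "window C \<delta> f x (u + c) = (\<integral>\<^sup>+y. indicator C y * (\<integral>\<^sup>+t. indicator {u<..u + \<delta>} t * f (x, y, t + c) \<partial>lborel) \<partial>Y)"
  unfolding window_def
proof (rule nn_integral_cong)
  fix y assume y: "y \<in> space Y"
  have [measurable]: "(\<lambda>t. f (x, y, t)) \<in> borel_measurable borel"
    using x y by (intro skew_space_function_measurable[OF f]) auto
  have "(\<integral>\<^sup>+t. indicator {u + c<..u + c + \<delta>} t * f (x, y, t) \<partial>lborel)
      = (\<integral>\<^sup>+t. indicator {u + c<..u + c + \<delta>} (c + 1 * t) * f (x, y, c + 1 * t) \<partial>lborel)"
    by (subst nn_integral_real_affine[where c = 1 and t = c]) auto
  also have "\<dots> = (\<integral>\<^sup>+t. indicator {u<..u + \<delta>} t * f (x, y, t + c) \<partial>lborel)"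
    by (intro nn_integral_cong) (auto simp: indicator_def add.commute)
  finally show "indicator C y * (\<integral>\<^sup>+t. indicator {u + c<..u + c + \<delta>} t * f (x, y, t) \<partial>lborel)
      = indicator C y * (\<integral>\<^sup>+t. indicator {u<..u + \<delta>} t * f (x, y, t + c) \<partial>lborel)" by simp
qed

lemma window_le_lipschitz:
  assumes f: "f \<in> borel_measurable skew_space" and f1: "\<And>z. f z \<le> 1" and C: "C \<in> sets Y" and \<delta>: "0 \<le> \<delta>"
    and x: "x \<in> space \<mu>"
  shows "window C \<delta> f x s \<le> ennreal \<delta>" (is ?bound)
    and "window C \<delta> f x s \<le> window C \<delta> f x s' + ennreal (2 * \<bar>s - s'\<bar>)" (is ?lip)
proof -
  have f_sec: "(\<lambda>t. f (x, y, t)) \<in> borel_measurable borel" if "y \<in> space Y" for y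
    using x that by (intro skew_space_function_measurable[OF f]) auto
  have "window C \<delta> f x s \<le> (\<integral>\<^sup>+y. ennreal \<delta> \<partial>Y)"
    unfolding window_def
  proof (rule nn_integral_mono)
    fix y assume "y \<in> space Y"
    have "indicator C y * (\<integral>\<^sup>+t. indicator {s<..s + \<delta>} t * f (x, y, t) \<partial>lborel) \<le> 1 * (\<integral>\<^sup>+t. indicator {s<..s + \<delta>} t * 1 \<partial>lborel)"
      using f1 by (intro mult_mono nn_integral_mono mult_left_mono) (auto simp: indicator_def)
    then show "indicator C y * (\<integral>\<^sup>+t. indicator {s<..s + \<delta>} t * f (x, y, t) \<partial>lborel) \<le> ennreal \<delta>"
      using \<delta> by simp
  qed
  then show ?bound by (simp add: Y.emeasure_space_1)
  have sec_meas: "(\<lambda>y. \<integral>\<^sup>+t. indicator {u<..u + \<delta>} t * f (x, y, t) \<partial>lborel) \<in> borel_measurable Y" for u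
    using measurable_compose[OF measurable_Pair1' window_inner_measurable[OF f measurable_const, of 0 \<delta>], of "(x, u)"] x
    by (simp add: space_pair_measure)
  have "window C \<delta> f x s \<le> (\<integral>\<^sup>+y. indicator C y * (\<integral>\<^sup>+t. indicator {s'<..s' + \<delta>} t * f (x, y, t) \<partial>lborel) + ennreal (2 * \<bar>s - s'\<bar>) \<partial>Y)"
    unfolding window_def
  proof (rule nn_integral_mono)
    fix y assume y: "y \<in> space Y"
    note [measurable] = f_sec[OF y]
    have "(\<integral>\<^sup>+t. indicator {s<..s + \<delta>} t * f (x, y, t) \<partial>lborel)
        \<le> (\<integral>\<^sup>+t. indicator {s'<..s' + \<delta>} t * f (x, y, t) + (indicator {min s s'<..max s s'} t + indicator {min s s' + \<delta><..max s s' + \<delta>} t) \<partial>lborel)"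
    proof (rule nn_integral_mono)
      fix t
      have "indicator {s<..s + \<delta>} t * f (x, y, t) \<le> (indicator {s'<..s' + \<delta>} t
          + (indicator {min s s'<..max s s'} t + indicator {min s s' + \<delta><..max s s' + \<delta>} t)) * f (x, y, t)"
        by (intro mult_right_mono indicator_window_le \<delta>) simp
      also have "\<dots> = indicator {s'<..s' + \<delta>} t * f (x, y, t)
          + (indicator {min s s'<..max s s'} t + indicator {min s s' + \<delta><..max s s' + \<delta>} t) * f (x, y, t)"
        by (rule distrib_right)
      also have "\<dots> \<le> indicator {s'<..s' + \<delta>} t * f (x, y, t)
          + (indicator {min s s'<..max s s'} t + indicator {min s s' + \<delta><..max s s' + \<delta>} t) * 1"
        by (intro add_left_mono mult_left_mono f1) simp
      finally show "indicator {s<..s + \<delta>} t * f (x, y, t) \<le> indicator {s'<..s' + \<delta>} t * f (x, y, t)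
          + (indicator {min s s'<..max s s'} t + indicator {min s s' + \<delta><..max s s' + \<delta>} t)" by simp
    qed
    also have "\<dots> = (\<integral>\<^sup>+t. indicator {s'<..s' + \<delta>} t * f (x, y, t) \<partial>lborel)
        + (\<integral>\<^sup>+t. indicator {min s s'<..max s s'} t + indicator {min s s' + \<delta><..max s s' + \<delta>} t \<partial>lborel)"
      by (rule nn_integral_add) measurable
    also have "(\<integral>\<^sup>+t. indicator {min s s'<..max s s'} t + indicator {min s s' + \<delta><..max s s' + \<delta>} t \<partial>lborel)
        = ennreal (max s s' - min s s') + ennreal (max s s' - min s s')"
      by (subst nn_integral_add) auto
    also have "\<dots> = ennreal (2 * \<bar>s - s'\<bar>)"
      by (subst ennreal_plus[symmetric]) (auto simp: min_def max_def)
    finally have le: "(\<integral>\<^sup>+t. indicator {s<..s + \<delta>} t * f (x, y, t) \<partial>lborel)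
        \<le> (\<integral>\<^sup>+t. indicator {s'<..s' + \<delta>} t * f (x, y, t) \<partial>lborel) + ennreal (2 * \<bar>s - s'\<bar>)" .
    show "indicator C y * (\<integral>\<^sup>+t. indicator {s<..s + \<delta>} t * f (x, y, t) \<partial>lborel)
        \<le> indicator C y * (\<integral>\<^sup>+t. indicator {s'<..s' + \<delta>} t * f (x, y, t) \<partial>lborel) + ennreal (2 * \<bar>s - s'\<bar>)"
      using le by (cases "y \<in> C") auto
  qed
  also have "\<dots> = window C \<delta> f x s' + ennreal (2 * \<bar>s - s'\<bar>)"
    unfolding window_def using C sec_meas by (subst nn_integral_add) (auto simp: Y.emeasure_space_1)
  finally show ?lip .
qed

lemma AE_level_imp_lborel:
  assumes "AE t in \<nu>. P t"
  shows "AE t in lborel. P t"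
  using assms unfolding level_measure_def by (subst (asm) AE_density) auto

lemma pair_sigma_finite_skew: "pair_sigma_finite \<mu> fibre"
  by (intro pair_sigma_finite.intro bernoulli.sigma_finite_measure_axioms sigma_finite_fibre)

lemma AE_skew_space_sections:
  assumes "AE z in skew_space. P z"
  shows "AE x in \<mu>. AE y in Y. AE t in lborel. P (x, y, t)"
proof -
  have "AE x in \<mu>. AE v in fibre. P (x, v)"
    using assms by (rule pair_sigma_finite.AE_pair[OF pair_sigma_finite_skew])
  then show ?thesis
  proof eventually_elim
    case (elim x)
    then have "AE y in Y. AE t in \<nu>. P (x, y, t)"
      by (rule Yl.AE_pair)
    then show ?case by eventually_elim (rule AE_level_imp_lborel)
  qed
qed

text \<open>
  After $M$ steps of the inverse shift, the coordinates that \<open>past_average 0\<close> depends on are those above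
  $M$. The coordinates up to $M$ only enter through the level.
\<close>
lemma past_average_skew_mix:
  "past_average 0 f (skew (- int M) (mix {..int M} w x, y, t + cylinder_weight M (mix {..int M} w x)))
    = past_average 0 f (skew (- int M) (x, y, t + cylinder_weight M x))"
proof -
  have "mix {0<..} (coord_shift (- int M) (mix {..int M} w x)) x' = mix {0<..} (coord_shift (- int M) x) x'" for x'
    by (auto simp: mix_def coord_shift_def)
  moreover have "t + cylinder_weight M (mix {..int M} w x) + log_cocycle (- int M) (mix {..int M} w x)
      = t + cylinder_weight M x + log_cocycle (- int M) x"
    using cylinder_weight_tail_mix[of M w x] by simp
  ultimately show ?thesis
    unfolding past_average_def skew_def by (simp only: prod.case fst_conv snd_conv of_nat_0 minus_zero)
qed

lemma window_constant:
  assumes f: "f \<in> borel_measurable skew_space" and f1: "\<And>z. f z \<le> 1"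
    and inv: "\<And>k. AE z in skew_space. f (skew k z) = f z" and C: "C \<in> sets Y" and \<delta>: "0 \<le> \<delta>"
  shows "\<exists>\<kappa>. \<forall>s. AE x in \<mu>. window C \<delta> f x s = \<kappa>"
proof -
  \<comment> \<open>A version of $f$ for which the dependence on the coordinates up to $M$ holds at every point.\<close>
  define P where "P M z = past_average 0 f (skew (- int M) z)" for M z
  have P: "P M \<in> borel_measurable skew_space" for M
    unfolding P_def by (rule measurable_compose[OF skew_measurable past_average_measurable[OF f]])
  define h where "h M x u = (\<integral>\<^sup>+y. indicator C y * (\<integral>\<^sup>+t. indicator {u<..u + \<delta>} t * P M (x, y, t + cylinder_weight M x) \<partial>lborel) \<partial>Y)" for M x u
  have cw: "cylinder_weight M \<in> borel_measurable \<mu>" for M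
    by measurable
  show ?thesis
  proof (rule level_function_constant[where c = 2 and K = \<delta> and h = h])
    show "(\<lambda>x. window C \<delta> f x s) \<in> borel_measurable \<mu>" for s
      by (rule window_measurable[OF f C])
    show "window C \<delta> f x s \<le> ennreal \<delta>" "window C \<delta> f x s \<le> window C \<delta> f x s' + ennreal (2 * \<bar>s - s'\<bar>)" for x s s'
      by (rule window_le_lipschitz[OF f f1 C \<delta>]; simp)+
    show "(\<lambda>(x, u). h M x u) \<in> borel_measurable (\<mu> \<Otimes>\<^sub>M borel)" for M
      unfolding h_def by (rule window_translate_measurable[OF P cw C])
    show "h M (mix {..int M} w x) u = h M x u" for M w x u
      unfolding h_def P_def past_average_skew_mix ..
    show "AE x in \<mu>. \<forall>u. window C \<delta> f x (u + cylinder_weight M x) = h M x u" for M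
      using AE_skew_space_sections[OF invariant_eq_past_average_skew[OF f f1 inv, of "- int M"]]
    proof eventually_elim
      case (elim x)
      have eq: "window C \<delta> f x s = window C \<delta> (P M) x s" for s
        unfolding window_def
      proof (rule nn_integral_cong_AE)
        show "AE y in Y. indicator C y * (\<integral>\<^sup>+t. indicator {s<..s + \<delta>} t * f (x, y, t) \<partial>lborel)
          = indicator C y * (\<integral>\<^sup>+t. indicator {s<..s + \<delta>} t * P M (x, y, t) \<partial>lborel)"
          using elim
        proof eventually_elim
          case (elim y)
          then have "(\<integral>\<^sup>+t. indicator {s<..s + \<delta>} t * f (x, y, t) \<partial>lborel) = (\<integral>\<^sup>+t. indicator {s<..s + \<delta>} t * P M (x, y, t) \<partial>lborel)"
            by (intro nn_integral_cong_AE) (auto simp: P_def elim!: eventually_mono)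
          then show ?case by simp
        qed
      qed
      show ?case
      proof
        fix u
        have "window C \<delta> (P M) x (u + cylinder_weight M x) = h M x u"
          unfolding h_def by (rule window_translate[OF P]) simp
        then show "window C \<delta> f x (u + cylinder_weight M x) = h M x u" by (simp add: eq)
      qed
    qed
  qed (use \<delta> in auto)
qed

end

section \<open>Invariant functions come from the base\<close>

lemma Int_stable_Ioc: "Int_stable (range (\<lambda>(a, b). {a<..b::real}))"
proof (rule Int_stableI)
  fix A B :: "real set"
  assume "A \<in> range (\<lambda>(a, b). {a<..b})" "B \<in> range (\<lambda>(a, b). {a<..b})"
  then obtain a b c d where "A = {a<..b}" "B = {c<..d}" by auto
  then have "A \<inter> B = {max a c<..min b d}" by auto
  then show "A \<inter> B \<in> range (\<lambda>(a, b). {a<..b})" by auto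
qed

lemma borel_measure_eqI_Ioc:
  fixes P Q :: "real measure"
  assumes P: "sets P = sets borel" and Q: "sets Q = sets borel"
    and eq: "\<And>a b. a \<le> b \<Longrightarrow> emeasure P {a<..b} = emeasure Q {a<..b}"
    and fin: "\<And>a b. a \<le> b \<Longrightarrow> emeasure P {a<..b} \<noteq> \<infinity>"
  shows "P = Q"
proof (rule measure_eqI_generator_eq[OF Int_stable_Ioc])
  show "range (\<lambda>(a, b). {a<..b::real}) \<subseteq> Pow UNIV" by simp
  have "sets borel = sigma_sets UNIV (range (\<lambda>(a, b). {a<..b::real}))"
    by (subst borel_sigma_sets_Ioc) simp
  then show "sets P = sigma_sets UNIV (range (\<lambda>(a, b). {a<..b::real}))"
    "sets Q = sigma_sets UNIV (range (\<lambda>(a, b). {a<..b::real}))"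
    using P Q by simp_all
  show "emeasure P X = emeasure Q X" if X: "X \<in> range (\<lambda>(a, b). {a<..b})" for X
  proof -
    obtain a b where "X = {a<..b}" using X by auto
    then show ?thesis using eq[of a b] by (cases "a \<le> b") auto
  qed
  show "range (\<lambda>i::nat. {- real i<..real i}) \<subseteq> range (\<lambda>(a, b). {a<..b})" by auto
  show "(\<Union>i::nat. {- real i<..real i}) = UNIV"
  proof (intro set_eqI iffI)
    fix t :: real
    obtain n :: nat where "\<bar>t\<bar> < real n" using reals_Archimedean2 by blast
    then show "t \<in> (\<Union>i::nat. {- real i<..real i})" by (intro UN_I[of n]) auto
  qed simp
  show "emeasure P {- real i<..real i} \<noteq> \<infinity>" for i :: nat
    by (rule fin) simp
qed

context skew_product
begin

lemma window_section_measurable: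
  assumes f: "f \<in> borel_measurable skew_space" and x: "x \<in> space \<mu>"
  shows "(\<lambda>y. \<integral>\<^sup>+t. indicator {u<..u + \<delta>} t * f (x, y, t) \<partial>lborel) \<in> borel_measurable Y"
  using measurable_compose[OF measurable_Pair1' window_inner_measurable[OF f measurable_const, of 0 \<delta>], of "(x, u)"] x
  by (simp add: space_pair_measure)

definition window_mean :: "'y set \<Rightarrow> real \<Rightarrow> ((int \<Rightarrow> bool) \<times> 'y \<times> real \<Rightarrow> ennreal) \<Rightarrow> ennreal" where
  "window_mean C \<delta> f = (\<integral>\<^sup>+x. window C \<delta> f x 0 \<partial>\<mu>)"

lemma window_eq_mean:
  assumes f: "f \<in> borel_measurable skew_space" and f1: "\<And>z. f z \<le> 1"
    and inv: "\<And>k. AE z in skew_space. f (skew k z) = f z" and C: "C \<in> sets Y" and \<delta>: "0 \<le> \<delta>"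
  shows "AE x in \<mu>. window C \<delta> f x s = window_mean C \<delta> f"
proof -
  obtain \<kappa> where \<kappa>: "\<And>s. AE x in \<mu>. window C \<delta> f x s = \<kappa>"
    using window_constant[OF f f1 inv C \<delta>] by blast
  have "window_mean C \<delta> f = (\<integral>\<^sup>+x. \<kappa> \<partial>\<mu>)"
    unfolding window_mean_def by (rule nn_integral_cong_AE) (rule \<kappa>)
  also have "\<dots> = \<kappa>" using bernoulli.emeasure_space_1 by simp
  finally show ?thesis using \<kappa> by simp
qed

lemma window_mean_le:
  assumes f: "f \<in> borel_measurable skew_space" and f1: "\<And>z. f z \<le> 1" and C: "C \<in> sets Y" and \<delta>: "0 \<le> \<delta>"
  shows "window_mean C \<delta> f \<le> ennreal \<delta>"
proof -
  have "window_mean C \<delta> f \<le> (\<integral>\<^sup>+x. ennreal \<delta> \<partial>\<mu>)"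
    unfolding window_mean_def by (intro nn_integral_mono window_le_lipschitz(1) assms)
  then show ?thesis using bernoulli.emeasure_space_1 by simp
qed

lemma window_mean_add:
  assumes f: "f \<in> borel_measurable skew_space" and f1: "\<And>z. f z \<le> 1"
    and inv: "\<And>k. AE z in skew_space. f (skew k z) = f z" and C: "C \<in> sets Y" and \<delta>: "0 \<le> \<delta>" "0 \<le> \<delta>'"
  shows "window_mean C (\<delta> + \<delta>') f = window_mean C \<delta> f + window_mean C \<delta>' f"
proof -
  have split: "window C (\<delta> + \<delta>') f x 0 = window C \<delta> f x 0 + window C \<delta>' f x \<delta>" if x: "x \<in> space \<mu>" for x
  proof -
    let ?I = "\<lambda>s \<delta> y. \<integral>\<^sup>+t. indicator {s<..s + \<delta>} t * f (x, y, t) \<partial>lborel"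
    have "?I 0 (\<delta> + \<delta>') y = ?I 0 \<delta> y + ?I \<delta> \<delta>' y" if y: "y \<in> space Y" for y
    proof -
      have [measurable]: "(\<lambda>t. f (x, y, t)) \<in> borel_measurable borel"
        using x y by (intro skew_space_function_measurable[OF f]) auto
      have "?I 0 \<delta> y + ?I \<delta> \<delta>' y = (\<integral>\<^sup>+t. indicator {0<..0 + \<delta>} t * f (x, y, t) + indicator {\<delta><..\<delta> + \<delta>'} t * f (x, y, t) \<partial>lborel)"
        by (rule nn_integral_add[symmetric]) measurable
      also have "\<dots> = ?I 0 (\<delta> + \<delta>') y"
        using \<delta> by (intro nn_integral_cong) (auto simp: indicator_def)
      finally show ?thesis ..
    qed
    then have "window C (\<delta> + \<delta>') f x 0 = (\<integral>\<^sup>+y. indicator C y * ?I 0 \<delta> y + indicator C y * ?I \<delta> \<delta>' y \<partial>Y)"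
      unfolding window_def by (intro nn_integral_cong) (simp add: distrib_left)
    also have "\<dots> = window C \<delta> f x 0 + window C \<delta>' f x \<delta>"
      unfolding window_def
      by (intro nn_integral_add borel_measurable_times_ennreal window_section_measurable f x borel_measurable_indicator C)
    finally show ?thesis .
  qed
  have "window_mean C (\<delta> + \<delta>') f = (\<integral>\<^sup>+x. window C \<delta> f x 0 + window C \<delta>' f x \<delta> \<partial>\<mu>)"
    unfolding window_mean_def by (intro nn_integral_cong split)
  also have "\<dots> = window_mean C \<delta> f + (\<integral>\<^sup>+x. window C \<delta>' f x \<delta> \<partial>\<mu>)"
    unfolding window_mean_def by (intro nn_integral_add window_measurable f C)
  also have "(\<integral>\<^sup>+x. window C \<delta>' f x \<delta> \<partial>\<mu>) = (\<integral>\<^sup>+x. window_mean C \<delta>' f \<partial>\<mu>)"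
    by (rule nn_integral_cong_AE) (rule window_eq_mean[OF f f1 inv C \<delta>(2)])
  also have "\<dots> = window_mean C \<delta>' f" using bernoulli.emeasure_space_1 by simp
  finally show ?thesis .
qed

text \<open>
  The mean does not depend on the position of the window, so it is additive in its length.
\<close>
lemma window_mean_linear:
  assumes f: "f \<in> borel_measurable skew_space" and f1: "\<And>z. f z \<le> 1"
    and inv: "\<And>k. AE z in skew_space. f (skew k z) = f z" and C: "C \<in> sets Y" and \<delta>: "0 \<le> \<delta>"
  shows "window_mean C \<delta> f = ennreal \<delta> * window_mean C 1 f"
proof -
  define k where "k a = enn2real (window_mean C a f)" for a
  have k: "window_mean C a f = ennreal (k a)" if "0 \<le> a" for a
  proof -
    have "window_mean C a f < top" using window_mean_le[OF f f1 C that] ennreal_less_top by (rule order.strict_trans1)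
    then show ?thesis by (simp add: k_def ennreal_enn2real)
  qed
  have k_nonneg: "0 \<le> k a" for a by (simp add: k_def)
  have "k \<delta> = \<delta> * k 1"
  proof (rule additive_bounded_imp_linear[OF _ _ _ \<delta>])
    show "k (a + b) = k a + k b" if "0 \<le> a" "0 \<le> b" for a b
      using window_mean_add[OF f f1 inv C that] that k_nonneg
      by (simp add: k ennreal_plus[symmetric] del: ennreal_plus)
    show "k a \<le> a" if "0 \<le> a" for a
      using window_mean_le[OF f f1 C that] that by (simp add: k)
  qed (rule k_nonneg)
  then show ?thesis using \<delta> k_nonneg by (simp add: k ennreal_mult)
qed

lemma nn_integral_iterated:
  assumes f: "f \<in> borel_measurable skew_space" and D [measurable]: "D \<in> sets \<mu>" and C [measurable]: "C \<in> sets Y"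
    and g [measurable]: "g \<in> borel_measurable borel"
  shows "(\<integral>\<^sup>+z. indicator D (fst z) * indicator C (fst (snd z)) * g (snd (snd z)) * f z \<partial>skew_space)
    = (\<integral>\<^sup>+x. indicator D x * (\<integral>\<^sup>+y. indicator C y * (\<integral>\<^sup>+t. g t * f (x, y, t) \<partial>\<nu>) \<partial>Y) \<partial>\<mu>)"
proof -
  note [measurable] = f
  have "(\<integral>\<^sup>+z. indicator D (fst z) * indicator C (fst (snd z)) * g (snd (snd z)) * f z \<partial>skew_space)
    = (\<integral>\<^sup>+x. \<integral>\<^sup>+y. \<integral>\<^sup>+t. indicator D x * indicator C y * g t * f (x, y, t) \<partial>\<nu> \<partial>Y \<partial>\<mu>)"
    by (subst nn_integral_total) auto
  also have "\<dots> = (\<integral>\<^sup>+x. indicator D x * (\<integral>\<^sup>+y. indicator C y * (\<integral>\<^sup>+t. g t * f (x, y, t) \<partial>\<nu>) \<partial>Y) \<partial>\<mu>)"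
  proof (rule nn_integral_cong)
    fix x assume x: "x \<in> space \<mu>"
    have "(\<integral>\<^sup>+y. \<integral>\<^sup>+t. indicator D x * indicator C y * g t * f (x, y, t) \<partial>\<nu> \<partial>Y)
        = (\<integral>\<^sup>+y. indicator D x * (indicator C y * (\<integral>\<^sup>+t. g t * f (x, y, t) \<partial>\<nu>)) \<partial>Y)"
      by (intro nn_integral_cong) (auto simp: indicator_def)
    also have "\<dots> = indicator D x * (\<integral>\<^sup>+y. indicator C y * (\<integral>\<^sup>+t. g t * f (x, y, t) \<partial>\<nu>) \<partial>Y)"
      by (cases "x \<in> D") auto
    finally show "(\<integral>\<^sup>+y. \<integral>\<^sup>+t. indicator D x * indicator C y * g t * f (x, y, t) \<partial>\<nu> \<partial>Y)
      = indicator D x * (\<integral>\<^sup>+y. indicator C y * (\<integral>\<^sup>+t. g t * f (x, y, t) \<partial>\<nu>) \<partial>Y)" .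
  qed
  finally show ?thesis .
qed

text \<open>
  For fixed sets \<open>D\<close> and \<open>C\<close> the integral is a measure in the variable of levels which, after removal of
  the density $e^{-s}$, gives the same mass to intervals of the same length: it is a multiple of
  Lebesgue measure.
\<close>
lemma invariant_rectangle_integral:
  assumes f: "f \<in> borel_measurable skew_space" and f1: "\<And>z. f z \<le> 1"
    and inv: "\<And>k. AE z in skew_space. f (skew k z) = f z"
    and D [measurable]: "D \<in> sets \<mu>" and C [measurable]: "C \<in> sets Y" and w [measurable]: "w \<in> borel_measurable borel"
  shows "(\<integral>\<^sup>+z. indicator D (fst z) * indicator C (fst (snd z)) * w (snd (snd z)) * f z \<partial>skew_space)
    = emeasure \<mu> D * window_mean C 1 f * (\<integral>\<^sup>+t. w t \<partial>\<nu>)"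
proof -
  let ?c = "emeasure \<mu> D * window_mean C 1 f"
  \<comment> \<open>The factor $e^t$ cancels the density of \<open>\<nu>\<close>, so that intervals of levels count with their length.\<close>
  let ?d = "\<lambda>z. indicator D (fst z) * indicator C (fst (snd z)) * ennreal (exp (snd (snd z))) * f z"
  define \<rho> where "\<rho> = distr (density skew_space ?d) borel (\<lambda>z. snd (snd z))"
  note [measurable] = f
  have int_\<rho>: "(\<integral>\<^sup>+t. g t \<partial>\<rho>) = (\<integral>\<^sup>+z. indicator D (fst z) * indicator C (fst (snd z)) * (ennreal (exp (snd (snd z))) * g (snd (snd z))) * f z \<partial>skew_space)"
    if [measurable]: "g \<in> borel_measurable borel" for g
  proof -
    have "(\<integral>\<^sup>+t. g t \<partial>\<rho>) = (\<integral>\<^sup>+z. g (snd (snd z)) \<partial>density skew_space ?d)"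
      unfolding \<rho>_def by (rule nn_integral_distr) measurable
    also have "\<dots> = (\<integral>\<^sup>+z. ?d z * g (snd (snd z)) \<partial>skew_space)"
      by (rule nn_integral_density) measurable
    finally show ?thesis by (simp add: ac_simps)
  qed
  have interval: "emeasure \<rho> {a<..b} = ennreal (b - a) * ?c" if ab: "a \<le> b" for a b
  proof -
    have "emeasure \<rho> {a<..b} = (\<integral>\<^sup>+t. indicator {a<..b} t \<partial>\<rho>)"
      by (simp add: \<rho>_def)
    also have "\<dots> = (\<integral>\<^sup>+x. indicator D x * (\<integral>\<^sup>+y. indicator C y * (\<integral>\<^sup>+t. (ennreal (exp t) * indicator {a<..b} t) * f (x, y, t) \<partial>\<nu>) \<partial>Y) \<partial>\<mu>)"
      by (subst int_\<rho>, measurable) (rule nn_integral_iterated[OF f D C], measurable)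
    also have "\<dots> = (\<integral>\<^sup>+x. indicator D x * window C (b - a) f x a \<partial>\<mu>)"
    proof (rule nn_integral_cong)
      fix x assume x: "x \<in> space \<mu>"
      have "(\<integral>\<^sup>+y. indicator C y * (\<integral>\<^sup>+t. (ennreal (exp t) * indicator {a<..b} t) * f (x, y, t) \<partial>\<nu>) \<partial>Y) = window C (b - a) f x a"
        unfolding window_def
      proof (rule nn_integral_cong)
        fix y assume y: "y \<in> space Y"
        have [measurable]: "(\<lambda>t. f (x, y, t)) \<in> borel_measurable borel"
          using x y by (intro skew_space_function_measurable[OF f]) auto
        have "(\<integral>\<^sup>+t. (ennreal (exp t) * indicator {a<..b} t) * f (x, y, t) \<partial>\<nu>)
            = (\<integral>\<^sup>+t. ennreal (exp (- t)) * ((ennreal (exp t) * indicator {a<..b} t) * f (x, y, t)) \<partial>lborel)"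
          by (rule nn_integral_level_measure) measurable
        also have "\<dots> = (\<integral>\<^sup>+t. indicator {a<..a + (b - a)} t * f (x, y, t) \<partial>lborel)"
          by (intro nn_integral_cong) (simp add: mult.assoc[symmetric] ennreal_mult[symmetric] exp_minus)
        finally show "indicator C y * (\<integral>\<^sup>+t. (ennreal (exp t) * indicator {a<..b} t) * f (x, y, t) \<partial>\<nu>)
            = indicator C y * (\<integral>\<^sup>+t. indicator {a<..a + (b - a)} t * f (x, y, t) \<partial>lborel)" by simp
      qed
      then show "indicator D x * (\<integral>\<^sup>+y. indicator C y * (\<integral>\<^sup>+t. (ennreal (exp t) * indicator {a<..b} t) * f (x, y, t) \<partial>\<nu>) \<partial>Y)
        = indicator D x * window C (b - a) f x a" by simp
    qed
    also have "\<dots> = (\<integral>\<^sup>+x. indicator D x * window_mean C (b - a) f \<partial>\<mu>)"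
      using window_eq_mean[OF f f1 inv C, of "b - a" a] ab by (intro nn_integral_cong_AE) auto
    also have "\<dots> = emeasure \<mu> D * window_mean C (b - a) f"
      by (subst nn_integral_multc) auto
    also have "\<dots> = ennreal (b - a) * ?c"
      using ab by (subst window_mean_linear[OF f f1 inv C]) (auto simp: ac_simps)
    finally show ?thesis .
  qed
  have c_fin: "?c < \<infinity>"
  proof -
    have "window_mean C 1 f \<le> ennreal 1" by (rule window_mean_le[OF f f1 C]) simp
    then have "window_mean C 1 f < top" using ennreal_less_top by (rule order.strict_trans1)
    moreover have "emeasure \<mu> D < top"
      using bernoulli.emeasure_finite[of D] by (simp add: less_top[symmetric])
    ultimately show ?thesis by (simp add: ennreal_mult_less_top)
  qed
  have "\<rho> = density lborel (\<lambda>_. ?c)"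
  proof (rule borel_measure_eqI_Ioc)
    show "emeasure \<rho> {a<..b} = emeasure (density lborel (\<lambda>_. ?c)) {a<..b}" if "a \<le> b" for a b
      using that by (simp add: interval emeasure_density nn_integral_cmult nn_integral_multc) (rule mult.commute)
    have "ennreal r * e \<noteq> \<infinity>" if "e < \<infinity>" for r e
      using that by (auto simp: ennreal_mult_eq_top_iff)
    then show "emeasure \<rho> {a<..b} \<noteq> \<infinity>" if "a \<le> b" for a b
      unfolding interval[OF that] using c_fin by blast
  qed (simp_all add: \<rho>_def)
  then have "(\<integral>\<^sup>+t. ennreal (exp (- t)) * w t \<partial>\<rho>) = ?c * (\<integral>\<^sup>+t. w t \<partial>\<nu>)"
    by (simp add: nn_integral_density nn_integral_cmult nn_integral_level_measure)
  moreover have "(\<integral>\<^sup>+t. ennreal (exp (- t)) * w t \<partial>\<rho>)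
      = (\<integral>\<^sup>+z. indicator D (fst z) * indicator C (fst (snd z)) * w (snd (snd z)) * f z \<partial>skew_space)"
    by (subst int_\<rho>, measurable, intro nn_integral_cong) (simp add: mult.assoc[symmetric] ennreal_mult[symmetric] exp_minus)
  ultimately show ?thesis by simp
qed

text \<open>
  The only possible value at $y$ of an invariant function, namely its mean over $x$ and a window of
  length 1. The interval is written as in \<open>window\<close>.
\<close>
definition base_part :: "((int \<Rightarrow> bool) \<times> 'y \<times> real \<Rightarrow> ennreal) \<Rightarrow> 'y \<Rightarrow> ennreal" where
  "base_part f y = (\<integral>\<^sup>+x. \<integral>\<^sup>+t. indicator {0<..0 + 1} t * f (x, y, t) \<partial>lborel \<partial>\<mu>)"

lemma window_pair_measurable:
  assumes f: "f \<in> borel_measurable skew_space"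
  shows "(\<lambda>(x, y). \<integral>\<^sup>+t. indicator {u<..u + \<delta>} t * f (x, y, t) \<partial>lborel) \<in> borel_measurable (\<mu> \<Otimes>\<^sub>M Y)"
proof -
  have "(\<lambda>w. ((fst w, u), snd w)) \<in> \<mu> \<Otimes>\<^sub>M Y \<rightarrow>\<^sub>M (\<mu> \<Otimes>\<^sub>M borel) \<Otimes>\<^sub>M Y"
    by measurable
  from measurable_compose[OF this window_inner_measurable[OF f measurable_const, of 0 \<delta>]]
  show ?thesis by (simp add: case_prod_beta')
qed

lemma base_part_measurable [measurable]:
  assumes f: "f \<in> borel_measurable skew_space"
  shows "base_part f \<in> borel_measurable Y"
proof -
  have "(\<lambda>w. ((snd w, 0), fst w)) \<in> Y \<Otimes>\<^sub>M \<mu> \<rightarrow>\<^sub>M (\<mu> \<Otimes>\<^sub>M borel) \<Otimes>\<^sub>M Y"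
    by measurable
  from measurable_compose[OF this window_inner_measurable[OF f measurable_const, of 0 1]]
  show ?thesis
    unfolding base_part_def by (intro bernoulli.borel_measurable_nn_integral) (simp add: case_prod_beta')
qed

lemma nn_integral_base_part:
  assumes f: "f \<in> borel_measurable skew_space" and C [measurable]: "C \<in> sets Y"
  shows "(\<integral>\<^sup>+y. indicator C y * base_part f y \<partial>Y) = window_mean C 1 f"
proof -
  interpret BY: pair_sigma_finite \<mu> Y ..
  note [measurable] = window_pair_measurable[OF f, of 0 1]
  let ?I = "\<lambda>(x, y). \<integral>\<^sup>+t. indicator {0<..0 + 1} t * f (x, y, t) \<partial>lborel"
  have "(\<integral>\<^sup>+y. indicator C y * base_part f y \<partial>Y) = (\<integral>\<^sup>+y. \<integral>\<^sup>+x. indicator C y * ?I (x, y) \<partial>\<mu> \<partial>Y)"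
    unfolding base_part_def
  proof (rule nn_integral_cong)
    fix y assume "y \<in> space Y"
    show "indicator C y * (\<integral>\<^sup>+x. \<integral>\<^sup>+t. indicator {0<..0 + 1} t * f (x, y, t) \<partial>lborel \<partial>\<mu>)
        = (\<integral>\<^sup>+x. indicator C y * ?I (x, y) \<partial>\<mu>)"
      by (cases "y \<in> C") auto
  qed
  also have "\<dots> = (\<integral>\<^sup>+x. \<integral>\<^sup>+y. indicator C y * ?I (x, y) \<partial>Y \<partial>\<mu>)"
  proof -
    have "(\<lambda>w. indicator C (snd w) * ?I w) \<in> borel_measurable (\<mu> \<Otimes>\<^sub>M Y)"
      by (intro borel_measurable_times_ennreal window_pair_measurable f
          measurable_compose[OF measurable_snd borel_measurable_indicator] C)
    from BY.Fubini[OF this] show ?thesis by simp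
  qed
  also have "\<dots> = window_mean C 1 f"
    by (simp add: window_mean_def window_def)
  finally show ?thesis .
qed

lemma emeasure_level_Ioc_finite: "emeasure \<nu> {- real m<..real m} < \<infinity>"
proof -
  have "emeasure \<nu> {- real m<..real m} \<le> emeasure \<nu> {- real m..}"
    by (rule emeasure_mono) (auto simp: sets_level_measure)
  also have "\<dots> < \<infinity>" by (simp add: emeasure_level_measure_ge)
  finally show ?thesis .
qed

lemma invariant_eq_base_part:
  assumes f: "f \<in> borel_measurable skew_space" and f1: "\<And>z. f z \<le> 1"
    and inv: "\<And>k. AE z in skew_space. f (skew k z) = f z"
  shows "AE z in skew_space. f z = base_part f (fst (snd z))"
proof -
  note [measurable] = f base_part_measurable[OF f]
  interpret Z: pair_sigma_finite \<mu> fibre by (rule pair_sigma_finite_skew)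
  have "AE z in skew_space. indicator {- real m<..real m} (snd (snd z)) * f z
      = indicator {- real m<..real m} (snd (snd z)) * base_part f (fst (snd z))" for m :: nat
  proof -
    let ?i = "indicator {- real m<..real m} :: real \<Rightarrow> ennreal"
    let ?F = "\<lambda>z. ?i (snd (snd z)) * f z" and ?G = "\<lambda>z. ?i (snd (snd z)) * base_part f (fst (snd z))"
    show ?thesis
    proof (rule AE_eqI_rectangles[OF bernoulli.sigma_finite_measure_axioms sigma_finite_fibre])
      have "(\<integral>\<^sup>+z. ?F z \<partial>skew_space) \<le> (\<integral>\<^sup>+z. ?i (snd (snd z)) \<partial>skew_space)"
        using f1 by (intro nn_integral_mono) (auto simp: indicator_def)
      also have "\<dots> = emeasure \<nu> {- real m<..real m}"
        using bernoulli.emeasure_space_1 by (subst nn_integral_total) (auto simp: Y.emeasure_space_1)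
      finally show "(\<integral>\<^sup>+z. ?F z \<partial>skew_space) \<noteq> \<infinity>"
        using emeasure_level_Ioc_finite[of m] by (auto simp: top_unique)
    next
      fix D d assume D [measurable]: "D \<in> sets \<mu>" and d [measurable]: "d \<in> sets fibre"
      define F1 where "F1 v = (\<integral>\<^sup>+x. indicator D x * ?F (x, v) \<partial>\<mu>)" for v
      define G1 where "G1 v = emeasure \<mu> D * (?i (snd v) * base_part f (fst v))" for v
      have F1 [measurable]: "F1 \<in> borel_measurable fibre" unfolding F1_def by measurable
      have G1 [measurable]: "G1 \<in> borel_measurable fibre" unfolding G1_def by measurable
      have swap: "(\<integral>\<^sup>+z. u z * indicator (D \<times> e) z \<partial>skew_space) = (\<integral>\<^sup>+v. (\<integral>\<^sup>+x. indicator D x * u (x, v) \<partial>\<mu>) * indicator e v \<partial>fibre)"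
        if [measurable]: "u \<in> borel_measurable skew_space" "e \<in> sets fibre" for u e
      proof -
        have "(\<integral>\<^sup>+z. u z * indicator (D \<times> e) z \<partial>skew_space) = (\<integral>\<^sup>+v. \<integral>\<^sup>+x. u (x, v) * indicator (D \<times> e) (x, v) \<partial>\<mu> \<partial>fibre)"
          by (rule Z.nn_integral_snd[symmetric]) measurable
        also have "\<dots> = (\<integral>\<^sup>+v. (\<integral>\<^sup>+x. indicator D x * u (x, v) \<partial>\<mu>) * indicator e v \<partial>fibre)"
          by (intro nn_integral_cong) (auto simp: indicator_def intro!: nn_integral_cong)
        finally show ?thesis .
      qed
      have "AE v in fibre. F1 v = G1 v"
      proof (rule AE_eqI_rectangles[OF Y.sigma_finite_measure_axioms sigma_finite_level_measure F1 G1])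
        have "(\<integral>\<^sup>+v. F1 v \<partial>fibre) \<le> (\<integral>\<^sup>+v. ?i (snd v) \<partial>fibre)"
        proof (rule nn_integral_mono)
          fix v
          have "F1 v \<le> (\<integral>\<^sup>+x. ?i (snd v) \<partial>\<mu>)"
            unfolding F1_def using f1 by (intro nn_integral_mono) (auto simp: indicator_def)
          then show "F1 v \<le> ?i (snd v)" using bernoulli.emeasure_space_1 by simp
        qed
        also have "\<dots> = emeasure \<nu> {- real m<..real m}"
          by (subst level.nn_integral_fst[symmetric]) (auto simp: Y.emeasure_space_1)
        finally show "(\<integral>\<^sup>+v. F1 v \<partial>fibre) \<noteq> \<infinity>"
          using emeasure_level_Ioc_finite[of m] by (auto simp: top_unique)
      next
        fix C S assume C [measurable]: "C \<in> sets Y" and "S \<in> sets \<nu>"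
        then have S [measurable]: "S \<in> sets borel" by (simp add: sets_level_measure)
        have "(\<integral>\<^sup>+v. F1 v * indicator (C \<times> S) v \<partial>fibre) = (\<integral>\<^sup>+z. ?F z * indicator (D \<times> (C \<times> S)) z \<partial>skew_space)"
          unfolding F1_def by (rule swap[symmetric]) measurable
        also have "\<dots> = (\<integral>\<^sup>+z. indicator D (fst z) * indicator C (fst (snd z)) * (?i (snd (snd z)) * indicator S (snd (snd z))) * f z \<partial>skew_space)"
          by (intro nn_integral_cong) (auto simp: indicator_def)
        also have "\<dots> = emeasure \<mu> D * window_mean C 1 f * (\<integral>\<^sup>+t. ?i t * indicator S t \<partial>\<nu>)"
          by (rule invariant_rectangle_integral[OF f f1 inv D C]) measurable
        also have "\<dots> = (\<integral>\<^sup>+y. \<integral>\<^sup>+t. emeasure \<mu> D * (indicator C y * base_part f y) * (?i t * indicator S t) \<partial>\<nu> \<partial>Y)"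
          by (simp add: nn_integral_cmult nn_integral_multc nn_integral_base_part[OF f C])
        also have "\<dots> = (\<integral>\<^sup>+v. G1 v * indicator (C \<times> S) v \<partial>fibre)"
          by (subst level.nn_integral_fst[symmetric], measurable, intro nn_integral_cong) (auto simp: G1_def indicator_def)
        finally show "(\<integral>\<^sup>+v. F1 v * indicator (C \<times> S) v \<partial>fibre) = (\<integral>\<^sup>+v. G1 v * indicator (C \<times> S) v \<partial>fibre)" .
      qed
      have "(\<integral>\<^sup>+z. ?F z * indicator (D \<times> d) z \<partial>skew_space) = (\<integral>\<^sup>+v. F1 v * indicator d v \<partial>fibre)"
        unfolding F1_def by (rule swap) measurable
      also have "\<dots> = (\<integral>\<^sup>+v. G1 v * indicator d v \<partial>fibre)"
        using \<open>AE v in fibre. F1 v = G1 v\<close> by (intro nn_integral_cong_AE) auto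
      also have "\<dots> = (\<integral>\<^sup>+z. ?G z * indicator (D \<times> d) z \<partial>skew_space)"
        by (subst swap) (auto simp: G1_def nn_integral_multc)
      finally show "(\<integral>\<^sup>+z. ?F z * indicator (D \<times> d) z \<partial>skew_space) = (\<integral>\<^sup>+z. ?G z * indicator (D \<times> d) z \<partial>skew_space)" .
    qed measurable
  qed
  then have "AE z in skew_space. \<forall>m::nat. indicator {- real m<..real m} (snd (snd z)) * f z
      = indicator {- real m<..real m} (snd (snd z)) * base_part f (fst (snd z))"
    by (subst AE_all_countable) auto
  then show ?thesis
  proof eventually_elim
    case (elim z)
    obtain m :: nat where "\<bar>snd (snd z)\<bar> < real m" using reals_Archimedean2 by blast
    then have "snd (snd z) \<in> {- real m<..real m}" by auto
    then show ?case using elim[rule_format, of m] by simp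
  qed
qed

lemma AE_base:
  assumes "AE z in skew_space. P (fst (snd z))"
  shows "AE y in Y. P y"
proof -
  have "AE x in \<mu>. AE y in Y. AE t in (lborel :: real measure). P y"
    using AE_skew_space_sections[OF assms] by (simp only: fst_conv snd_conv)
  then have "AE x in \<mu>. AE y in Y. P y"
  proof eventually_elim
    case (elim x)
    then show ?case
    proof eventually_elim
      case (elim y)
      show ?case
      proof (rule ccontr)
        assume "\<not> P y"
        then have "AE t in (lborel :: real measure). t \<notin> UNIV" using elim by simp
        then have "(UNIV :: real set) \<in> null_sets lborel" by (subst AE_iff_null_sets) auto
        then show False using null_setsD1 by fastforce
      qed
    qed
  qed
  then show ?thesis by simp
qed

lemma AE_lift_base:
  assumes "AE y in Y. P y"
  shows "AE z in skew_space. P (fst (snd z))"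
proof -
  obtain N where N: "N \<in> null_sets Y" "{y \<in> space Y. \<not> P y} \<subseteq> N"
    using assms by (auto simp: eventually_ae_filter)
  then have [measurable]: "N \<in> sets Y" by auto
  have "(\<integral>\<^sup>+z. indicator N (fst (snd z)) \<partial>skew_space) = (\<integral>\<^sup>+x. \<integral>\<^sup>+y. \<integral>\<^sup>+t. indicator N y \<partial>\<nu> \<partial>Y \<partial>\<mu>)"
    by (subst nn_integral_total) auto
  also have "\<dots> = 0"
    using null_setsD1[OF N(1)] by (simp add: nn_integral_multc)
  finally have "AE z in skew_space. indicator N (fst (snd z)) = (0 :: ennreal)"
    by (subst (asm) nn_integral_0_iff_AE) auto
  then show ?thesis
    using AE_space by eventually_elim (use N in \<open>auto simp: space_pair_measure indicator_def split: if_splits\<close>)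
qed

text \<open>
  Up to a null set an invariant set is the preimage of a set \<open>C\<close> in the base, which is then invariant.
\<close>
theorem ergodic_skew:
  assumes A [measurable]: "A \<in> sets skew_space" and inv: "\<And>k. AE z in skew_space. skew k z \<in> A \<longleftrightarrow> z \<in> A"
    and Y: "ergodic_action b Y"
  shows "A \<in> null_sets skew_space \<or> space skew_space - A \<in> null_sets skew_space"
proof -
  let ?f = "indicator A :: _ \<Rightarrow> ennreal"
  have f: "?f \<in> borel_measurable skew_space" by measurable
  have f1: "?f z \<le> 1" for z by (simp add: indicator_def)
  have f_inv: "AE z in skew_space. ?f (skew k z) = ?f z" for k
    using inv[of k] by eventually_elim (simp add: indicator_def)
  \<comment> \<open>Almost everywhere \<open>base_part\<close> takes the values of an indicator.\<close>
  define C where "C = {y \<in> space Y. base_part ?f y = 1}"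
  have C [measurable]: "C \<in> sets Y"
    unfolding C_def using base_part_measurable[OF f] by measurable
  have A_C: "AE z in skew_space. z \<in> A \<longleftrightarrow> fst (snd z) \<in> C"
    using invariant_eq_base_part[OF f f1 f_inv] AE_space
  proof eventually_elim
    case (elim z)
    then show ?case by (cases "z \<in> A") (auto simp: C_def space_pair_measure)
  qed
  have "AE y in Y. b k y \<in> C \<longleftrightarrow> y \<in> C" for k
  proof (rule AE_base)
    show "AE z in skew_space. b k (fst (snd z)) \<in> C \<longleftrightarrow> fst (snd z) \<in> C"
      using A_C AE_skew[OF A_C, of k] inv[of k] by eventually_elim (auto simp: skew_def)
  qed
  then have "sym_diff (b k -` C \<inter> space Y) C \<in> null_sets Y" for k
  proof -
    have [measurable]: "b k -` C \<inter> space Y \<in> sets Y" by measurable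
    have "AE y in Y. y \<notin> sym_diff (b k -` C \<inter> space Y) C"
      using \<open>AE y in Y. b k y \<in> C \<longleftrightarrow> y \<in> C\<close> AE_space by eventually_elim auto
    then show ?thesis by (subst AE_iff_null_sets) auto
  qed
  then have "C \<in> null_sets Y \<or> space Y - C \<in> null_sets Y"
    using Y C unfolding ergodic_action_def by blast
  then show ?thesis
  proof
    assume "C \<in> null_sets Y"
    then have "AE y in Y. y \<notin> C" by (rule AE_not_in)
    then have "AE z in skew_space. fst (snd z) \<notin> C"
      using AE_lift_base by blast
    then have "AE z in skew_space. z \<notin> A" using A_C by eventually_elim simp
    then show ?thesis using AE_iff_null_sets[OF A] by simp
  next
    assume "space Y - C \<in> null_sets Y"
    then have "AE y in Y. y \<notin> space Y - C" by (rule AE_not_in)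
    then have "AE z in skew_space. fst (snd z) \<notin> space Y - C"
      using AE_lift_base by blast
    then have "AE z in skew_space. z \<notin> space skew_space - A"
      using A_C AE_space by eventually_elim (auto simp: space_pair_measure)
    then show ?thesis by (subst (asm) AE_iff_null_sets[symmetric]) auto
  qed
qed

end

section \<open>Ergodicity of the Maharam extension and its products\<close>

lemma maharam_measure_eq: "maharam_measure M = M \<Otimes>\<^sub>M \<nu>"
  by (simp add: maharam_measure_def level_measure_def)

lemma sigma_finite_maharam_bernoulli: "sigma_finite_measure (\<mu> \<Otimes>\<^sub>M \<nu>)"
proof -
  interpret level: sigma_finite_measure \<nu> by (rule sigma_finite_level_measure)
  interpret pair_sigma_finite \<mu> \<nu> ..
  show ?thesis ..
qed

context skew_product
begin

definition swap_base :: "(int \<Rightarrow> bool) \<times> 'y \<times> real \<Rightarrow> 'y \<times> (int \<Rightarrow> bool) \<times> real" where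
  "swap_base = (\<lambda>(x, y, s). (y, x, s))"

lemma swap_base_measurable [measurable]: "swap_base \<in> skew_space \<rightarrow>\<^sub>M Y \<Otimes>\<^sub>M (\<mu> \<Otimes>\<^sub>M \<nu>)"
  unfolding swap_base_def by measurable

lemma distr_swap_base:
  "distr skew_space (Y \<Otimes>\<^sub>M (\<mu> \<Otimes>\<^sub>M \<nu>)) swap_base = Y \<Otimes>\<^sub>M (\<mu> \<Otimes>\<^sub>M \<nu>)"
    (is "distr _ ?W _ = _")
proof (rule measure_eqI)
  interpret BY: pair_sigma_finite \<mu> Y ..
  interpret W: sigma_finite_measure "\<mu> \<Otimes>\<^sub>M \<nu>" by (rule sigma_finite_maharam_bernoulli)
  fix A assume "A \<in> sets (distr skew_space ?W swap_base)"
  then have A [measurable]: "A \<in> sets ?W" by simp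
  let ?I = "\<lambda>w. \<integral>\<^sup>+s. indicator A (snd w, fst w, s) \<partial>\<nu>"
  have I: "?I \<in> borel_measurable (\<mu> \<Otimes>\<^sub>M Y)"
    by measurable
  have "emeasure (distr skew_space ?W swap_base) A = (\<integral>\<^sup>+w. indicator A w \<partial>distr skew_space ?W swap_base)"
    by simp
  also have "\<dots> = (\<integral>\<^sup>+z. indicator A (swap_base z) \<partial>skew_space)"
    by (rule nn_integral_distr) measurable
  also have "\<dots> = (\<integral>\<^sup>+x. \<integral>\<^sup>+y. ?I (x, y) \<partial>Y \<partial>\<mu>)"
    by (subst nn_integral_total) (auto simp: swap_base_def)
  also have "\<dots> = (\<integral>\<^sup>+y. \<integral>\<^sup>+x. ?I (x, y) \<partial>\<mu> \<partial>Y)"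
    by (rule BY.Fubini[OF I, symmetric])
  also have "\<dots> = (\<integral>\<^sup>+y. \<integral>\<^sup>+v. indicator A (y, v) \<partial>(\<mu> \<Otimes>\<^sub>M \<nu>) \<partial>Y)"
  proof (rule nn_integral_cong)
    fix y assume [measurable]: "y \<in> space Y"
    show "(\<integral>\<^sup>+x. ?I (x, y) \<partial>\<mu>) = (\<integral>\<^sup>+v. indicator A (y, v) \<partial>(\<mu> \<Otimes>\<^sub>M \<nu>))"
      by (subst level.nn_integral_fst[symmetric]) auto
  qed
  also have "\<dots> = (\<integral>\<^sup>+w. indicator A w \<partial>?W)"
    by (rule W.nn_integral_fst) measurable
  finally show "emeasure (distr skew_space ?W swap_base) A = emeasure ?W A" by simp
qed simp

lemma AE_lift_first:
  assumes "AE x in \<mu>. P x"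
  shows "AE z in skew_space. P (fst z)"
proof -
  obtain N where N: "N \<in> null_sets \<mu>" "{x \<in> space \<mu>. \<not> P x} \<subseteq> N"
    using assms by (auto simp: eventually_ae_filter)
  then have [measurable]: "N \<in> sets \<mu>" by auto
  have "(\<integral>\<^sup>+z. indicator N (fst z) \<partial>skew_space) = (\<integral>\<^sup>+x. \<integral>\<^sup>+y. \<integral>\<^sup>+t. indicator N x \<partial>\<nu> \<partial>Y \<partial>\<mu>)"
    by (subst nn_integral_total) auto
  also have "\<dots> = 0"
    using null_setsD1[OF N(1)] by (simp add: nn_integral_multc)
  finally have "AE z in skew_space. indicator N (fst z) = (0 :: ennreal)"
    by (subst (asm) nn_integral_0_iff_AE) auto
  then show ?thesis
    using AE_space by eventually_elim (use N in \<open>auto simp: space_pair_measure indicator_def split: if_splits\<close>)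
qed

text \<open>
  The explicit cocycle agrees with the Radon-Nikodym derivative almost everywhere, which is enough as
  invariance is only required up to null sets.
\<close>
theorem ergodic_diagonal_maharam:
  assumes Y: "ergodic_action b Y"
  shows "ergodic_action (diagonal_action b (maharam_extension bernoulli_action \<mu>))
    (Y \<Otimes>\<^sub>M maharam_measure \<mu>)"
  unfolding maharam_measure_eq ergodic_action_def
proof (intro ballI impI)
  let ?W = "Y \<Otimes>\<^sub>M (\<mu> \<Otimes>\<^sub>M \<nu>)"
  let ?T = "diagonal_action b (maharam_extension bernoulli_action \<mu>)"
  fix A assume A [measurable]: "A \<in> sets ?W" and inv: "\<forall>g. sym_diff (?T g -` A \<inter> space ?W) A \<in> null_sets ?W"
  define A' where "A' = swap_base -` A \<inter> space skew_space"
  have A' [measurable]: "A' \<in> sets skew_space" unfolding A'_def by measurable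
  have swap_space: "swap_base z \<in> space ?W" if "z \<in> space skew_space" for z
    using measurable_space[OF swap_base_measurable that] .
  have "AE z in skew_space. skew k z \<in> A' \<longleftrightarrow> z \<in> A'" for k
  proof -
    have "AE w in distr skew_space ?W swap_base. w \<notin> sym_diff (?T k -` A \<inter> space ?W) A"
      unfolding distr_swap_base using inv by (intro AE_not_in) blast
    then have "AE z in skew_space. swap_base z \<notin> sym_diff (?T k -` A \<inter> space ?W) A"
      by (rule AE_distrD[OF swap_base_measurable])
    then show ?thesis
      using AE_lift_first[OF rn_cocycle_bernoulli[of k]] AE_space
    proof eventually_elim
      case (elim z)
      have "?T k (swap_base z) = swap_base (skew k z)"
        using elim(2)
        by (auto simp: diagonal_action_def maharam_extension_def swap_base_def skew_def bernoulli_action_eq split: prod.splits)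
      then show ?case
        using elim(1,3) swap_space[OF elim(3)] skew_in_space[OF elim(3), of k] by (auto simp: A'_def)
    qed
  qed
  then have "A' \<in> null_sets skew_space \<or> space skew_space - A' \<in> null_sets skew_space"
    by (rule ergodic_skew[OF A' _ Y])
  moreover have null: "B \<in> null_sets ?W" if "swap_base -` B \<inter> space skew_space \<in> null_sets skew_space" "B \<in> sets ?W" for B
  proof -
    have "emeasure ?W B = emeasure (distr skew_space ?W swap_base) B" by (simp only: distr_swap_base)
    also have "\<dots> = 0" using that by (subst emeasure_distr) auto
    finally show ?thesis using that by auto
  qed
  moreover have "swap_base -` (space ?W - A) \<inter> space skew_space = space skew_space - A'"
    using swap_space by (auto simp: A'_def)
  ultimately show "A \<in> null_sets ?W \<or> space ?W - A \<in> null_sets ?W"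
    using null[of A] null[of "space ?W - A"] A sets.compl_sets[OF A] unfolding A'_def[symmetric] by argo
qed

end

lemma weakly_mixing_maharam_bernoulli:
  "weakly_mixing TYPE('y) (maharam_extension bernoulli_action \<mu>) (maharam_measure \<mu>)"
  unfolding weakly_mixing_def
proof (intro allI impI)
  fix Y :: "'y measure" and b :: "int \<Rightarrow> 'y \<Rightarrow> 'y"
  assume *: "standard_borel_space Y \<and> prob_space Y \<and> measure_preserving_action b Y \<and> ergodic_action b Y"
  then have Y: "prob_space Y" "measure_preserving_action b Y" "ergodic_action b Y" by blast+
  interpret skew_product Y b by (rule skew_product.intro[OF Y(1,2)])
  show "ergodic_action (diagonal_action b (maharam_extension bernoulli_action \<mu>))
    (Y \<Otimes>\<^sub>M maharam_measure \<mu>)"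
    by (rule ergodic_diagonal_maharam[OF Y(3)])
qed

text \<open>
  The product with the trivial action on one point.
\<close>
lemma ergodic_maharam_bernoulli:
  "ergodic_action (maharam_extension bernoulli_action \<mu>) (maharam_measure \<mu>)"
    (is "ergodic_action ?T ?M")
  unfolding ergodic_action_def
proof (intro ballI impI)
  define U where "U = (count_space UNIV :: unit measure)"
  define b where "b = (\<lambda>(k :: int) (u :: unit). u)"
  have U: "prob_space U" unfolding U_def by (rule prob_spaceI) simp
  have pmp: "measure_preserving_action b U"
  proof -
    have "distr U U (b k) = U" for k unfolding b_def by (rule distr_id2) simp
    then show ?thesis
      by (simp add: measure_preserving_action_def measurable_action_def) (simp add: b_def U_def)
  qed
  have erg: "ergodic_action b U"
    unfolding ergodic_action_def
  proof (intro ballI impI)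
    fix C :: "unit set"
    have "C = {} \<or> C = UNIV" by (auto simp: UNIV_unit)
    then show "C \<in> null_sets U \<or> space U - C \<in> null_sets U" by (auto simp: U_def)
  qed
  interpret skew_product U b
    by (rule skew_product.intro[OF U pmp])
  interpret M: sigma_finite_measure ?M
    unfolding maharam_measure_eq by (rule sigma_finite_maharam_bernoulli)
  have null_iff: "UNIV \<times> B \<in> null_sets (U \<Otimes>\<^sub>M ?M) \<longleftrightarrow> B \<in> null_sets ?M" if "B \<in> sets ?M" for B
  proof -
    have "emeasure (U \<Otimes>\<^sub>M ?M) (UNIV \<times> B) = emeasure U UNIV * emeasure ?M B"
      using that by (intro M.emeasure_pair_measure_Times) (auto simp: U_def)
    also have "emeasure U UNIV = 1" by (simp add: U_def)
    finally show ?thesis using that by (auto simp: null_sets_def U_def)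
  qed
  fix A assume A: "A \<in> sets ?M" and inv: "\<forall>g. sym_diff (?T g -` A \<inter> space ?M) A \<in> null_sets ?M"
  have "sym_diff (diagonal_action b ?T g -` (UNIV \<times> A) \<inter> space (U \<Otimes>\<^sub>M ?M)) (UNIV \<times> A) \<in> null_sets (U \<Otimes>\<^sub>M ?M)" for g
  proof -
    have "sym_diff (diagonal_action b ?T g -` (UNIV \<times> A) \<inter> space (U \<Otimes>\<^sub>M ?M)) (UNIV \<times> A)
        = UNIV \<times> sym_diff (?T g -` A \<inter> space ?M) A"
      by (auto simp: diagonal_action_def space_pair_measure U_def)
    moreover have "sym_diff (?T g -` A \<inter> space ?M) A \<in> null_sets ?M"
      using inv by blast
    ultimately show ?thesis using null_iff[OF null_setsD2] by (simp only:)
  qed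
  moreover have "UNIV \<times> A \<in> sets (U \<Otimes>\<^sub>M ?M)" using A by (auto simp: U_def)
  ultimately have "UNIV \<times> A \<in> null_sets (U \<Otimes>\<^sub>M ?M) \<or> space (U \<Otimes>\<^sub>M ?M) - UNIV \<times> A \<in> null_sets (U \<Otimes>\<^sub>M ?M)"
    using ergodic_diagonal_maharam[OF erg] unfolding ergodic_action_def by blast
  moreover have "space (U \<Otimes>\<^sub>M ?M) - UNIV \<times> A = UNIV \<times> (space ?M - A)"
    by (auto simp: space_pair_measure U_def)
  ultimately show "A \<in> null_sets ?M \<or> space ?M - A \<in> null_sets ?M"
    by (simp only: null_iff[OF A] null_iff[OF sets.compl_sets[OF A]])
qed

text \<open>
  An invariant set times the line is invariant under the Maharam extension.
\<close>
lemma ergodic_bernoulli_action: "ergodic_action bernoulli_action \<mu>"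
  unfolding ergodic_action_def
proof (intro ballI impI)
  let ?T = "maharam_extension bernoulli_action \<mu>" and ?M = "maharam_measure \<mu>"
  interpret level: sigma_finite_measure \<nu> by (rule sigma_finite_level_measure)
  have times: "emeasure ?M (B \<times> UNIV) = emeasure \<mu> B * emeasure \<nu> UNIV" if "B \<in> sets \<mu>" for B
    unfolding maharam_measure_eq using that by (intro level.emeasure_pair_measure_Times) (auto simp: sets_level_measure)
  have sets: "B \<times> UNIV \<in> sets ?M" if "B \<in> sets \<mu>" for B
    unfolding maharam_measure_eq using that by (auto simp: sets_level_measure)
  have "emeasure \<nu> {- 0..} \<le> emeasure \<nu> UNIV"
    by (rule emeasure_mono) (auto simp: sets_level_measure)
  then have "emeasure \<nu> UNIV \<noteq> 0"
    unfolding emeasure_level_measure_ge by auto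
  then have null_iff: "B \<times> UNIV \<in> null_sets ?M \<longleftrightarrow> B \<in> null_sets \<mu>" if "B \<in> sets \<mu>" for B
    using times[OF that] sets[OF that] that by (auto simp: null_sets_def)
  fix A assume A: "A \<in> sets \<mu>"
    and inv: "\<forall>g. sym_diff (bernoulli_action g -` A \<inter> space \<mu>) A \<in> null_sets \<mu>"
  have space: "space ?M = UNIV" by (simp add: maharam_measure_eq space_pair_measure)
  have "sym_diff (?T g -` (A \<times> UNIV) \<inter> space ?M) (A \<times> UNIV) \<in> null_sets ?M" for g
  proof -
    have "sym_diff (?T g -` (A \<times> UNIV) \<inter> space ?M) (A \<times> UNIV)
        = sym_diff (bernoulli_action g -` A \<inter> space \<mu>) A \<times> UNIV"
      by (auto simp: maharam_extension_def space)
    moreover have "sym_diff (bernoulli_action g -` A \<inter> space \<mu>) A \<in> null_sets \<mu>"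
      using inv by blast
    ultimately show ?thesis using null_iff[OF null_setsD2] by (simp only:)
  qed
  then have "A \<times> UNIV \<in> null_sets ?M \<or> space ?M - A \<times> UNIV \<in> null_sets ?M"
    using ergodic_maharam_bernoulli sets[OF A] unfolding ergodic_action_def by blast
  moreover have "space ?M - A \<times> UNIV = (space \<mu> - A) \<times> UNIV"
    by (auto simp: space)
  ultimately show "A \<in> null_sets \<mu> \<or> space \<mu> - A \<in> null_sets \<mu>"
    by (simp only: null_iff[OF A] null_iff[OF sets.compl_sets[OF A]])
qed

no_notation bernoulli_measure ("\<mu>")

theorem corollary6p3:
  shows "nonsingular_action bernoulli_action bernoulli_measure \<and>
    essentially_free bernoulli_action bernoulli_measure \<and>
    ergodic_action bernoulli_action bernoulli_measure \<and>
    type_III_1 bernoulli_action bernoulli_measure \<and>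
    weakly_mixing TYPE('y) (maharam_extension bernoulli_action bernoulli_measure) (maharam_measure bernoulli_measure) \<and>
    (\<forall>m\<ge>73. dissipative_action
       (generated_action (power_measure m bernoulli_measure) (power_transformation m bernoulli_shift))
       (power_measure m bernoulli_measure))"
  unfolding type_III_1_def
  using nonsingular_bernoulli_action essentially_free_bernoulli_action ergodic_bernoulli_action
    ergodic_maharam_bernoulli weakly_mixing_maharam_bernoulli dissipative_power_action
  by blast

end
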